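(* Let $n\ge 1$ and $m\ge 0$ be integers. Let $\mathcal{T}$ be an additive category which is $(n+2)$-angulated with $n$-suspension functor $\Sigma_n$. Let $\{\mathfrak{a}_p\}_{p\in\mathbb{Z}}$ be additive subcategories of $\mathcal{T}$ satisfying: (a) $\operatorname{Hom}_{\mathcal{T}}(\mathfrak{a}_p,\mathfrak{a}_q)=0$ for $q\notin\{p,p+1\}$; (b) if $t\in\mathcal{T}$ then $t\cong a_s\oplus a_{s-1}\oplus\cdots\oplus a_i$ for some integers $s\ge i$ and objects $a_j\in\mathfrak{a}_j$; (c) $\mathfrak{a}_j=\Sigma_n^j\mathfrak{a}_0$ for all $j\in\mathbb{Z}$. For $i\le j$ set $\mathcal{T}[i,j]:=\operatorname{add}(\mathfrak{a}_i,\mathfrak{a}_{i+1},\dots,\mathfrak{a}_j)$. Assume further that $\mathfrak{a}_0$ has split idempotents and that $\mathcal{T}[0,m+1]$ is closed under $n$-extensions. Then the truncated subcategory $\mathcal{T}[0,m]$ of $\mathcal{T}$ is a $d$-abelian category where $d=(n+2)(m+1)-2$.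
   Context: Subcategories are full. $\operatorname{add}(\mathfrak{a}_i,\dots,\mathfrak{a}_j)$ is the full subcategory of direct summands of finite direct sums of objects from $\mathfrak{a}_i,\dots,\mathfrak{a}_j$. Closed under $n$-extensions: $\mathcal{T}[0,m+1]$ is closed under $n$-extensions if for every morphism $\delta:t^{n+1}\to\Sigma_nt^0$ with $t^0,t^{n+1}\in\mathcal{T}[0,m+1]$ there is an $(n+2)$-angle $t^0\to t^1\to\cdots\to t^n\to t^{n+1}\xrightarrow{\delta}\Sigma_nt^0$ in $\mathcal{T}$ with $t^1,\dots,t^n\in\mathcal{T}[0,m+1]$. $(n+2)$-angulated category (Geiss–Keller–Oppermann): an additive category $\mathcal{T}$ with an automorphism $\Sigma_n$ and a class of sequences $X^0\xrightarrow{f^0}X^1\to\cdots\to X^{n+1}\xrightarrow{f^{n+1}}\Sigma_nX^0$, called $(n+2)$-angles, such that: (F1) the class is closed under isomorphisms, finite direct sums and direct summands; for each $X$ the sequence $X\xrightarrow{\mathrm{id}}X\to 0\to\cdots\to 0\to\Sigma_nX$ is an $(n+2)$-angle; each morphism $X^0\to X^1$ is the first morphism of some $(n+2)$-angle. (F2) The sequence $(f^0,\dots,f^{n+1})$ is an $(n+2)$-angle if and only if its rotation $X^1\xrightarrow{f^1}\cdots\xrightarrow{f^{n+1}}\Sigma_nX^0\xrightarrow{(-1)^n\Sigma_nf^0}\Sigma_nX^1$ is. (F3) Given two $(n+2)$-angles $(X,f)$, $(Y,g)$ and $\varphi^0,\varphi^1$ with $g^0\varphi^0=\varphi^1f^0$,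 there are $\varphi^2,\dots,\varphi^{n+1}$ making $(\varphi^0,\dots,\varphi^{n+1},\Sigma_n\varphi^0)$ a morphism of sequences. (F4) In (F3) the $\varphi^i$ can be chosen such that the mapping cone $X^1\oplus Y^0\to X^2\oplus Y^1\to\cdots\to\Sigma_nX^0\oplus Y^{n+1}\to\Sigma_nX^1\oplus\Sigma_nY^0$, with differentials $\begin{pmatrix}-f^{i+1}&0\\ \varphi^{i+1}&g^i\end{pmatrix}$ (where $f^{n+2}=\Sigma_nf^0$, $\varphi^{n+2}=\Sigma_n\varphi^0$), is an $(n+2)$-angle. Let $d\ge 1$ be an integer and let $\mathcal{M}$ be an additive category. A $d$-cokernel of a morphism $f_0:X_0\to X_1$ is a sequence $X_1\xrightarrow{f_1}X_2\to\cdots\xrightarrow{f_d}X_{d+1}$ such that for every $Y\in\mathcal{M}$ the sequence $0\to\mathcal{M}(X_{d+1},Y)\to\mathcal{M}(X_d,Y)\to\cdots\to\mathcal{M}(X_1,Y)\to\mathcal{M}(X_0,Y)$ of abelian groups is exact. Dually, a $d$-kernel of $f_d:X_d\to X_{d+1}$ is a sequence $X_0\xrightarrow{f_0}X_1\to\cdots\xrightarrow{f_{d-1}}X_d$ such that $0\to\mathcal{M}(Y,X_0)\to\cdots\to\mathcal{M}(Y,X_d)\to\mathcal{M}(Y,X_{d+1})$ is exact for every $Y\in\mathcal{M}$. A sequence $X_0\xrightarrow{f_0}X_1\to\cdots\to X_d\xrightarrow{f_d}X_{d+1}$ is $d$-exact if $(f_1,\dots,f_d)$ is a $d$-cokernel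 of $f_0$ and $(f_0,\dots,f_{d-1})$ is a $d$-kernel of $f_d$. The category $\mathcal{M}$ is $d$-abelian if: (0) $\mathcal{M}$ is idempotent complete; (1) every morphism in $\mathcal{M}$ has a $d$-kernel and a $d$-cokernel; (2) for every monomorphism $f_0:X_0\to X_1$ and every $d$-cokernel $(f_1,\dots,f_d)$ of $f_0$, the sequence $X_0\to X_1\to\cdots\to X_{d+1}$ is $d$-exact; (2$^{op}$) for every epimorphism $f_d:X_d\to X_{d+1}$ and every $d$-kernel $(f_0,\dots,f_{d-1})$ of $f_d$, the sequence $X_0\to X_1\to\cdots\to X_{d+1}$ is $d$-exact. *)

theory Defs
  imports "HOL-Algebra.FiniteProduct" "HOL-Algebra.Exact_Sequence" "HOL-Algebra.Elementary_Groups"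
begin

section \<open>Additive categories\<close>

text \<open>Objects form a set \<open>Ob C\<close>; \<open>Hom C X Y\<close> is meaningful for objects \<open>X\<close>, \<open>Y\<close> only. A single
  composition and a single addition serve all Hom-sets. Hom-sets are not required to be disjoint, so
  every notion below that depends on source or target takes them as explicit arguments.\<close>

record ('o, 'm) preadd =
  Ob :: "'o set"
  Hom :: "'o \<Rightarrow> 'o \<Rightarrow> 'm set"
  Comp :: "'m \<Rightarrow> 'm \<Rightarrow> 'm"  (infixr "\<cdot>\<index>" 75)
  Idm :: "'o \<Rightarrow> 'm"
  Zero :: "'o \<Rightarrow> 'o \<Rightarrow> 'm"
  Add :: "'m \<Rightarrow> 'm \<Rightarrow> 'm"

definition hom_group :: "('o, 'm) preadd \<Rightarrow> 'o \<Rightarrow> 'o \<Rightarrow> 'm monoid" where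
  "hom_group C X Y = \<lparr>carrier = Hom C X Y, mult = Add C, one = Zero C X Y\<rparr>"

definition neg :: "('o, 'm) preadd \<Rightarrow> 'o \<Rightarrow> 'o \<Rightarrow> 'm \<Rightarrow> 'm" where
  "neg C X Y f = inv\<^bsub>hom_group C X Y\<^esub> f"

locale preadditive_category =
  fixes C :: "('o, 'm) preadd" (structure)
  assumes Id_in_Hom: "X \<in> Ob C \<Longrightarrow> Idm C X \<in> Hom C X X"
    and Comp_in_Hom:
      "\<lbrakk>X \<in> Ob C; Y \<in> Ob C; Z \<in> Ob C; f \<in> Hom C X Y; g \<in> Hom C Y Z\<rbrakk> \<Longrightarrow> g \<cdot> f \<in> Hom C X Z"
    and Comp_Id: "\<lbrakk>X \<in> Ob C; Y \<in> Ob C; f \<in> Hom C X Y\<rbrakk> \<Longrightarrow> f \<cdot> Idm C X = f"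
    and Id_Comp: "\<lbrakk>X \<in> Ob C; Y \<in> Ob C; f \<in> Hom C X Y\<rbrakk> \<Longrightarrow> Idm C Y \<cdot> f = f"
    and Comp_assoc:
      "\<lbrakk>W \<in> Ob C; X \<in> Ob C; Y \<in> Ob C; Z \<in> Ob C; f \<in> Hom C W X; g \<in> Hom C X Y; h \<in> Hom C Y Z\<rbrakk>
        \<Longrightarrow> (h \<cdot> g) \<cdot> f = h \<cdot> (g \<cdot> f)"
    and hom_comm_group: "\<lbrakk>X \<in> Ob C; Y \<in> Ob C\<rbrakk> \<Longrightarrow> comm_group (hom_group C X Y)"
    and Comp_Add_right:
      "\<lbrakk>X \<in> Ob C; Y \<in> Ob C; Z \<in> Ob C; f \<in> Hom C X Y; f' \<in> Hom C X Y; g \<in> Hom C Y Z\<rbrakk>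
        \<Longrightarrow> g \<cdot> Add C f f' = Add C (g \<cdot> f) (g \<cdot> f')"
    and Comp_Add_left:
      "\<lbrakk>X \<in> Ob C; Y \<in> Ob C; Z \<in> Ob C; f \<in> Hom C X Y; g \<in> Hom C Y Z; g' \<in> Hom C Y Z\<rbrakk>
        \<Longrightarrow> Add C g g' \<cdot> f = Add C (g \<cdot> f) (g' \<cdot> f)"

definition is_zero :: "('o, 'm) preadd \<Rightarrow> 'o \<Rightarrow> bool" where
  "is_zero C Z \<longleftrightarrow> Z \<in> Ob C \<and>
     (\<forall>X\<in>Ob C. Hom C X Z = {Zero C X Z} \<and> Hom C Z X = {Zero C Z X})"

definition is_biproduct ::
  "('o, 'm) preadd \<Rightarrow> 'o \<Rightarrow> 'o \<Rightarrow> 'o \<Rightarrow> 'm \<Rightarrow> 'm \<Rightarrow> 'm \<Rightarrow> 'm \<Rightarrow> bool" where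
  "is_biproduct C A B Z i1 i2 p1 p2 \<longleftrightarrow>
     A \<in> Ob C \<and> B \<in> Ob C \<and> Z \<in> Ob C \<and>
     i1 \<in> Hom C A Z \<and> i2 \<in> Hom C B Z \<and> p1 \<in> Hom C Z A \<and> p2 \<in> Hom C Z B \<and>
     p1 \<cdot>\<^bsub>C\<^esub> i1 = Idm C A \<and> p2 \<cdot>\<^bsub>C\<^esub> i2 = Idm C B \<and>
     p1 \<cdot>\<^bsub>C\<^esub> i2 = Zero C B A \<and> p2 \<cdot>\<^bsub>C\<^esub> i1 = Zero C A B \<and>
     Add C (i1 \<cdot>\<^bsub>C\<^esub> p1) (i2 \<cdot>\<^bsub>C\<^esub> p2) = Idm C Z"

text \<open>\<open>Z\<close> is the direct sum of the objects \<open>X k\<close>, \<open>k \<in> I\<close>. The product \<open>finprod\<close> in the (additively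
  meant) group \<open>hom_group C Z Z\<close> is the sum of the morphisms \<open>j k \<cdot> p k\<close>. The predicate is invariant
  under isomorphisms of \<open>Z\<close>, and for empty \<open>I\<close> it says that \<open>Z\<close> is a zero object.\<close>

definition is_direct_sum ::
  "('o, 'm) preadd \<Rightarrow> 'i set \<Rightarrow> ('i \<Rightarrow> 'o) \<Rightarrow> 'o \<Rightarrow> ('i \<Rightarrow> 'm) \<Rightarrow> ('i \<Rightarrow> 'm) \<Rightarrow> bool" where
  "is_direct_sum C I X Z j p \<longleftrightarrow>
     finite I \<and> Z \<in> Ob C \<and>
     (\<forall>k\<in>I. X k \<in> Ob C \<and> j k \<in> Hom C (X k) Z \<and> p k \<in> Hom C Z (X k)) \<and>
     (\<forall>k\<in>I. \<forall>l\<in>I. p k \<cdot>\<^bsub>C\<^esub> j l = (if k = l then Idm C (X k) else Zero C (X l) (X k))) \<and>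
     finprod (hom_group C Z Z) (\<lambda>k. j k \<cdot>\<^bsub>C\<^esub> p k) I = Idm C Z"

locale additive_category = preadditive_category +
  assumes zero_object: "\<exists>Z. is_zero C Z"
    and biproducts:
      "\<lbrakk>A \<in> Ob C; B \<in> Ob C\<rbrakk> \<Longrightarrow> \<exists>Z i1 i2 p1 p2. is_biproduct C A B Z i1 i2 p1 p2"

definition is_iso :: "('o, 'm) preadd \<Rightarrow> 'o \<Rightarrow> 'o \<Rightarrow> 'm \<Rightarrow> bool" where
  "is_iso C X Y f \<longleftrightarrow>
     f \<in> Hom C X Y \<and> (\<exists>g\<in>Hom C Y X. g \<cdot>\<^bsub>C\<^esub> f = Idm C X \<and> f \<cdot>\<^bsub>C\<^esub> g = Idm C Y)"

definition is_mono :: "('o, 'm) preadd \<Rightarrow> 'o \<Rightarrow> 'o \<Rightarrow> 'm \<Rightarrow> bool" where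
  "is_mono C X Y f \<longleftrightarrow>
     f \<in> Hom C X Y \<and>
     (\<forall>W\<in>Ob C. \<forall>g\<in>Hom C W X. \<forall>h\<in>Hom C W X. f \<cdot>\<^bsub>C\<^esub> g = f \<cdot>\<^bsub>C\<^esub> h \<longrightarrow> g = h)"

definition is_epi :: "('o, 'm) preadd \<Rightarrow> 'o \<Rightarrow> 'o \<Rightarrow> 'm \<Rightarrow> bool" where
  "is_epi C X Y f \<longleftrightarrow>
     f \<in> Hom C X Y \<and>
     (\<forall>W\<in>Ob C. \<forall>g\<in>Hom C Y W. \<forall>h\<in>Hom C Y W. g \<cdot>\<^bsub>C\<^esub> f = h \<cdot>\<^bsub>C\<^esub> f \<longrightarrow> g = h)"

definition idempotent_complete :: "('o, 'm) preadd \<Rightarrow> bool" where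
  "idempotent_complete C \<longleftrightarrow>
     (\<forall>X\<in>Ob C. \<forall>e\<in>Hom C X X. e \<cdot>\<^bsub>C\<^esub> e = e \<longrightarrow>
        (\<exists>Y\<in>Ob C. \<exists>r\<in>Hom C X Y. \<exists>s\<in>Hom C Y X. s \<cdot>\<^bsub>C\<^esub> r = e \<and> r \<cdot>\<^bsub>C\<^esub> s = Idm C Y))"

text \<open>Subcategories are full, hence given by sets of objects; these need not be closed under
  isomorphism.\<close>

definition full_subcategory :: "('o, 'm) preadd \<Rightarrow> 'o set \<Rightarrow> ('o, 'm) preadd" where
  "full_subcategory C S = C\<lparr>Ob := S\<rparr>"

definition additive_subcategory :: "('o, 'm) preadd \<Rightarrow> 'o set \<Rightarrow> bool" where
  "additive_subcategory C S \<longleftrightarrow> S \<subseteq> Ob C \<and> additive_category (full_subcategory C S)"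

definition add_closure :: "('o, 'm) preadd \<Rightarrow> 'o set \<Rightarrow> 'o set" where
  "add_closure C S =
     {A. \<exists>(r::nat) X W j p B i1 i2 p1 p2.
           (\<forall>k<r. X k \<in> S) \<and> is_direct_sum C {..<r} X W j p \<and> is_biproduct C A B W i1 i2 p1 p2}"


section \<open>Angulated categories\<close>

text \<open>An automorphism of an additive category is taken to be additive, as usual; this is automatic
  for an isomorphism of categories.\<close>

locale additive_automorphism = additive_category C
  for C :: "('o, 'm) preadd" (structure) +
  fixes So :: "'o \<Rightarrow> 'o" and Sm :: "'m \<Rightarrow> 'm"
  assumes So_bij: "bij_betw So (Ob C) (Ob C)"
    and Sm_bij: "\<lbrakk>X \<in> Ob C; Y \<in> Ob C\<rbrakk> \<Longrightarrow> bij_betw Sm (Hom C X Y) (Hom C (So X) (So Y))"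
    and Sm_Id: "X \<in> Ob C \<Longrightarrow> Sm (Idm C X) = Idm C (So X)"
    and Sm_Comp:
      "\<lbrakk>X \<in> Ob C; Y \<in> Ob C; Z \<in> Ob C; f \<in> Hom C X Y; g \<in> Hom C Y Z\<rbrakk>
        \<Longrightarrow> Sm (g \<cdot> f) = Sm g \<cdot> Sm f"
    and Sm_Add:
      "\<lbrakk>X \<in> Ob C; Y \<in> Ob C; f \<in> Hom C X Y; g \<in> Hom C X Y\<rbrakk>
        \<Longrightarrow> Sm (Add C f g) = Add C (Sm f) (Sm g)"

definition ob_power :: "('o, 'm) preadd \<Rightarrow> ('o \<Rightarrow> 'o) \<Rightarrow> int \<Rightarrow> 'o \<Rightarrow> 'o" where
  "ob_power C So j =
     (if j \<ge> 0 then So ^^ nat j else inv_into (Ob C) So ^^ nat (- j))"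

text \<open>A sequence \<open>X 0 \<rightarrow> X 1 \<rightarrow> \<dots> \<rightarrow> X (n + 1) \<rightarrow> So (X 0)\<close> is given by functions \<open>X\<close> and \<open>f\<close> of which
  only the values at \<open>0, \<dots>, n + 1\<close> matter. \<open>ext n\<close> continues such data (objects, morphisms, or
  components of morphisms of sequences) beyond \<open>n + 1\<close> by means of the suspension:
  \<open>X (n + 2) = So (X 0)\<close>, \<open>X (n + 3) = So (X 1)\<close>, and similarly with \<open>Sm\<close> for morphisms.\<close>

definition ext :: "nat \<Rightarrow> ('a \<Rightarrow> 'a) \<Rightarrow> (nat \<Rightarrow> 'a) \<Rightarrow> nat \<Rightarrow> 'a" where
  "ext n S x i = (if i < n + 2 then x i else S (x (i - (n + 2))))"

definition is_seq ::
  "('o, 'm) preadd \<Rightarrow> ('o \<Rightarrow> 'o) \<Rightarrow> nat \<Rightarrow> (nat \<Rightarrow> 'o) \<Rightarrow> (nat \<Rightarrow> 'm) \<Rightarrow> bool" where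
  "is_seq C So n X f \<longleftrightarrow>
     (\<forall>i<n + 2. X i \<in> Ob C \<and> f i \<in> Hom C (X i) (ext n So X (i + 1)))"

definition seq_mor ::
  "('o, 'm) preadd \<Rightarrow> ('m \<Rightarrow> 'm) \<Rightarrow> nat \<Rightarrow> (nat \<Rightarrow> 'o) \<Rightarrow> (nat \<Rightarrow> 'm) \<Rightarrow>
    (nat \<Rightarrow> 'o) \<Rightarrow> (nat \<Rightarrow> 'm) \<Rightarrow> (nat \<Rightarrow> 'm) \<Rightarrow> bool" where
  "seq_mor C Sm n X f Y g \<phi> \<longleftrightarrow>
     (\<forall>i<n + 2. \<phi> i \<in> Hom C (X i) (Y i) \<and>
        ext n Sm \<phi> (i + 1) \<cdot>\<^bsub>C\<^esub> f i = g i \<cdot>\<^bsub>C\<^esub> \<phi> i)"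

definition seq_direct_sum ::
  "('o, 'm) preadd \<Rightarrow> ('o \<Rightarrow> 'o) \<Rightarrow> ('m \<Rightarrow> 'm) \<Rightarrow> nat \<Rightarrow> nat \<Rightarrow>
    (nat \<Rightarrow> nat \<Rightarrow> 'o) \<Rightarrow> (nat \<Rightarrow> nat \<Rightarrow> 'm) \<Rightarrow> (nat \<Rightarrow> 'o) \<Rightarrow> (nat \<Rightarrow> 'm) \<Rightarrow> bool" where
  "seq_direct_sum C So Sm n r X f Z h \<longleftrightarrow>
     is_seq C So n Z h \<and> (\<forall>k<r. is_seq C So n (X k) (f k)) \<and>
     (\<exists>j p.
        (\<forall>i<n + 2. is_direct_sum C {..<r} (\<lambda>k. X k i) (Z i) (\<lambda>k. j k i) (\<lambda>k. p k i)) \<and>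
        (\<forall>k<r. seq_mor C Sm n (X k) (f k) Z h (j k) \<and> seq_mor C Sm n Z h (X k) (f k) (p k)))"

definition rot_ob :: "('o \<Rightarrow> 'o) \<Rightarrow> nat \<Rightarrow> (nat \<Rightarrow> 'o) \<Rightarrow> nat \<Rightarrow> 'o" where
  "rot_ob So n X i = ext n So X (i + 1)"

definition rot_mor ::
  "('o, 'm) preadd \<Rightarrow> ('o \<Rightarrow> 'o) \<Rightarrow> ('m \<Rightarrow> 'm) \<Rightarrow> nat \<Rightarrow> (nat \<Rightarrow> 'o) \<Rightarrow> (nat \<Rightarrow> 'm) \<Rightarrow> nat \<Rightarrow> 'm" where
  "rot_mor C So Sm n X f i =
     (if i < n + 1 then f (i + 1)
      else if even n then Sm (f 0)
      else neg C (So (X 0)) (So (X 1)) (Sm (f 0)))"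

text \<open>\<open>(Z, h)\<close> is a mapping cone of \<open>\<phi> : (X, f) \<rightarrow> (Y, g)\<close>. The biproduct data of the target
  \<open>So (X 1) \<oplus> So (Y 0)\<close> of the last differential are the images under \<open>Sm\<close> of those of \<open>Z 0\<close>. The
  four equations give the entries of the matrix of \<open>h i\<close>.\<close>

definition is_cone ::
  "('o, 'm) preadd \<Rightarrow> ('o \<Rightarrow> 'o) \<Rightarrow> ('m \<Rightarrow> 'm) \<Rightarrow> nat \<Rightarrow> (nat \<Rightarrow> 'o) \<Rightarrow> (nat \<Rightarrow> 'm) \<Rightarrow>
    (nat \<Rightarrow> 'o) \<Rightarrow> (nat \<Rightarrow> 'm) \<Rightarrow> (nat \<Rightarrow> 'm) \<Rightarrow> (nat \<Rightarrow> 'o) \<Rightarrow> (nat \<Rightarrow> 'm) \<Rightarrow> bool" where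
  "is_cone C So Sm n X f Y g \<phi> Z h \<longleftrightarrow>
     is_seq C So n Z h \<and>
     (\<exists>i1 i2 p1 p2. \<forall>i<n + 2.
        is_biproduct C (ext n So X (i + 1)) (Y i) (Z i) (i1 i) (i2 i) (p1 i) (p2 i) \<and>
        ext n Sm p1 (i + 1) \<cdot>\<^bsub>C\<^esub> h i \<cdot>\<^bsub>C\<^esub> i1 i =
          neg C (ext n So X (i + 1)) (ext n So X (i + 2)) (ext n Sm f (i + 1)) \<and>
        ext n Sm p1 (i + 1) \<cdot>\<^bsub>C\<^esub> h i \<cdot>\<^bsub>C\<^esub> i2 i = Zero C (Y i) (ext n So X (i + 2)) \<and>
        ext n Sm p2 (i + 1) \<cdot>\<^bsub>C\<^esub> h i \<cdot>\<^bsub>C\<^esub> i1 i = ext n Sm \<phi> (i + 1) \<and>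
        ext n Sm p2 (i + 1) \<cdot>\<^bsub>C\<^esub> h i \<cdot>\<^bsub>C\<^esub> i2 i = g i)"

text \<open>\<open>angle\<close> is the class of \<open>(n + 2)\<close>-angles. By \<open>F1_iso\<close>, applied to identities, it only
  depends on the relevant values of its arguments. \<open>F1_sum\<close> and \<open>F1_summand\<close> express closure under
  finite direct sums and direct summands.\<close>

locale angulated_category = additive_automorphism C So Sm
  for C :: "('o, 'm) preadd" (structure) and So :: "'o \<Rightarrow> 'o" and Sm :: "'m \<Rightarrow> 'm" +
  fixes n :: nat
    and angle :: "(nat \<Rightarrow> 'o) \<Rightarrow> (nat \<Rightarrow> 'm) \<Rightarrow> bool"
  assumes angle_seq: "angle X f \<Longrightarrow> is_seq C So n X f"
    and F1_iso:
      "\<lbrakk>angle X f; is_seq C So n Y g; seq_mor C Sm n X f Y g \<phi>;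
        \<And>i. i < n + 2 \<Longrightarrow> is_iso C (X i) (Y i) (\<phi> i)\<rbrakk> \<Longrightarrow> angle Y g"
    and F1_sum:
      "\<lbrakk>seq_direct_sum C So Sm n r Xs fs Z h; \<And>k. k < r \<Longrightarrow> angle (Xs k) (fs k)\<rbrakk> \<Longrightarrow> angle Z h"
    and F1_summand:
      "\<lbrakk>seq_direct_sum C So Sm n r Xs fs Z h; angle Z h; k < r\<rbrakk> \<Longrightarrow> angle (Xs k) (fs k)"
    and F1_trivial:
      "\<lbrakk>A \<in> Ob C; is_seq C So n X f; X 0 = A; X 1 = A; f 0 = Idm C A;
        \<And>i. 2 \<le> i \<Longrightarrow> i \<le> n + 1 \<Longrightarrow> is_zero C (X i)\<rbrakk> \<Longrightarrow> angle X f"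
    and F1_exists:
      "\<lbrakk>A \<in> Ob C; B \<in> Ob C; u \<in> Hom C A B\<rbrakk> \<Longrightarrow> \<exists>X f. angle X f \<and> X 0 = A \<and> X 1 = B \<and> f 0 = u"
    and F2:
      "is_seq C So n X f \<Longrightarrow> angle X f \<longleftrightarrow> angle (rot_ob So n X) (rot_mor C So Sm n X f)"
    and F3:
      "\<lbrakk>angle X f; angle Y g; u \<in> Hom C (X 0) (Y 0); v \<in> Hom C (X 1) (Y 1); g 0 \<cdot> u = v \<cdot> f 0\<rbrakk>
        \<Longrightarrow> \<exists>\<phi>. seq_mor C Sm n X f Y g \<phi> \<and> \<phi> 0 = u \<and> \<phi> 1 = v"
    and F4:
      "\<lbrakk>angle X f; angle Y g; u \<in> Hom C (X 0) (Y 0); v \<in> Hom C (X 1) (Y 1); g 0 \<cdot> u = v \<cdot> f 0\<rbrakk>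
        \<Longrightarrow> \<exists>\<phi>. seq_mor C Sm n X f Y g \<phi> \<and> \<phi> 0 = u \<and> \<phi> 1 = v \<and>
              (\<forall>Z h. is_cone C So Sm n X f Y g \<phi> Z h \<longrightarrow> angle Z h)"

definition closed_under_n_extensions ::
  "('o, 'm) preadd \<Rightarrow> ('o \<Rightarrow> 'o) \<Rightarrow> nat \<Rightarrow> ((nat \<Rightarrow> 'o) \<Rightarrow> (nat \<Rightarrow> 'm) \<Rightarrow> bool) \<Rightarrow> 'o set \<Rightarrow> bool" where
  "closed_under_n_extensions C So n angle S \<longleftrightarrow>
     (\<forall>A\<in>S. \<forall>B\<in>S. \<forall>\<delta>\<in>Hom C B (So A).
        \<exists>X f. angle X f \<and> X 0 = A \<and> X (n + 1) = B \<and> f (n + 1) = \<delta> \<and> (\<forall>i\<in>{1..n}. X i \<in> S))"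


section \<open>\<open>d\<close>-abelian categories\<close>

definition is_finite_seq ::
  "('o, 'm) preadd \<Rightarrow> nat \<Rightarrow> (nat \<Rightarrow> 'o) \<Rightarrow> (nat \<Rightarrow> 'm) \<Rightarrow> bool" where
  "is_finite_seq C d X f \<longleftrightarrow>
     (\<forall>i\<le>d + 1. X i \<in> Ob C) \<and> (\<forall>i\<le>d. f i \<in> Hom C (X i) (X (i + 1)))"

text \<open>The lists in \<open>exact_seq\<close> run from right to left: the last group is the source of the last map.
  So \<open>d_cokernel C d X f\<close> says that \<open>0 \<rightarrow> C(X (d + 1), Y) \<rightarrow> C(X d, Y) \<rightarrow> \<dots> \<rightarrow> C(X 0, Y)\<close> is exact
  for all \<open>Y\<close>, i.e. that \<open>(f 1, \<dots>, f d)\<close> is a \<open>d\<close>-cokernel of \<open>f 0\<close>, and \<open>d_kernel C d X f\<close> says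
  that \<open>0 \<rightarrow> C(Y, X 0) \<rightarrow> \<dots> \<rightarrow> C(Y, X (d + 1))\<close> is exact for all \<open>Y\<close>, i.e. that
  \<open>(f 0, \<dots>, f (d - 1))\<close> is a \<open>d\<close>-kernel of \<open>f d\<close>.\<close>

definition d_cokernel ::
  "('o, 'm) preadd \<Rightarrow> nat \<Rightarrow> (nat \<Rightarrow> 'o) \<Rightarrow> (nat \<Rightarrow> 'm) \<Rightarrow> bool" where
  "d_cokernel C d X f \<longleftrightarrow> is_finite_seq C d X f \<and>
     (\<forall>Y\<in>Ob C. exact_seq
        (map (\<lambda>i. hom_group C (X i) Y) [0..<d + 2] @ [singleton_group (Zero C (X (d + 1)) Y)],
         map (\<lambda>i g. g \<cdot>\<^bsub>C\<^esub> f i) [0..<d + 1] @ [\<lambda>_. Zero C (X (d + 1)) Y]))"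

definition d_kernel ::
  "('o, 'm) preadd \<Rightarrow> nat \<Rightarrow> (nat \<Rightarrow> 'o) \<Rightarrow> (nat \<Rightarrow> 'm) \<Rightarrow> bool" where
  "d_kernel C d X f \<longleftrightarrow> is_finite_seq C d X f \<and>
     (\<forall>Y\<in>Ob C. exact_seq
        (map (\<lambda>i. hom_group C Y (X i)) (rev [0..<d + 2]) @ [singleton_group (Zero C Y (X 0))],
         map (\<lambda>i g. f i \<cdot>\<^bsub>C\<^esub> g) (rev [0..<d + 1]) @ [\<lambda>_. Zero C Y (X 0)]))"

definition d_exact ::
  "('o, 'm) preadd \<Rightarrow> nat \<Rightarrow> (nat \<Rightarrow> 'o) \<Rightarrow> (nat \<Rightarrow> 'm) \<Rightarrow> bool" where
  "d_exact C d X f \<longleftrightarrow> d_cokernel C d X f \<and> d_kernel C d X f"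

definition d_abelian :: "nat \<Rightarrow> ('o, 'm) preadd \<Rightarrow> bool" where
  "d_abelian d C \<longleftrightarrow>
     d \<ge> 1 \<and> additive_category C \<and> idempotent_complete C \<and>
     (\<forall>A\<in>Ob C. \<forall>B\<in>Ob C. \<forall>u\<in>Hom C A B.
        (\<exists>X f. d_kernel C d X f \<and> X d = A \<and> X (d + 1) = B \<and> f d = u) \<and>
        (\<exists>X f. d_cokernel C d X f \<and> X 0 = A \<and> X 1 = B \<and> f 0 = u)) \<and>
     (\<forall>X f. d_cokernel C d X f \<and> is_mono C (X 0) (X 1) (f 0) \<longrightarrow> d_exact C d X f) \<and>
     (\<forall>X f. d_kernel C d X f \<and> is_epi C (X d) (X (d + 1)) (f d) \<longrightarrow> d_exact C d X f)"


section \<open>Truncated subcategories\<close>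

definition trunc :: "('o, 'm) preadd \<Rightarrow> (int \<Rightarrow> 'o set) \<Rightarrow> int \<Rightarrow> int \<Rightarrow> 'o set" where
  "trunc C \<aa> i j = add_closure C (\<Union>p\<in>{i..j}. \<aa> p)"

end

theory Submission
  imports Defs
begin

text \<open>
  Let \<open>u : A \<rightarrow> B\<close> be a morphism of the truncated subcategory \<open>\<T>[0, m]\<close>. Complete \<open>u\<close> to an
  \<open>(n + 2)\<close>-angle and continue the angle in both directions by the suspension. The result is a
  helix \<open>\<dots> \<rightarrow> E 0 \<rightarrow> E 1 \<rightarrow> \<dots>\<close> whose windows are angles, so \<open>Hom(Y, -)\<close> and \<open>Hom(-, Y)\<close> turn it into exact
  complexes. Closure under \<open>n\<close>-extensions allows the new objects of the first angle to be chosen in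
  \<open>\<T>[0, m + 1]\<close>, and each period raises all levels by one.

  Nonzero morphisms never lower the level, so the summand of level at most \<open>m\<close> is a reflection. Hence the
  right half of the helix, truncated to levels at most \<open>m\<close>, stays exact under \<open>Hom(-, Y)\<close> for \<open>Y\<close> in
  \<open>\<T>[0, m]\<close>. After \<open>m + 1\<close> periods, that is after \<open>(n + 2) (m + 1) = d + 2\<close> objects, all levels
  exceed \<open>m\<close>; the truncated half is a \<open>d\<close>-cokernel of \<open>u\<close> (lemma \<open>coker_seq_trunc\<close>). Dually, the left half truncated
  to levels at least \<open>0\<close> is a \<open>d\<close>-kernel.

  Now let \<open>u\<close> be a monomorphism of \<open>\<T>[0, m]\<close>. Then \<open>u\<close> is injective on morphisms from all objects of
  levels at least \<open>0\<close>, and its \<open>(m + 1)\<close>-st suspension, which up to sign is the helix morphism \<open>d + 2\<close> steps after \<open>u\<close>, is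
  injective on morphisms from objects of levels at least \<open>m + 1\<close>. Hence the differential of the helix vanishes
  on the last discarded summand, and a contraction of the discarded part can be built by descending induction
  (lemma \<open>partial_contraction\<close>). Discarding a contractible part does not affect exactness under
  \<open>Hom(Y, -)\<close>, so the constructed sequence is also a \<open>d\<close>-kernel (lemma \<open>ker_exact_trunc\<close>). Two \<open>d\<close>-cokernels of the same
  morphism are homotopy equivalent, so the same holds for every \<open>d\<close>-cokernel of \<open>u\<close>
  (lemma \<open>ker_exact_transfer\<close>). The statement on epimorphisms is the same one in the opposite category.

  Idempotents split in \<open>\<T>[0, m]\<close> because an idempotent is a triangular matrix with respect to the levels,
  and its diagonal entries split (lemma \<open>idems_split_triangular\<close>).
\<close>

section \<open>Arithmetic of morphisms\<close>

text \<open>Hom-sets are meaningful for objects only and may overlap, so the typing of a morphism always carries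
  its two objects and their membership in the category.\<close>

definition arr :: "('o, 'm) preadd \<Rightarrow> 'm \<Rightarrow> 'o \<Rightarrow> 'o \<Rightarrow> bool"  ("(_ \<Colon>\<index> _ \<leadsto> _)" [66, 66, 66] 65)
  where "f \<Colon>\<^bsub>C\<^esub> X \<leadsto> Y \<longleftrightarrow> X \<in> Ob C \<and> Y \<in> Ob C \<and> f \<in> Hom C X Y"

context preadditive_category
begin

lemma arr_obD: "f \<Colon> X \<leadsto> Y \<Longrightarrow> X \<in> Ob C" "f \<Colon> X \<leadsto> Y \<Longrightarrow> Y \<in> Ob C"
  by (simp_all add: arr_def)

lemma id_arr [intro]: "X \<in> Ob C \<Longrightarrow> Idm C X \<Colon> X \<leadsto> X"
  by (simp add: arr_def Id_in_Hom)

lemma comp_arr [intro]: "f \<Colon> X \<leadsto> Y \<Longrightarrow> g \<Colon> Y \<leadsto> Z \<Longrightarrow> g \<cdot> f \<Colon> X \<leadsto> Z"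
  by (auto simp: arr_def intro: Comp_in_Hom)

lemma assoc:
  "f \<Colon> W \<leadsto> X \<Longrightarrow> g \<Colon> X \<leadsto> Y \<Longrightarrow> h \<Colon> Y \<leadsto> Z \<Longrightarrow> (h \<cdot> g) \<cdot> f = h \<cdot> (g \<cdot> f)"
  by (auto simp: arr_def intro: Comp_assoc)

lemma comp_id: "f \<Colon> X \<leadsto> Y \<Longrightarrow> f \<cdot> Idm C X = f"
  and id_comp: "f \<Colon> X \<leadsto> Y \<Longrightarrow> Idm C Y \<cdot> f = f"
  by (auto simp: arr_def intro: Comp_Id Id_Comp)

lemma zero_arr [intro]: "X \<in> Ob C \<Longrightarrow> Y \<in> Ob C \<Longrightarrow> Zero C X Y \<Colon> X \<leadsto> Y"
  using hom_comm_group[of X Y] monoid.one_closed[of "hom_group C X Y"]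
  by (auto simp: arr_def hom_group_def comm_group_def group_def)

lemma add_arr [intro]: "f \<Colon> X \<leadsto> Y \<Longrightarrow> g \<Colon> X \<leadsto> Y \<Longrightarrow> Add C f g \<Colon> X \<leadsto> Y"
  using hom_comm_group[of X Y] monoid.m_closed[of "hom_group C X Y"]
  by (auto simp: arr_def hom_group_def comm_group_def group_def)

lemma add_comm:
  assumes "f \<Colon> X \<leadsto> Y" "g \<Colon> X \<leadsto> Y"
  shows "Add C f g = Add C g f"
proof -
  interpret G: comm_group "hom_group C X Y" using assms by (auto simp: arr_def intro: hom_comm_group)
  show ?thesis using G.m_comm[of f g] assms by (auto simp: hom_group_def arr_def)
qed

lemma add_zero:
  assumes "f \<Colon> X \<leadsto> Y"
  shows "Add C f (Zero C X Y) = f" "Add C (Zero C X Y) f = f"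
proof -
  interpret G: comm_group "hom_group C X Y" using assms by (auto simp: arr_def intro: hom_comm_group)
  show "Add C f (Zero C X Y) = f" "Add C (Zero C X Y) f = f"
    using G.r_one[of f] G.l_one[of f] assms by (auto simp: hom_group_def arr_def)
qed

lemma add_left_cancel:
  assumes "f \<Colon> X \<leadsto> Y" "g \<Colon> X \<leadsto> Y" "h \<Colon> X \<leadsto> Y" "Add C f g = Add C f h"
  shows "g = h"
proof -
  interpret G: comm_group "hom_group C X Y" using assms by (auto simp: arr_def intro: hom_comm_group)
  show ?thesis using G.Units_l_cancel[of f g h] assms unfolding G.Units_eq by (auto simp: hom_group_def arr_def)
qed

text \<open>Differences enter as solutions of \<open>g + h = f\<close>; in this way chain-level arguments need no signs.\<close>

lemma difference_exists:
  assumes "f \<Colon> X \<leadsto> Y" "g \<Colon> X \<leadsto> Y"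
  obtains h where "h \<Colon> X \<leadsto> Y" "Add C g h = f"
proof -
  interpret G: comm_group "hom_group C X Y" using assms by (auto simp: arr_def intro: hom_comm_group)
  let ?i = "inv\<^bsub>hom_group C X Y\<^esub> g"
  have fg: "f \<in> carrier (hom_group C X Y)" "g \<in> carrier (hom_group C X Y)"
    using assms by (auto simp: arr_def hom_group_def)
  then have i: "?i \<in> carrier (hom_group C X Y)" by simp
  have "g \<otimes>\<^bsub>hom_group C X Y\<^esub> (?i \<otimes>\<^bsub>hom_group C X Y\<^esub> f) = f"
    using fg i G.m_assoc[of g ?i f, symmetric] by simp
  moreover have "?i \<otimes>\<^bsub>hom_group C X Y\<^esub> f \<in> carrier (hom_group C X Y)"
    using fg i by simp
  ultimately show ?thesis
    using assms that[of "?i \<otimes>\<^bsub>hom_group C X Y\<^esub> f"]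
    by (metis arr_def hom_group_def monoid.simps(1) partial_object.simps(1))
qed

lemma comp_add: 
  "f \<Colon> X \<leadsto> Y \<Longrightarrow> f' \<Colon> X \<leadsto> Y \<Longrightarrow> g \<Colon> Y \<leadsto> Z \<Longrightarrow> g \<cdot> Add C f f' = Add C (g \<cdot> f) (g \<cdot> f')"
  by (auto simp: arr_def intro: Comp_Add_right)

lemma add_comp: 
  "f \<Colon> X \<leadsto> Y \<Longrightarrow> g \<Colon> Y \<leadsto> Z \<Longrightarrow> g' \<Colon> Y \<leadsto> Z \<Longrightarrow> Add C g g' \<cdot> f = Add C (g \<cdot> f) (g' \<cdot> f)"
  by (auto simp: arr_def intro: Comp_Add_left)

lemma comp_zero:
  assumes "g \<Colon> Y \<leadsto> Z" "X \<in> Ob C"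
  shows "g \<cdot> Zero C X Y = Zero C X Z"
proof -
  have z: "Zero C X Y \<Colon> X \<leadsto> Y" using assms arr_obD by blast
  have "Add C (g \<cdot> Zero C X Y) (g \<cdot> Zero C X Y) = Add C (g \<cdot> Zero C X Y) (Zero C X Z)"
    using comp_add[OF z z assms(1)] add_zero(1)[OF z] add_zero(1)[OF comp_arr[OF z assms(1)]] by simp
  then show ?thesis
    using add_left_cancel z assms comp_arr zero_arr arr_obD by metis
qed

lemma zero_comp:
  assumes "f \<Colon> X \<leadsto> Y" "Z \<in> Ob C"
  shows "Zero C Y Z \<cdot> f = Zero C X Z"
proof -
  have z: "Zero C Y Z \<Colon> Y \<leadsto> Z" using assms arr_obD by blast
  have "Add C (Zero C Y Z \<cdot> f) (Zero C Y Z \<cdot> f) = Add C (Zero C Y Z \<cdot> f) (Zero C X Z)"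
    using add_comp[OF assms(1) z z] add_zero(1)[OF z] add_zero(1)[OF comp_arr[OF assms(1) z]] by simp
  then show ?thesis
    using add_left_cancel z assms comp_arr zero_arr arr_obD by metis
qed

lemma zero_iff_faithful_comp:
  assumes "g \<Colon> Y \<leadsto> Z" "X \<in> Ob C"
  shows "(\<forall>a b. a \<Colon> X \<leadsto> Y \<longrightarrow> b \<Colon> X \<leadsto> Y \<longrightarrow> g \<cdot> a = g \<cdot> b \<longrightarrow> a = b)
     \<longleftrightarrow> (\<forall>a. a \<Colon> X \<leadsto> Y \<longrightarrow> g \<cdot> a = Zero C X Z \<longrightarrow> a = Zero C X Y)"  (is "?L \<longleftrightarrow> ?R")
proof
  assume ?L
  then show ?R using comp_zero[OF assms] assms zero_arr[of X Y] by (auto simp: arr_def)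
next
  assume R: ?R
  show ?L
  proof (intro allI impI)
    fix a b assume ab: "a \<Colon> X \<leadsto> Y" "b \<Colon> X \<leadsto> Y" and eq: "g \<cdot> a = g \<cdot> b"
    obtain c where c: "c \<Colon> X \<leadsto> Y" "Add C b c = a" using difference_exists ab by blast
    have "Add C (g \<cdot> b) (g \<cdot> c) = Add C (g \<cdot> b) (Zero C X Z)"
      using comp_add[OF ab(2) c(1) assms(1)] c(2) eq add_zero(1)[OF comp_arr[OF ab(2) assms(1)]] by auto
    then have "g \<cdot> c = Zero C X Z"
      using add_left_cancel[OF comp_arr[OF ab(2) assms(1)] comp_arr[OF c(1) assms(1)]]
        zero_arr assms arr_obD by blast
    then show "a = b" using R c add_zero(1)[OF ab(2)] by auto
  qed
qed

lemma is_mono_iff: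
  assumes "f \<Colon> X \<leadsto> Y"
  shows "is_mono C X Y f \<longleftrightarrow>
    (\<forall>W g. g \<Colon> W \<leadsto> X \<longrightarrow> f \<cdot> g = Zero C W Y \<longrightarrow> g = Zero C W X)"
proof -
  have "is_mono C X Y f \<longleftrightarrow> (\<forall>W\<in>Ob C. \<forall>a b. a \<Colon> W \<leadsto> X \<longrightarrow> b \<Colon> W \<leadsto> X \<longrightarrow> f \<cdot> a = f \<cdot> b \<longrightarrow> a = b)"
    using assms unfolding is_mono_def arr_def by blast
  also have "\<dots> \<longleftrightarrow> (\<forall>W\<in>Ob C. \<forall>a. a \<Colon> W \<leadsto> X \<longrightarrow> f \<cdot> a = Zero C W Y \<longrightarrow> a = Zero C W X)"
    using zero_iff_faithful_comp[OF assms] by simp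
  finally show ?thesis by (auto simp: arr_def)
qed

end

section \<open>The opposite category\<close>

text \<open>Kernel statements are obtained from cokernel statements by reversing all arrows.\<close>

definition opp :: "('o, 'm) preadd \<Rightarrow> ('o, 'm) preadd" where
  "opp C = \<lparr>Ob = Ob C, Hom = (\<lambda>X Y. Hom C Y X), Comp = (\<lambda>g f. f \<cdot>\<^bsub>C\<^esub> g), Idm = Idm C,
     Zero = (\<lambda>X Y. Zero C Y X), Add = Add C\<rparr>"

lemma opp_simps [simp]:
  "Ob (opp C) = Ob C" "Hom (opp C) X Y = Hom C Y X" "g \<cdot>\<^bsub>opp C\<^esub> f = f \<cdot>\<^bsub>C\<^esub> g"
  "Idm (opp C) = Idm C" "Zero (opp C) X Y = Zero C Y X" "Add (opp C) = Add C"
  "hom_group (opp C) X Y = hom_group C Y X"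
  by (simp_all add: opp_def hom_group_def)

lemma arr_opp [simp]: "f \<Colon>\<^bsub>opp C\<^esub> X \<leadsto> Y \<longleftrightarrow> f \<Colon>\<^bsub>C\<^esub> Y \<leadsto> X"
  by (auto simp: arr_def)

lemma is_mono_opp [simp]: "is_mono (opp C) X Y f \<longleftrightarrow> is_epi C Y X f"
  by (simp add: is_mono_def is_epi_def)

lemma (in preadditive_category) preadditive_opp: "preadditive_category (opp C)"
proof (rule preadditive_category.intro, goal_cases)
  case (5 W X Y Z f g h)
  then show ?case using Comp_assoc[of Z Y X W h g f] by simp
qed (auto intro: Id_in_Hom Comp_in_Hom Comp_Id Id_Comp Comp_Add_left Comp_Add_right hom_comm_group)

lemma full_subcategory_simps [simp]:
  "Ob (full_subcategory C S) = S" "Hom (full_subcategory C S) = Hom C"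
  "Comp (full_subcategory C S) = Comp C" "Idm (full_subcategory C S) = Idm C"
  "Zero (full_subcategory C S) = Zero C" "Add (full_subcategory C S) = Add C"
  "hom_group (full_subcategory C S) = hom_group C"
  by (auto simp: full_subcategory_def hom_group_def fun_eq_iff)

lemma opp_full_subcategory: "opp (full_subcategory C S) = full_subcategory (opp C) S"
  by (simp add: opp_def full_subcategory_def)

lemma arr_full_subcategory:
  "S \<subseteq> Ob C \<Longrightarrow> f \<Colon>\<^bsub>full_subcategory C S\<^esub> X \<leadsto> Y \<longleftrightarrow> X \<in> S \<and> Y \<in> S \<and> f \<Colon>\<^bsub>C\<^esub> X \<leadsto> Y"
  by (auto simp: arr_def)

lemma (in preadditive_category) preadditive_full_subcategory:
  assumes "S \<subseteq> Ob C"
  shows "preadditive_category (full_subcategory C S)"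
proof -
  have [dest]: "X \<in> Ob C" if "X \<in> S" for X using that assms by blast
  show ?thesis
  proof (rule preadditive_category.intro, goal_cases)
    case (5 W X Y Z f g h)
    then show ?case using Comp_assoc[of W X Y Z f g h] by auto
  qed (auto intro: Id_in_Hom Comp_in_Hom Comp_Id Id_Comp Comp_Add_left Comp_Add_right hom_comm_group)
qed

section \<open>Cokernel sequences\<close>

text \<open>The lists of \<open>exact_seq\<close> grow on the left, so induction on \<open>k\<close> peels off the group with index \<open>0\<close> and
  shifts all indices. The last map \<open>\<psi>\<close> is the one from the trivial group.\<close>

lemma exact_seq_upto_iff:
  assumes "group_hom (G (Suc k)) (G k) (\<phi> k)" "group_hom H (G (Suc k)) \<psi>"
    "\<And>i. i \<le> k \<Longrightarrow> group_hom (G (Suc i)) (G i) (\<phi> i)"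
  shows "exact_seq (map G [0..<k + 2] @ [H], map \<phi> [0..<k + 1] @ [\<psi>]) \<longleftrightarrow>
    kernel (G (Suc k)) (G k) (\<phi> k) = \<psi> ` carrier H \<and>
    (\<forall>i<k. kernel (G (Suc i)) (G i) (\<phi> i) = \<phi> (Suc i) ` carrier (G (Suc (Suc i))))"
  using assms
proof (induction k arbitrary: G \<phi>)
  case 0
  then show ?case by (auto simp: group_hom_def group_hom_axioms_def numeral_2_eq_2)
next
  case (Suc k)
  have up: "map F [0..<Suc l] = F 0 # map (\<lambda>i. F (Suc i)) [0..<l]" for F :: "nat \<Rightarrow> 'x" and l
    by (simp add: upt_conv_Cons map_Suc_upt[symmetric] del: upt_Suc)
  have IH: "exact_seq (map (\<lambda>i. G (Suc i)) [0..<k + 2] @ [H], map (\<lambda>i. \<phi> (Suc i)) [0..<k + 1] @ [\<psi>]) \<longleftrightarrow>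
    kernel (G (Suc (Suc k))) (G (Suc k)) (\<phi> (Suc k)) = \<psi> ` carrier H \<and>
    (\<forall>i<k. kernel (G (Suc (Suc i))) (G (Suc i)) (\<phi> (Suc i)) = \<phi> (Suc (Suc i)) ` carrier (G (Suc (Suc (Suc i)))))"
    using Suc.prems by (intro Suc.IH) auto
  have eq1: "map G [0..<Suc k + 2] = G 0 # G 1 # G 2 # map (\<lambda>i. G (Suc (Suc (Suc i)))) [0..<k]"
    and eq2: "map (\<lambda>i. G (Suc i)) [0..<k + 2] = G 1 # G 2 # map (\<lambda>i. G (Suc (Suc (Suc i)))) [0..<k]"
    and eq3: "map \<phi> [0..<Suc k + 1] = \<phi> 0 # \<phi> 1 # map (\<lambda>i. \<phi> (Suc (Suc i))) [0..<k]"
    and eq4: "map (\<lambda>i. \<phi> (Suc i)) [0..<k + 1] = \<phi> 1 # map (\<lambda>i. \<phi> (Suc (Suc i))) [0..<k]"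
    by (simp_all add: up numeral_2_eq_2 del: upt_Suc)
  have "exact_seq (map G [0..<Suc k + 2] @ [H], map \<phi> [0..<Suc k + 1] @ [\<psi>]) \<longleftrightarrow>
     exact_seq (map (\<lambda>i. G (Suc i)) [0..<k + 2] @ [H], map (\<lambda>i. \<phi> (Suc i)) [0..<k + 1] @ [\<psi>]) \<and>
     kernel (G 1) (G 0) (\<phi> 0) = \<phi> 1 ` carrier (G 2)"
    unfolding eq1 eq2 eq3 eq4 using Suc.prems(3)[of 0]
    by (auto simp: group_hom_def group_hom_axioms_def)
  then show ?case unfolding IH
    by (auto simp: All_less_Suc2 numeral_2_eq_2)
qed

text \<open>The conditions on elements to which exactness of the sequences \<open>0 \<rightarrow> C(X (d + 1), Y) \<rightarrow> \<dots> \<rightarrow> C(X 0, Y)\<close>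
  for all \<open>Y\<close> amounts. That the composites of the \<open>f i\<close> vanish is the case \<open>Y = X (i + 2)\<close>, applied to the
  identity.\<close>

definition coker_seq :: "('o, 'm) preadd \<Rightarrow> nat \<Rightarrow> (nat \<Rightarrow> 'o) \<Rightarrow> (nat \<Rightarrow> 'm) \<Rightarrow> bool" where
  "coker_seq C d X f \<longleftrightarrow>
     (\<forall>i\<le>d. f i \<Colon>\<^bsub>C\<^esub> X i \<leadsto> X (Suc i)) \<and>
     (\<forall>i<d. f (Suc i) \<cdot>\<^bsub>C\<^esub> f i = Zero C (X i) (X (Suc (Suc i)))) \<and>
     (\<forall>i<d. \<forall>Y g. g \<Colon>\<^bsub>C\<^esub> X (Suc i) \<leadsto> Y \<longrightarrow> g \<cdot>\<^bsub>C\<^esub> f i = Zero C (X i) Y \<longrightarrow>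
        (\<exists>h. h \<Colon>\<^bsub>C\<^esub> X (Suc (Suc i)) \<leadsto> Y \<and> g = h \<cdot>\<^bsub>C\<^esub> f (Suc i))) \<and>
     (\<forall>Y g. g \<Colon>\<^bsub>C\<^esub> X (Suc d) \<leadsto> Y \<longrightarrow> g \<cdot>\<^bsub>C\<^esub> f d = Zero C (X d) Y \<longrightarrow> g = Zero C (X (Suc d)) Y)"

lemma (in preadditive_category) d_cokernel_iff: "d_cokernel C d X f \<longleftrightarrow> coker_seq C d X f"
proof (cases "is_finite_seq C d X f")
  case False
  then have "\<not> (\<forall>i\<le>d. f i \<Colon> X i \<leadsto> X (Suc i))"
    by (auto simp: is_finite_seq_def arr_def le_Suc_eq)
  then show ?thesis using False by (simp add: d_cokernel_def coker_seq_def)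
next
  case True
  then have X: "X i \<in> Ob C" if "i \<le> Suc d" for i using that by (simp add: is_finite_seq_def)
  have f: "f i \<Colon> X i \<leadsto> X (Suc i)" if "i \<le> d" for i
    using that True X by (simp add: is_finite_seq_def arr_def)
  let ?ex = "\<lambda>Y. (\<forall>g. g \<Colon> X (Suc d) \<leadsto> Y \<longrightarrow> g \<cdot> f d = Zero C (X d) Y \<longrightarrow> g = Zero C (X (Suc d)) Y) \<and>
     (\<forall>i<d. (\<forall>g. g \<Colon> X (Suc (Suc i)) \<leadsto> Y \<longrightarrow> (g \<cdot> f (Suc i)) \<cdot> f i = Zero C (X i) Y) \<and>
        (\<forall>g. g \<Colon> X (Suc i) \<leadsto> Y \<longrightarrow> g \<cdot> f i = Zero C (X i) Y \<longrightarrow>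
        (\<exists>h. h \<Colon> X (Suc (Suc i)) \<leadsto> Y \<and> g = h \<cdot> f (Suc i))))"
  have ex: "exact_seq
        (map (\<lambda>i. hom_group C (X i) Y) [0..<d + 2] @ [singleton_group (Zero C (X (d + 1)) Y)],
         map (\<lambda>i g. g \<cdot> f i) [0..<d + 1] @ [\<lambda>_. Zero C (X (d + 1)) Y]) \<longleftrightarrow> ?ex Y"
    if Y: "Y \<in> Ob C" for Y
  proof -
    have gh: "group_hom (hom_group C (X (Suc i)) Y) (hom_group C (X i) Y) (\<lambda>g. g \<cdot> f i)" if "i \<le> d" for i
      using hom_comm_group[OF X Y, of i] hom_comm_group[OF X Y, of "Suc i"] that f[of i] Y
        add_comp[OF f] comp_arr[OF f]
      by (auto simp: group_hom_def group_hom_axioms_def hom_def comm_group_def hom_group_def arr_def)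
    have gz: "group_hom (singleton_group (Zero C (X (d + 1)) Y)) (hom_group C (X (Suc d)) Y)
        (\<lambda>_. Zero C (X (d + 1)) Y)"
      using hom_comm_group[OF X Y, of "Suc d"] Y zero_arr[OF X Y, of "Suc d"] add_zero
      by (auto simp: group_hom_def group_hom_axioms_def hom_def comm_group_def hom_group_def arr_def)
    have zz: "Zero C (X (Suc d)) Y \<Colon> X (Suc d) \<leadsto> Y" "Zero C (X (Suc d)) Y \<cdot> f d = Zero C (X d) Y"
      using zero_arr[OF X Y] zero_comp[OF f Y] by auto
    have cl: "g \<cdot> f i \<Colon> X i \<leadsto> Y" if "i \<le> d" "g \<Colon> X (Suc i) \<leadsto> Y" for i g
      using comp_arr f that by blast
    let ?K = "\<lambda>i. kernel (hom_group C (X (Suc i)) Y) (hom_group C (X i) Y) (\<lambda>g. g \<cdot> f i)"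
    have K: "?K i = {g. g \<Colon> X (Suc i) \<leadsto> Y \<and> g \<cdot> f i = Zero C (X i) Y}" if "i \<le> d" for i
      using X[of "Suc i"] Y that by (auto simp: kernel_def hom_group_def arr_def)
    have I: "(\<lambda>g. g \<cdot> f (Suc i)) ` carrier (hom_group C (X (Suc (Suc i))) Y) =
        {h \<cdot> f (Suc i) | h. h \<Colon> X (Suc (Suc i)) \<leadsto> Y}" if "i < d" for i
      using X[of "Suc (Suc i)"] Y that by (auto simp: hom_group_def arr_def)
    have "?K d = (\<lambda>_. Zero C (X (d + 1)) Y) ` carrier (singleton_group (Zero C (X (d + 1)) Y)) \<longleftrightarrow>
      (\<forall>g. g \<Colon> X (Suc d) \<leadsto> Y \<longrightarrow> g \<cdot> f d = Zero C (X d) Y \<longrightarrow> g = Zero C (X (Suc d)) Y)"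
      unfolding K[OF order_refl] using zz by auto
    moreover have "?K i = (\<lambda>g. g \<cdot> f (Suc i)) ` carrier (hom_group C (X (Suc (Suc i))) Y) \<longleftrightarrow>
      (\<forall>g. g \<Colon> X (Suc (Suc i)) \<leadsto> Y \<longrightarrow> (g \<cdot> f (Suc i)) \<cdot> f i = Zero C (X i) Y) \<and>
        (\<forall>g. g \<Colon> X (Suc i) \<leadsto> Y \<longrightarrow> g \<cdot> f i = Zero C (X i) Y \<longrightarrow>
        (\<exists>h. h \<Colon> X (Suc (Suc i)) \<leadsto> Y \<and> g = h \<cdot> f (Suc i)))" if "i < d" for i
      unfolding K[OF less_imp_le[OF that]] I[OF that] set_eq_iff using that cl[of "Suc i"] by auto
    ultimately show ?thesis
      using exact_seq_upto_iff[where G = "\<lambda>i. hom_group C (X i) Y" and \<phi> = "\<lambda>i g. g \<cdot> f i",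
        OF gh[OF order_refl] gz gh]
      by auto
  qed
  have "d_cokernel C d X f \<longleftrightarrow> (\<forall>Y\<in>Ob C. ?ex Y)"
    using True ex by (simp add: d_cokernel_def)
  also have "\<dots> \<longleftrightarrow> coker_seq C d X f"
  proof
    assume L: "\<forall>Y\<in>Ob C. ?ex Y"
    have "f (Suc i) \<cdot> f i = Zero C (X i) (X (Suc (Suc i)))" if "i < d" for i
      using L X[of "Suc (Suc i)"] that id_arr[of "X (Suc (Suc i))"] id_comp[OF f, of "Suc i"] by force
    then show "coker_seq C d X f" using L f by (auto simp: coker_seq_def arr_def)
  next
    assume R: "coker_seq C d X f"
    have "(g \<cdot> f (Suc i)) \<cdot> f i = Zero C (X i) Y" if "i < d" "g \<Colon> X (Suc (Suc i)) \<leadsto> Y" for i g Y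
      using assoc[OF f[of i] f[of "Suc i"] that(2)] that R comp_zero[OF that(2) X[of i]]
      by (simp add: coker_seq_def)
    then show "\<forall>Y\<in>Ob C. ?ex Y" using R by (auto simp: coker_seq_def)
  qed
  finally show ?thesis .
qed

lemma d_kernel_opp: "d_kernel C d X f \<longleftrightarrow> d_cokernel (opp C) d (\<lambda>i. X (d + 1 - i)) (\<lambda>i. f (d - i))"
proof -
  have fin: "is_finite_seq C d X f \<longleftrightarrow> is_finite_seq (opp C) d (\<lambda>i. X (d + 1 - i)) (\<lambda>i. f (d - i))"
    (is "?L \<longleftrightarrow> ?R")
  proof
    assume ?L
    then have "f (d - i) \<in> Hom C (X (d - i)) (X (Suc d - i))" if "i \<le> d" for i
      using that by (auto simp: is_finite_seq_def Suc_diff_le)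
    then show ?R using \<open>?L\<close> by (auto simp: is_finite_seq_def)
  next
    assume R: ?R
    have "X i \<in> Ob C" if "i \<le> d + 1" for i
      using R that spec[of "\<lambda>i. i \<le> d + 1 \<longrightarrow> X (d + 1 - i) \<in> Ob C" "d + 1 - i"] by (simp add: is_finite_seq_def)
    moreover have "f i \<in> Hom C (X i) (X (i + 1))" if "i \<le> d" for i
    proof -
      have "f (d - (d - i)) \<in> Hom C (X (d + 1 - (d - i + 1))) (X (d + 1 - (d - i)))"
        using R by (simp add: is_finite_seq_def)
      then show ?thesis using that by (simp add: Suc_diff_le)
    qed
    ultimately show ?L by (auto simp: is_finite_seq_def)
  qed
  have rv: "map F (rev [0..<l]) = map (\<lambda>i. F (l - Suc i)) [0..<l]" for F :: "nat \<Rightarrow> 'x" and l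
    by (auto simp: rev_map[symmetric] rev_nth intro: nth_equalityI)
  show ?thesis unfolding d_kernel_def d_cokernel_def fin[symmetric] rv
    by (simp del: upt_Suc)
qed

lemma (in preadditive_category) d_kernel_iff:
  "d_kernel C d X f \<longleftrightarrow> coker_seq (opp C) d (\<lambda>i. X (d + 1 - i)) (\<lambda>i. f (d - i))"
  using d_kernel_opp preadditive_category.d_cokernel_iff[OF preadditive_opp] by blast

section \<open>Comparison of cokernel sequences\<close>

text \<open>Exactness of \<open>C(W, X 0) \<rightarrow> \<dots> \<rightarrow> C(W, X (d + 1))\<close> at the inner terms. Together with injectivity at the left end,
  which for a monomorphism \<open>f 0\<close> is automatic, it turns a \<open>d\<close>-cokernel into a \<open>d\<close>-exact sequence.\<close>

definition ker_exact :: "('o, 'm) preadd \<Rightarrow> nat \<Rightarrow> (nat \<Rightarrow> 'o) \<Rightarrow> (nat \<Rightarrow> 'm) \<Rightarrow> bool" where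
  "ker_exact C d X f \<longleftrightarrow>
     (\<forall>i<d. \<forall>W y. y \<Colon>\<^bsub>C\<^esub> W \<leadsto> X (Suc i) \<longrightarrow> f (Suc i) \<cdot>\<^bsub>C\<^esub> y = Zero C W (X (Suc (Suc i))) \<longrightarrow>
        (\<exists>z. z \<Colon>\<^bsub>C\<^esub> W \<leadsto> X i \<and> y = f i \<cdot>\<^bsub>C\<^esub> z))"

context preadditive_category
begin

lemma coker_seqD:
  assumes "coker_seq C d X f"
  shows "i \<le> d \<Longrightarrow> f i \<Colon> X i \<leadsto> X (Suc i)"
    and "i < d \<Longrightarrow> f (Suc i) \<cdot> f i = Zero C (X i) (X (Suc (Suc i)))"
    and "i < d \<Longrightarrow> g \<Colon> X (Suc i) \<leadsto> Y \<Longrightarrow> g \<cdot> f i = Zero C (X i) Y \<Longrightarrow>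
        \<exists>h. h \<Colon> X (Suc (Suc i)) \<leadsto> Y \<and> g = h \<cdot> f (Suc i)"
  using assms by (auto simp: coker_seq_def)

lemma d_kernelI:
  assumes c: "coker_seq C d X f" and k: "ker_exact C d X f" and m: "is_mono C (X 0) (X 1) (f 0)"
  shows "d_kernel C d X f"
  unfolding d_kernel_iff coker_seq_def
proof (intro conjI allI impI)
  fix i assume i: "i \<le> d"
  show "f (d - i) \<Colon>\<^bsub>opp C\<^esub> X (d + 1 - i) \<leadsto> X (d + 1 - Suc i)"
    using coker_seqD(1)[OF c, of "d - i"] i by (simp add: Suc_diff_le)
next
  fix i assume i: "i < d"
  then show "f (d - Suc i) \<cdot>\<^bsub>opp C\<^esub> f (d - i) = Zero (opp C) (X (d + 1 - i)) (X (d + 1 - Suc (Suc i)))"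
    using coker_seqD(2)[OF c, of "d - Suc i"] by (simp add: Suc_diff_Suc Suc_diff_le)
next
  fix i Y g assume i: "i < d" and "g \<Colon>\<^bsub>opp C\<^esub> X (d + 1 - Suc i) \<leadsto> Y"
    "g \<cdot>\<^bsub>opp C\<^esub> f (d - i) = Zero (opp C) (X (d + 1 - i)) Y"
  moreover have "d - i = Suc (d - Suc i)" "d + 1 - i = Suc (Suc (d - Suc i))" using i by auto
  ultimately have "\<exists>z. z \<Colon> Y \<leadsto> X (d - Suc i) \<and> g = f (d - Suc i) \<cdot> z"
    using k unfolding ker_exact_def by simp
  then show "\<exists>h. h \<Colon>\<^bsub>opp C\<^esub> X (d + 1 - Suc (Suc i)) \<leadsto> Y \<and> g = h \<cdot>\<^bsub>opp C\<^esub> f (d - Suc i)"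
    using i by auto
next
  fix Y g assume "g \<Colon>\<^bsub>opp C\<^esub> X (d + 1 - Suc d) \<leadsto> Y" "g \<cdot>\<^bsub>opp C\<^esub> f (d - d) = Zero (opp C) (X (d + 1 - d)) Y"
  then show "g = Zero (opp C) (X (d + 1 - Suc d)) Y"
    using m is_mono_iff[OF coker_seqD(1)[OF c, of 0]] by auto
qed

text \<open>\<open>X\<close> plays the role of a projective resolution: since \<open>Hom(-, X' k)\<close> is exact on it, a chain map can be
  extended step by step to the right, starting from identities.\<close>

lemma chain_map_exists:
  assumes c: "coker_seq C d X f"
    and f': "\<And>i. i \<le> d \<Longrightarrow> f' i \<Colon> X' i \<leadsto> X' (Suc i)"
    and ff': "\<And>i. i < d \<Longrightarrow> f' (Suc i) \<cdot> f' i = Zero C (X' i) (X' (Suc (Suc i)))"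
    and eq: "X 0 = X' 0" "X 1 = X' 1" "f 0 = f' 0"
  obtains \<phi> where "\<phi> 0 = Idm C (X 0)" "\<phi> 1 = Idm C (X 1)"
    "\<And>i. i \<le> Suc d \<Longrightarrow> \<phi> i \<Colon> X i \<leadsto> X' i"
    "\<And>i. i \<le> d \<Longrightarrow> \<phi> (Suc i) \<cdot> f i = f' i \<cdot> \<phi> i"
proof -
  note f = coker_seqD(1)[OF c]
  \<comment> \<open>The last conjunct is what makes \<open>f' k \<cdot> x\<close> factor through \<open>f k\<close> in the next step.\<close>
  let ?P = "\<lambda>k x. (k \<le> Suc d \<longrightarrow> x \<Colon> X k \<leadsto> X' k) \<and> (k \<le> 1 \<longrightarrow> x = Idm C (X k)) \<and>
    (\<forall>j. k = Suc j \<longrightarrow> j < d \<longrightarrow> f' k \<cdot> (x \<cdot> f j) = Zero C (X j) (X' (Suc k)))"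
  let ?Q = "\<lambda>k x y. k \<le> d \<longrightarrow> y \<cdot> f k = f' k \<cdot> x"
  have ob: "X 0 \<in> Ob C" "X 1 \<in> Ob C" using f[of 0] arr_obD by auto
  have step: "\<exists>y. ?P (Suc k) y \<and> ?Q k x y" if P: "?P k x" for k x
  proof (cases "k \<le> d")
    case False
    then show ?thesis using ob by (intro exI[of _ "Idm C (X 1)"]) auto
  next
    case True
    have x: "x \<Colon> X k \<leadsto> X' k" using P True by auto
    have ex: "\<exists>y. y \<Colon> X (Suc k) \<leadsto> X' (Suc k) \<and> (k = 0 \<longrightarrow> y = Idm C (X 1)) \<and> y \<cdot> f k = f' k \<cdot> x"
    proof (cases k)
      case 0
      then show ?thesis
        using P eq f[of 0] f'[of 0] ob
        by (intro exI[of _ "Idm C (X 1)"]) (auto simp: comp_id id_comp intro: id_arr)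
    next
      case (Suc j)
      have fx: "f' k \<cdot> x \<Colon> X k \<leadsto> X' (Suc k)" using x f' True by blast
      have "(f' k \<cdot> x) \<cdot> f j = Zero C (X j) (X' (Suc k))"
        using assoc[OF f[of j] _ f'[OF True], of x] x P Suc True by auto
      then obtain h where "h \<Colon> X (Suc k) \<leadsto> X' (Suc k)" "f' k \<cdot> x = h \<cdot> f k"
        using coker_seqD(3)[OF c, of j "f' k \<cdot> x" "X' (Suc k)"] fx Suc True by auto
      then show ?thesis using Suc by auto
    qed
    then obtain y where y: "y \<Colon> X (Suc k) \<leadsto> X' (Suc k)" "k = 0 \<longrightarrow> y = Idm C (X 1)" "y \<cdot> f k = f' k \<cdot> x"
      by blast
    have "f' (Suc k) \<cdot> (y \<cdot> f k) = Zero C (X k) (X' (Suc (Suc k)))" if "k < d"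
      using assoc[OF x f'[OF True] f'[of "Suc k"]] ff'[OF that] y(3) that
        zero_comp[OF x] arr_obD(2)[OF f'[of "Suc k"]] by simp
    then show ?thesis using y by (intro exI[of _ y]) auto
  qed
  have "?P 0 (Idm C (X 0))" using ob eq by auto
  then have "\<exists>\<phi>. \<forall>k. ?P k (\<phi> k) \<and> ?Q k (\<phi> k) (\<phi> (Suc k))"
    by (intro dependent_nat_choice[of ?P ?Q] exI[of "?P 0"] step)
  then obtain \<phi> where \<phi>: "\<And>k. ?P k (\<phi> k)" "\<And>k. ?Q k (\<phi> k) (\<phi> (Suc k))" by metis
  show ?thesis
    using that[of \<phi>] \<phi>(1)[of 0] \<phi>(1)[of 1] \<phi> by auto
qed

text \<open>The same extension argument shows that a chain endomorphism which starts with identities is homotopic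
  to the identity. The homotopy is \<open>h i : X (i + 1) \<rightarrow> X i\<close>; it starts with zero.\<close>

lemma homotopy_exists:
  assumes c: "coker_seq C d X f"
    and \<theta>01: "\<theta> 0 = Idm C (X 0)" "\<theta> 1 = Idm C (X 1)"
    and \<theta>: "\<And>i. i \<le> Suc d \<Longrightarrow> \<theta> i \<Colon> X i \<leadsto> X i"
    and comm: "\<And>i. i \<le> d \<Longrightarrow> \<theta> (Suc i) \<cdot> f i = f i \<cdot> \<theta> i"
  obtains h where "\<And>i. i \<le> d \<Longrightarrow> h i \<Colon> X (Suc i) \<leadsto> X i"
    "\<And>i. i < d \<Longrightarrow>
       Add C (Add C (\<theta> (Suc i)) (f i \<cdot> h i)) (h (Suc i) \<cdot> f (Suc i)) = Idm C (X (Suc i))"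
proof -
  note f = coker_seqD(1)[OF c]
  let ?P = "\<lambda>k h. k \<le> d \<longrightarrow> h \<Colon> X (Suc k) \<leadsto> X k \<and> Add C (f k \<cdot> \<theta> k) (f k \<cdot> (h \<cdot> f k)) = f k"
  let ?Q = "\<lambda>k h h'. k < d \<longrightarrow>
    Add C (Add C (\<theta> (Suc k)) (f k \<cdot> h)) (h' \<cdot> f (Suc k)) = Idm C (X (Suc k))"
  have ob: "X 0 \<in> Ob C" "X 1 \<in> Ob C" using f[of 0] arr_obD by auto
  have step: "\<exists>h'. ?P (Suc k) h' \<and> ?Q k h h'" if P: "?P k h" for k h
  proof (cases "k < d")
    case False
    then show ?thesis by auto
  next
    case True
    note fk = f[OF less_imp_le[OF True]] and fk' = f[OF Suc_leI[OF True]]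
    note t = \<theta>[of k] and t' = \<theta>[of "Suc k"]
    have h: "h \<Colon> X (Suc k) \<leadsto> X k" and eq: "Add C (f k \<cdot> \<theta> k) (f k \<cdot> (h \<cdot> f k)) = f k"
      using P True by auto
    have fh: "f k \<cdot> h \<Colon> X (Suc k) \<leadsto> X (Suc k)" using fk h by blast
    have tf: "Add C (\<theta> (Suc k)) (f k \<cdot> h) \<Colon> X (Suc k) \<leadsto> X (Suc k)"
      using t' True fh by auto
    have I: "Idm C (X (Suc k)) \<Colon> X (Suc k) \<leadsto> X (Suc k)" using fk arr_obD by blast
    obtain x where x: "x \<Colon> X (Suc k) \<leadsto> X (Suc k)"
      "Add C (Add C (\<theta> (Suc k)) (f k \<cdot> h)) x = Idm C (X (Suc k))"
      using difference_exists[OF I tf] by blast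
    have "Add C (\<theta> (Suc k)) (f k \<cdot> h) \<cdot> f k = f k"
      using add_comp[OF fk t' fh] comm[of k] assoc[OF fk h fk] eq True by simp
    then have "Add C (f k) (x \<cdot> f k) = Add C (f k) (Zero C (X k) (X (Suc k)))"
      using add_comp[OF fk tf x(1)] x(2) id_comp[OF fk] add_zero[OF fk] by simp
    then have "x \<cdot> f k = Zero C (X k) (X (Suc k))"
      using add_left_cancel[OF fk comp_arr[OF fk x(1)]] fk arr_obD by blast
    then obtain h' where h': "h' \<Colon> X (Suc (Suc k)) \<leadsto> X (Suc k)" "x = h' \<cdot> f (Suc k)"
      using coker_seqD(3)[OF c True x(1)] by blast
    have hf: "h' \<cdot> f (Suc k) \<Colon> X (Suc k) \<leadsto> X (Suc k)" using h' fk' by blast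
    have "f (Suc k) \<cdot> (f k \<cdot> h) = Zero C (X (Suc k)) (X (Suc (Suc k)))"
      using assoc[OF h fk fk'] coker_seqD(2)[OF c True] zero_comp[OF h] fk' arr_obD by metis
    then have "f (Suc k) \<cdot> Add C (\<theta> (Suc k)) (f k \<cdot> h) = f (Suc k) \<cdot> \<theta> (Suc k)"
      using comp_add[OF t' fh fk'] add_zero(1)[OF comp_arr[OF t' fk']] True by simp
    then have "Add C (f (Suc k) \<cdot> \<theta> (Suc k)) (f (Suc k) \<cdot> (h' \<cdot> f (Suc k))) = f (Suc k)"
      using comp_add[OF tf hf fk'] x(2) h'(2) comp_id[OF fk'] by simp
    then show ?thesis using h' x by (intro exI[of _ h']) auto
  qed
  have z: "Zero C (X 1) (X 0) \<Colon> X 1 \<leadsto> X 0" using ob by blast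
  have "?P 0 (Zero C (X 1) (X 0))"
    using z zero_comp[of "f 0" "X 0" "X 1" "X 0"] comp_zero[of "f 0" "X 0" "X 1" "X 0"]
      f[of 0] ob \<theta>01 comp_id[of "f 0"] add_zero by auto
  then have "\<exists>h. \<forall>k. ?P k (h k) \<and> ?Q k (h k) (h (Suc k))"
    by (intro dependent_nat_choice[of ?P ?Q] exI[of "?P 0"] step)
  then obtain h where h: "\<And>k. ?P k (h k)" "\<And>k. ?Q k (h k) (h (Suc k))" by metis
  show ?thesis using that[of h] h by auto
qed

text \<open>Chain maps \<open>\<phi>\<close> and \<open>\<psi>\<close> between the two sequences and a homotopy from \<open>\<psi> \<phi>\<close> to the identity exhibit \<open>X\<close> as a
  retract of \<open>X'\<close> up to homotopy; homotopies survive every \<open>Hom(W, -)\<close>.\<close>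

lemma ker_exact_transfer:
  assumes c: "coker_seq C d X f" and c': "coker_seq C d X' f'"
    and eq: "X 0 = X' 0" "X 1 = X' 1" "f 0 = f' 0"
    and k': "ker_exact C d X' f'"
  shows "ker_exact C d X f"
  unfolding ker_exact_def
proof (intro allI impI)
  note f = coker_seqD(1)[OF c] and f' = coker_seqD(1)[OF c']
  fix i W y assume i: "i < d" and y: "y \<Colon> W \<leadsto> X (Suc i)" and fy: "f (Suc i) \<cdot> y = Zero C W (X (Suc (Suc i)))"
  obtain \<phi> where \<phi>: "\<phi> 0 = Idm C (X 0)" "\<phi> 1 = Idm C (X 1)"
    "\<And>i. i \<le> Suc d \<Longrightarrow> \<phi> i \<Colon> X i \<leadsto> X' i" "\<And>i. i \<le> d \<Longrightarrow> \<phi> (Suc i) \<cdot> f i = f' i \<cdot> \<phi> i"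
    using chain_map_exists[OF c f' coker_seqD(2)[OF c'] eq] by blast
  obtain \<psi> where \<psi>: "\<psi> 0 = Idm C (X' 0)" "\<psi> 1 = Idm C (X' 1)"
    "\<And>i. i \<le> Suc d \<Longrightarrow> \<psi> i \<Colon> X' i \<leadsto> X i" "\<And>i. i \<le> d \<Longrightarrow> \<psi> (Suc i) \<cdot> f' i = f i \<cdot> \<psi> i"
    using chain_map_exists[OF c' f coker_seqD(2)[OF c] eq[symmetric]] by blast
  have ob: "X 0 \<in> Ob C" "X 1 \<in> Ob C" using f[of 0] arr_obD by auto
  have comm: "(\<psi> (Suc j) \<cdot> \<phi> (Suc j)) \<cdot> f j = f j \<cdot> (\<psi> j \<cdot> \<phi> j)" if "j \<le> d" for j
    using assoc[OF f[OF that] \<phi>(3)[of "Suc j"] \<psi>(3)[of "Suc j"]]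
      assoc[OF \<phi>(3)[of j] f'[OF that] \<psi>(3)[of "Suc j"]]
      assoc[OF \<phi>(3)[of j] \<psi>(3)[of j] f[OF that]] \<phi>(4)[OF that] \<psi>(4)[OF that] that by simp
  obtain h where h: "\<And>i. i \<le> d \<Longrightarrow> h i \<Colon> X (Suc i) \<leadsto> X i"
    "\<And>i. i < d \<Longrightarrow> Add C (Add C (\<psi> (Suc i) \<cdot> \<phi> (Suc i)) (f i \<cdot> h i)) (h (Suc i) \<cdot> f (Suc i)) = Idm C (X (Suc i))"
  proof (rule homotopy_exists[OF c, of "\<lambda>i. \<psi> i \<cdot> \<phi> i"])
    show "\<psi> 0 \<cdot> \<phi> 0 = Idm C (X 0)" "\<psi> 1 \<cdot> \<phi> 1 = Idm C (X 1)"
      using \<phi>(1,2) \<psi>(1,2) eq ob id_comp[OF id_arr] by auto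
    show "\<psi> i \<cdot> \<phi> i \<Colon> X i \<leadsto> X i" if "i \<le> Suc d" for i using \<phi>(3) \<psi>(3) that by blast
  qed (use comm in auto)
  note fi = f[OF less_imp_le[OF i]] and fi' = f[OF Suc_leI[OF i]] and gi = f'[OF less_imp_le[OF i]]
    and gi' = f'[OF Suc_leI[OF i]]
  have p: "\<phi> (Suc i) \<Colon> X (Suc i) \<leadsto> X' (Suc i)" "\<phi> (Suc (Suc i)) \<Colon> X (Suc (Suc i)) \<leadsto> X' (Suc (Suc i))"
    and q: "\<psi> i \<Colon> X' i \<leadsto> X i" "\<psi> (Suc i) \<Colon> X' (Suc i) \<leadsto> X (Suc i)"
    and hi: "h i \<Colon> X (Suc i) \<leadsto> X i" "h (Suc i) \<Colon> X (Suc (Suc i)) \<leadsto> X (Suc i)"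
    using \<phi>(3) \<psi>(3) h i by auto
  have "f' (Suc i) \<cdot> (\<phi> (Suc i) \<cdot> y) = \<phi> (Suc (Suc i)) \<cdot> (f (Suc i) \<cdot> y)"
    using assoc[OF y p(1) gi'] assoc[OF y fi' p(2)] \<phi>(4)[of "Suc i"] i by simp
  also have "\<dots> = Zero C W (X' (Suc (Suc i)))"
    using fy comp_zero[OF p(2)] y arr_obD by simp
  finally obtain z where z: "z \<Colon> W \<leadsto> X' i" "\<phi> (Suc i) \<cdot> y = f' i \<cdot> z"
    using k' i comp_arr[OF y p(1)] unfolding ker_exact_def by blast
  have "(\<psi> (Suc i) \<cdot> \<phi> (Suc i)) \<cdot> y = f i \<cdot> (\<psi> i \<cdot> z)"
    using assoc[OF y p(1) q(2)] z(2) assoc[OF z(1) gi q(2)] assoc[OF z(1) q(1) fi] \<psi>(4)[of i] i by simp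
  moreover have "(f i \<cdot> h i) \<cdot> y = f i \<cdot> (h i \<cdot> y)" using assoc[OF y hi(1) fi] .
  moreover have "(h (Suc i) \<cdot> f (Suc i)) \<cdot> y = Zero C W (X (Suc i))"
    using assoc[OF y fi' hi(2)] fy comp_zero[OF hi(2)] y arr_obD by simp
  moreover have tp: "\<psi> (Suc i) \<cdot> \<phi> (Suc i) \<Colon> X (Suc i) \<leadsto> X (Suc i)" "f i \<cdot> h i \<Colon> X (Suc i) \<leadsto> X (Suc i)"
      "h (Suc i) \<cdot> f (Suc i) \<Colon> X (Suc i) \<leadsto> X (Suc i)" "\<psi> i \<cdot> z \<Colon> W \<leadsto> X i" "h i \<cdot> y \<Colon> W \<leadsto> X i"
    using p q hi fi fi' z(1) y by blast+
  moreover have "y = Add C (Add C ((\<psi> (Suc i) \<cdot> \<phi> (Suc i)) \<cdot> y) ((f i \<cdot> h i) \<cdot> y)) ((h (Suc i) \<cdot> f (Suc i)) \<cdot> y)"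
    using h(2)[OF i] id_comp[OF y] add_comp[OF y add_arr[OF tp(1,2)] tp(3)] add_comp[OF y tp(1,2)]
    by simp
  ultimately have "y = f i \<cdot> Add C (\<psi> i \<cdot> z) (h i \<cdot> y)"
    using comp_add[OF tp(4,5) fi] add_zero(1) comp_arr[OF add_arr[OF tp(4,5)] fi] by simp
  then show "\<exists>z. z \<Colon> W \<leadsto> X i \<and> y = f i \<cdot> z" using add_arr[OF tp(4,5)] by blast
qed

end

section \<open>Truncation of a helix\<close>

text \<open>The right half of a helix, cut after \<open>d + 2\<close> steps. The summand \<open>A i\<close> of \<open>E i\<close> is kept, \<open>B i\<close> is
  discarded. Since there are no morphisms from \<open>G\<close> to \<open>S\<close>, the projection \<open>\<pi> i\<close> is a reflection of \<open>E i\<close> into \<open>S\<close>. The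
  assumption \<open>last\<close> says that the helix has left \<open>S\<close> after \<open>d + 2\<close> steps.\<close>

locale split_sequence = preadditive_category C
  for C :: "('o, 'm) preadd" (structure) +
  fixes S G :: "'o set" and d :: nat and E :: "nat \<Rightarrow> 'o" and e :: "nat \<Rightarrow> 'm"
    and A B :: "nat \<Rightarrow> 'o" and \<iota> \<pi> \<kappa> \<rho> :: "nat \<Rightarrow> 'm"
  assumes S_Ob: "S \<subseteq> Ob C"
    and orth: "\<lbrakk>Q \<in> G; Y \<in> S; g \<Colon> Q \<leadsto> Y\<rbrakk> \<Longrightarrow> g = Zero C Q Y"
    and e_arr: "i \<le> d + 2 \<Longrightarrow> e i \<Colon> E i \<leadsto> E (Suc i)"
    and ee: "i \<le> d + 1 \<Longrightarrow> e (Suc i) \<cdot> e i = Zero C (E i) (E (Suc (Suc i)))"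
    and cok: "\<lbrakk>i \<le> d; g \<Colon> E (Suc i) \<leadsto> Y; g \<cdot> e i = Zero C (E i) Y\<rbrakk> \<Longrightarrow>
        \<exists>h. h \<Colon> E (Suc (Suc i)) \<leadsto> Y \<and> g = h \<cdot> e (Suc i)"
    and last: "E (Suc (Suc d)) \<in> G"
    and AB: "i \<le> d + 1 \<Longrightarrow> A i \<in> S" "i \<le> d + 1 \<Longrightarrow> B i \<in> G"
    and split: "i \<le> d + 1 \<Longrightarrow> is_biproduct C (A i) (B i) (E i) (\<iota> i) (\<kappa> i) (\<pi> i) (\<rho> i)"
begin

definition trunc_mor :: "nat \<Rightarrow> 'm" where
  "trunc_mor i = \<pi> (Suc i) \<cdot> (e i \<cdot> \<iota> i)"

lemma split_arr:
  assumes "i \<le> d + 1"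
  shows "\<iota> i \<Colon> A i \<leadsto> E i" "\<pi> i \<Colon> E i \<leadsto> A i" "\<kappa> i \<Colon> B i \<leadsto> E i" "\<rho> i \<Colon> E i \<leadsto> B i"
    "\<pi> i \<cdot> \<iota> i = Idm C (A i)" "Add C (\<iota> i \<cdot> \<pi> i) (\<kappa> i \<cdot> \<rho> i) = Idm C (E i)"
  using split[OF assms] by (auto simp: is_biproduct_def arr_def)

lemma factor_through_\<pi>:
  assumes i: "i \<le> d + 1" and g: "g \<Colon> E i \<leadsto> Y" and Y: "Y \<in> S"
  shows "g = (g \<cdot> \<iota> i) \<cdot> \<pi> i"
proof -
  note s = split_arr[OF i]
  have "g \<cdot> \<kappa> i = Zero C (B i) Y" using orth[OF AB(2)[OF i] Y] s g by blast
  then have "g \<cdot> (\<kappa> i \<cdot> \<rho> i) = Zero C (E i) Y"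
    using assoc[OF s(4,3) g] zero_comp[OF s(4)] g arr_obD by metis
  then show ?thesis
    using comp_add[OF comp_arr[OF s(2,1)] comp_arr[OF s(4,3)] g] s(6) comp_id[OF g]
      add_zero(1)[OF comp_arr[OF comp_arr[OF s(2,1)] g]] assoc[OF s(2,1) g] by simp
qed

lemma factor_through_\<kappa>:
  assumes i: "i \<le> d + 1" and g: "g \<Colon> Y \<leadsto> E i" and z: "\<pi> i \<cdot> g = Zero C Y (A i)"
  shows "g = \<kappa> i \<cdot> (\<rho> i \<cdot> g)"
proof -
  note s = split_arr[OF i]
  have "(\<iota> i \<cdot> \<pi> i) \<cdot> g = Zero C Y (E i)"
    using assoc[OF g s(2,1)] z comp_zero[OF s(1)] g arr_obD by metis
  then show ?thesis
    using add_comp[OF g comp_arr[OF s(2,1)] comp_arr[OF s(4,3)]] s(6) id_comp[OF g]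
      add_zero(2)[OF comp_arr[OF g comp_arr[OF s(4,3)]]] assoc[OF g s(4,3)] by simp
qed

lemma trunc_mor_arr: "i \<le> d \<Longrightarrow> trunc_mor i \<Colon> A i \<leadsto> A (Suc i)"
  unfolding trunc_mor_def using split_arr(1)[of i] split_arr(2)[of "Suc i"] e_arr[of i] by auto

lemma trunc_mor_\<pi>:
  assumes i: "i \<le> d"
  shows "trunc_mor i \<cdot> \<pi> i = \<pi> (Suc i) \<cdot> e i"
proof -
  have i1: "i \<le> d + 1" "Suc i \<le> d + 1" "i \<le> d + 2" using i by auto
  note s = split_arr[OF i1(1)] and s' = split_arr[OF i1(2)] and e = e_arr[OF i1(3)]
  have "(\<pi> (Suc i) \<cdot> e i) \<cdot> \<iota> i = trunc_mor i"
    unfolding trunc_mor_def using assoc[OF s(1) e s'(2)] .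
  then show ?thesis
    using factor_through_\<pi>[OF i1(1) comp_arr[OF e s'(2)] AB(1)[OF i1(2)]] by simp
qed

text \<open>Morphisms into objects of \<open>S\<close> factor uniquely through the projections \<open>\<pi> i\<close>, so for \<open>Y\<close> in \<open>S\<close> the complexes
  \<open>Hom(E i, Y)\<close> and \<open>Hom(A i, Y)\<close> are isomorphic. The first one is exact at its inner terms, and it vanishes in position \<open>d + 2\<close>.\<close>

lemma coker_seq_trunc: "coker_seq (full_subcategory C S) d A trunc_mor"
proof -
  have ob: "Y \<in> Ob C" if "Y \<in> S" for Y using that S_Ob by auto
  have comp0: "trunc_mor (Suc i) \<cdot> trunc_mor i = Zero C (A i) (A (Suc (Suc i)))" if i: "i < d" for i
  proof -
    have le: "i \<le> d" "Suc i \<le> d" "i \<le> d + 1" "Suc i \<le> d + 1" "Suc (Suc i) \<le> d + 1" "i \<le> d + 2" "Suc i \<le> d + 2" using i by auto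
    note s = split_arr[OF le(3)] and s' = split_arr[OF le(4)] and s'' = split_arr[OF le(5)]
      and e = e_arr[OF le(6)] and e' = e_arr[OF le(7)]
    have ei: "e i \<cdot> \<iota> i \<Colon> A i \<leadsto> E (Suc i)" using e s by blast
    have "trunc_mor (Suc i) \<cdot> trunc_mor i = (\<pi> (Suc (Suc i)) \<cdot> e (Suc i)) \<cdot> (e i \<cdot> \<iota> i)"
      using trunc_mor_\<pi>[OF le(2)] assoc[OF ei s'(2) trunc_mor_arr[OF le(2)]]
      unfolding trunc_mor_def[of i] by simp
    also have "\<dots> = \<pi> (Suc (Suc i)) \<cdot> ((e (Suc i) \<cdot> e i) \<cdot> \<iota> i)"
      using assoc[OF ei e' s''(2)] assoc[OF s(1) e e'] by simp
    also have "\<dots> = Zero C (A i) (A (Suc (Suc i)))"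
      using ee[of i] i zero_comp[OF s(1), of "E (Suc (Suc i))"] comp_zero[OF s''(2), of "A i"]
        arr_obD(1)[OF s(1)] arr_obD(1)[OF s''(2)] by simp
    finally show ?thesis .
  qed
  have exact: "\<exists>h. h \<Colon> A (Suc (Suc i)) \<leadsto> Y \<and> g = h \<cdot> trunc_mor (Suc i)"
    if i: "i < d" and Y: "Y \<in> S" and g: "g \<Colon> A (Suc i) \<leadsto> Y" and z: "g \<cdot> trunc_mor i = Zero C (A i) Y" for i Y g
  proof -
    have le: "i \<le> d" "Suc i \<le> d" "i \<le> d + 1" "Suc i \<le> d + 1" "Suc (Suc i) \<le> d + 1" "i \<le> d + 2" "Suc i \<le> d + 2" using i by auto
    note s = split_arr[OF le(3)] and s' = split_arr[OF le(4)] and s'' = split_arr[OF le(5)]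
      and e = e_arr[OF le(6)] and e' = e_arr[OF le(7)]
    have "(g \<cdot> \<pi> (Suc i)) \<cdot> e i = (g \<cdot> trunc_mor i) \<cdot> \<pi> i"
      using assoc[OF e s'(2) g] assoc[OF s(2) trunc_mor_arr[OF le(1)] g] trunc_mor_\<pi>[OF le(1)] by simp
    also have "\<dots> = Zero C (E i) Y" using z zero_comp[OF s(2) ob[OF Y]] by simp
    finally obtain h where h: "h \<Colon> E (Suc (Suc i)) \<leadsto> Y" "g \<cdot> \<pi> (Suc i) = h \<cdot> e (Suc i)"
      using cok[OF le(1) comp_arr[OF s'(2) g]] by blast
    have "g = (g \<cdot> \<pi> (Suc i)) \<cdot> \<iota> (Suc i)"
      using assoc[OF s'(1,2) g] s'(5) comp_id[OF g] by simp
    also have "\<dots> = ((h \<cdot> \<iota> (Suc (Suc i))) \<cdot> \<pi> (Suc (Suc i))) \<cdot> (e (Suc i) \<cdot> \<iota> (Suc i))"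
      using h(2) factor_through_\<pi>[OF le(5) h(1) Y] assoc[OF s'(1) e' h(1)] by simp
    also have "\<dots> = (h \<cdot> \<iota> (Suc (Suc i))) \<cdot> trunc_mor (Suc i)"
      unfolding trunc_mor_def using assoc[OF comp_arr[OF s'(1) e'] s''(2) comp_arr[OF s''(1) h(1)]] .
    finally show ?thesis using comp_arr[OF s''(1) h(1)] by blast
  qed
  have inj: "g = Zero C (A (Suc d)) Y"
    if Y: "Y \<in> S" and g: "g \<Colon> A (Suc d) \<leadsto> Y" and z: "g \<cdot> trunc_mor d = Zero C (A d) Y" for Y g
  proof -
    have le: "d \<le> d + 1" "Suc d \<le> d + 1" "d \<le> d + 2" "Suc d \<le> d + 2" by auto
    note s = split_arr[OF le(1)] and s' = split_arr[OF le(2)] and e = e_arr[OF le(3)] and e' = e_arr[OF le(4)]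
    have "(g \<cdot> \<pi> (Suc d)) \<cdot> e d = (g \<cdot> trunc_mor d) \<cdot> \<pi> d"
      using assoc[OF e s'(2) g] assoc[OF s(2) trunc_mor_arr[OF order_refl] g] trunc_mor_\<pi>[OF order_refl] by simp
    also have "\<dots> = Zero C (E d) Y" using z zero_comp[OF s(2) ob[OF Y]] by simp
    finally obtain h where h: "h \<Colon> E (Suc (Suc d)) \<leadsto> Y" "g \<cdot> \<pi> (Suc d) = h \<cdot> e (Suc d)"
      using cok[OF order_refl comp_arr[OF s'(2) g]] by blast
    have "g \<cdot> \<pi> (Suc d) = Zero C (E (Suc d)) Y"
      using h(2) orth[OF last Y h(1)] zero_comp[OF e' ob[OF Y]] by simp
    moreover have "g = (g \<cdot> \<pi> (Suc d)) \<cdot> \<iota> (Suc d)"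
      using assoc[OF s'(1,2) g] s'(5) comp_id[OF g] by simp
    ultimately show ?thesis using zero_comp[OF s'(1) ob[OF Y]] by simp
  qed
  show ?thesis unfolding coker_seq_def arr_full_subcategory[OF S_Ob]
    using trunc_mor_arr AB(1) comp0 exact inj by auto
qed

text \<open>The morphisms \<open>s\<close> are the components of a contraction of the discarded complex \<open>B\<close>, with values in \<open>E\<close> and
  evaluated on cycles \<open>v\<close> only. The induction descends from the right end. There, \<open>e (d + 1) \<cdot> \<kappa> (d + 1)\<close> is
  killed by \<open>e (d + 2)\<close>, hence zero by \<open>inj\<close>, and \<open>\<kappa> (d + 1)\<close> lifts along \<open>e d\<close>. In the step, \<open>b\<close> is the differential of \<open>B\<close>,
  and \<open>\<kappa> - s \<cdot> b\<close> is a cycle that can be lifted.\<close>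

lemma partial_contraction:
  assumes ker: "\<And>i y Y. \<lbrakk>i \<le> d; y \<Colon> Y \<leadsto> E (Suc i); e (Suc i) \<cdot> y = Zero C Y (E (Suc (Suc i)))\<rbrakk> \<Longrightarrow>
        \<exists>z. z \<Colon> Y \<leadsto> E i \<and> y = e i \<cdot> z"
    and inj: "\<And>Q y. \<lbrakk>Q \<in> G; y \<Colon> Q \<leadsto> E (d + 2); e (d + 2) \<cdot> y = Zero C Q (E (d + 3))\<rbrakk> \<Longrightarrow> y = Zero C Q (E (d + 2))"
    and "j \<le> d"
  shows "\<exists>s. s \<Colon> B (Suc j) \<leadsto> E j \<and>
    (\<forall>W v. v \<Colon> W \<leadsto> B (Suc j) \<longrightarrow> e (Suc j) \<cdot> (\<kappa> (Suc j) \<cdot> v) = Zero C W (E (Suc (Suc j))) \<longrightarrow>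
      e j \<cdot> (s \<cdot> v) = \<kappa> (Suc j) \<cdot> v)"
  using \<open>j \<le> d\<close>
proof (induction j rule: inc_induct)
  case base
  note k = split_arr(3)[of "Suc d"]
  have k: "\<kappa> (Suc d) \<Colon> B (Suc d) \<leadsto> E (Suc d)" and e1: "e (Suc d) \<Colon> E (Suc d) \<leadsto> E (Suc (Suc d))"
    and e2: "e (Suc (Suc d)) \<Colon> E (Suc (Suc d)) \<leadsto> E (Suc (Suc (Suc d)))" and e0: "e d \<Colon> E d \<leadsto> E (Suc d)"
    using split_arr(3)[of "Suc d"] e_arr by auto
  have "e (Suc (Suc d)) \<cdot> (e (Suc d) \<cdot> \<kappa> (Suc d)) = Zero C (B (Suc d)) (E (Suc (Suc (Suc d))))"
    using assoc[OF k e1 e2] ee[of "Suc d"] zero_comp[OF k] arr_obD(2)[OF e2] by simp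
  then have "e (Suc d) \<cdot> \<kappa> (Suc d) = Zero C (B (Suc d)) (E (Suc (Suc d)))"
    using inj[of "B (Suc d)" "e (Suc d) \<cdot> \<kappa> (Suc d)"] AB(2)[of "Suc d"] comp_arr[OF k e1]
    by (simp add: numeral_2_eq_2 numeral_3_eq_3)
  then obtain s where s: "s \<Colon> B (Suc d) \<leadsto> E d" "\<kappa> (Suc d) = e d \<cdot> s"
    using ker[OF order_refl k] by blast
  show ?case using s assoc[OF _ s(1) e0] by (intro exI[of _ s]) auto
next
  case (step i)
  have le: "Suc i \<le> d + 1" "Suc (Suc i) \<le> d + 1" "i \<le> d + 2" "Suc i \<le> d + 2" "Suc (Suc i) \<le> d + 2"
    using step.hyps by auto
  note s1 = split_arr[OF le(1)] and s2 = split_arr[OF le(2)]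
    and e0 = e_arr[OF le(3)] and e1 = e_arr[OF le(4)] and e2 = e_arr[OF le(5)]
  obtain s where s: "s \<Colon> B (Suc (Suc i)) \<leadsto> E (Suc i)"
    "\<And>W v. v \<Colon> W \<leadsto> B (Suc (Suc i)) \<Longrightarrow> e (Suc (Suc i)) \<cdot> (\<kappa> (Suc (Suc i)) \<cdot> v) = Zero C W (E (Suc (Suc (Suc i)))) \<Longrightarrow>
      e (Suc i) \<cdot> (s \<cdot> v) = \<kappa> (Suc (Suc i)) \<cdot> v" using step.IH by blast
  define b where "b = \<rho> (Suc (Suc i)) \<cdot> (e (Suc i) \<cdot> \<kappa> (Suc i))"
  have ek: "e (Suc i) \<cdot> \<kappa> (Suc i) \<Colon> B (Suc i) \<leadsto> E (Suc (Suc i))" using e1 s1 by blast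
  have b: "b \<Colon> B (Suc i) \<leadsto> B (Suc (Suc i))" unfolding b_def using ek s2 by blast
  have "\<pi> (Suc (Suc i)) \<cdot> (e (Suc i) \<cdot> \<kappa> (Suc i)) = Zero C (B (Suc i)) (A (Suc (Suc i)))"
    using orth[OF AB(2)[OF le(1)] AB(1)[OF le(2)]] comp_arr[OF ek s2(2)] by blast
  then have kb: "\<kappa> (Suc (Suc i)) \<cdot> b = e (Suc i) \<cdot> \<kappa> (Suc i)"
    unfolding b_def using factor_through_\<kappa>[OF le(2) ek] by simp
  have "e (Suc (Suc i)) \<cdot> (\<kappa> (Suc (Suc i)) \<cdot> b) = Zero C (B (Suc i)) (E (Suc (Suc (Suc i))))"
    using kb assoc[OF s1(3) e1 e2] ee[of "Suc i"] le zero_comp[OF s1(3)] arr_obD(2)[OF e2] by simp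
  then have esb: "e (Suc i) \<cdot> (s \<cdot> b) = e (Suc i) \<cdot> \<kappa> (Suc i)" using s(2)[OF b] kb by simp
  have sb: "s \<cdot> b \<Colon> B (Suc i) \<leadsto> E (Suc i)" using s b by blast
  obtain c where c: "c \<Colon> B (Suc i) \<leadsto> E (Suc i)" "Add C (s \<cdot> b) c = \<kappa> (Suc i)"
    using difference_exists[OF s1(3) sb] by blast
  have "Add C (e (Suc i) \<cdot> \<kappa> (Suc i)) (e (Suc i) \<cdot> c) = Add C (e (Suc i) \<cdot> \<kappa> (Suc i)) (Zero C (B (Suc i)) (E (Suc (Suc i))))"
    using comp_add[OF sb c(1) e1] c(2) esb add_zero(1)[OF ek] by simp
  then have "e (Suc i) \<cdot> c = Zero C (B (Suc i)) (E (Suc (Suc i)))"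
    using add_left_cancel[OF ek comp_arr[OF c(1) e1]] arr_obD[OF ek] by blast
  then obtain s' where s': "s' \<Colon> B (Suc i) \<leadsto> E i" "c = e i \<cdot> s'"
    using ker[OF _ c(1)] step.hyps by auto
  have "e i \<cdot> (s' \<cdot> v) = \<kappa> (Suc i) \<cdot> v"
    if v: "v \<Colon> W \<leadsto> B (Suc i)" and z: "e (Suc i) \<cdot> (\<kappa> (Suc i) \<cdot> v) = Zero C W (E (Suc (Suc i)))" for W v
  proof -
    have "b \<cdot> v = Zero C W (B (Suc (Suc i)))"
      unfolding b_def using assoc[OF v ek s2(4)] assoc[OF v s1(3) e1] z comp_zero[OF s2(4)] arr_obD[OF v] by simp
    then have "(s \<cdot> b) \<cdot> v = Zero C W (E (Suc i))"
      using assoc[OF v b s(1)] comp_zero[OF s(1)] arr_obD[OF v] by simp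
    then have "\<kappa> (Suc i) \<cdot> v = c \<cdot> v"
      using c(2) add_comp[OF v sb c(1)] add_zero(2)[OF comp_arr[OF v c(1)]] by simp
    then show ?thesis using s'(2) assoc[OF v s'(1) e0] by simp
  qed
  then show ?case using s'(1) by blast
qed

text \<open>A cycle \<open>y\<close> of \<open>Hom(W, A)\<close> is a cycle of \<open>Hom(W, E)\<close> only up to an error \<open>w\<close> in the discarded part. The
  contraction corrects \<open>\<iota> \<cdot> y\<close> by \<open>s \<cdot> v\<close> to a true cycle, which is a boundary, and the correction disappears under \<open>\<pi>\<close>.\<close>

lemma ker_exact_trunc:
  assumes ker: "\<And>i y Y. \<lbrakk>i \<le> d; y \<Colon> Y \<leadsto> E (Suc i); e (Suc i) \<cdot> y = Zero C Y (E (Suc (Suc i)))\<rbrakk> \<Longrightarrow>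
        \<exists>z. z \<Colon> Y \<leadsto> E i \<and> y = e i \<cdot> z"
    and inj: "\<And>Q y. \<lbrakk>Q \<in> G; y \<Colon> Q \<leadsto> E (d + 2); e (d + 2) \<cdot> y = Zero C Q (E (d + 3))\<rbrakk> \<Longrightarrow> y = Zero C Q (E (d + 2))"
  shows "ker_exact (full_subcategory C S) d A trunc_mor"
proof -
  have "\<exists>z. z \<Colon> W \<leadsto> A i \<and> y = trunc_mor i \<cdot> z"
    if i: "i < d" and y: "y \<Colon> W \<leadsto> A (Suc i)"
      and z: "trunc_mor (Suc i) \<cdot> y = Zero C W (A (Suc (Suc i)))" for i W y
  proof -
    have le: "i \<le> d" "Suc i \<le> d" "i \<le> d + 1" "Suc i \<le> d + 1" "Suc (Suc i) \<le> d + 1" "i \<le> d + 2" "Suc i \<le> d + 2"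
      "Suc (Suc i) \<le> d + 2" using i by auto
    note s0 = split_arr[OF le(3)] and s1 = split_arr[OF le(4)] and s2 = split_arr[OF le(5)]
      and e0 = e_arr[OF le(6)] and e1 = e_arr[OF le(7)] and e2 = e_arr[OF le(8)]
    obtain s where s: "s \<Colon> B (Suc (Suc i)) \<leadsto> E (Suc i)"
      "\<And>W v. v \<Colon> W \<leadsto> B (Suc (Suc i)) \<Longrightarrow> e (Suc (Suc i)) \<cdot> (\<kappa> (Suc (Suc i)) \<cdot> v) = Zero C W (E (Suc (Suc (Suc i)))) \<Longrightarrow>
        e (Suc i) \<cdot> (s \<cdot> v) = \<kappa> (Suc (Suc i)) \<cdot> v"
      using partial_contraction[OF ker inj le(2)] by blast
    have iy: "\<iota> (Suc i) \<cdot> y \<Colon> W \<leadsto> E (Suc i)" using s1 y by blast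
    define w where "w = e (Suc i) \<cdot> (\<iota> (Suc i) \<cdot> y)"
    have w: "w \<Colon> W \<leadsto> E (Suc (Suc i))" unfolding w_def using iy e1 by blast
    have "\<pi> (Suc (Suc i)) \<cdot> w = Zero C W (A (Suc (Suc i)))"
      using z assoc[OF y comp_arr[OF s1(1) e1] s2(2)] assoc[OF y s1(1) e1]
      unfolding w_def trunc_mor_def by simp
    then have wk: "w = \<kappa> (Suc (Suc i)) \<cdot> (\<rho> (Suc (Suc i)) \<cdot> w)"
      using factor_through_\<kappa>[OF le(5) w] by simp
    define v where "v = \<rho> (Suc (Suc i)) \<cdot> w"
    have v: "v \<Colon> W \<leadsto> B (Suc (Suc i))" unfolding v_def using w s2 by blast
    have "e (Suc (Suc i)) \<cdot> w = Zero C W (E (Suc (Suc (Suc i))))"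
      unfolding w_def using assoc[OF iy e1 e2] ee[of "Suc i"] i zero_comp[OF iy] arr_obD(2)[OF e2] by simp
    then have esv: "e (Suc i) \<cdot> (s \<cdot> v) = w" using s(2)[OF v] wk v_def by simp
    have sv: "s \<cdot> v \<Colon> W \<leadsto> E (Suc i)" using s v by blast
    obtain x where x: "x \<Colon> W \<leadsto> E (Suc i)" "Add C (s \<cdot> v) x = \<iota> (Suc i) \<cdot> y"
      using difference_exists[OF iy sv] by blast
    have "Add C w (e (Suc i) \<cdot> x) = Add C w (Zero C W (E (Suc (Suc i))))"
      using comp_add[OF sv x(1) e1] x(2) esv add_zero(1)[OF w] w_def by simp
    then have "e (Suc i) \<cdot> x = Zero C W (E (Suc (Suc i)))"
      using add_left_cancel[OF w comp_arr[OF x(1) e1]] arr_obD[OF w] by blast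
    then obtain t where t: "t \<Colon> W \<leadsto> E i" "x = e i \<cdot> t" using ker[OF le(1) x(1)] by blast
    have "\<pi> (Suc i) \<cdot> s = Zero C (B (Suc (Suc i))) (A (Suc i))"
      using orth[OF AB(2)[OF le(5)] AB(1)[OF le(4)]] comp_arr[OF s(1) s1(2)] by blast
    then have psv: "\<pi> (Suc i) \<cdot> (s \<cdot> v) = Zero C W (A (Suc i))"
      using assoc[OF v s(1) s1(2)] zero_comp[OF v] arr_obD(2)[OF s1(2)] by simp
    have "y = \<pi> (Suc i) \<cdot> (\<iota> (Suc i) \<cdot> y)" using assoc[OF y s1(1,2)] s1(5) id_comp[OF y] by simp
    also have "\<dots> = \<pi> (Suc i) \<cdot> x"
      using x(2) comp_add[OF sv x(1) s1(2)] psv add_zero(2)[OF comp_arr[OF x(1) s1(2)]] by simp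
    also have "\<dots> = trunc_mor i \<cdot> (\<pi> i \<cdot> t)"
      using t(2) assoc[OF t(1) e0 s1(2)] trunc_mor_\<pi>[OF le(1)] assoc[OF t(1) s0(2) trunc_mor_arr[OF le(1)]] by simp
    finally show ?thesis using comp_arr[OF t(1) s0(2)] by blast
  qed
  then show ?thesis unfolding ker_exact_def arr_full_subcategory[OF S_Ob]
    using AB(1) by auto
qed

end

section \<open>From helices to \<open>d\<close>-abelian categories\<close>

text \<open>Both covariant and contravariant exactness are required, so that the notion is self-dual.\<close>

definition exact_helix :: "('o, 'm) preadd \<Rightarrow> nat \<Rightarrow> (nat \<Rightarrow> 'o) \<Rightarrow> (nat \<Rightarrow> 'm) \<Rightarrow> bool" where
  "exact_helix C l E e \<longleftrightarrow>
     (\<forall>i\<le>l. e i \<Colon>\<^bsub>C\<^esub> E i \<leadsto> E (Suc i)) \<and>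
     (\<forall>i<l. e (Suc i) \<cdot>\<^bsub>C\<^esub> e i = Zero C (E i) (E (Suc (Suc i))) \<and>
        (\<forall>Y g. g \<Colon>\<^bsub>C\<^esub> E (Suc i) \<leadsto> Y \<longrightarrow> g \<cdot>\<^bsub>C\<^esub> e i = Zero C (E i) Y \<longrightarrow>
           (\<exists>h. h \<Colon>\<^bsub>C\<^esub> E (Suc (Suc i)) \<leadsto> Y \<and> g = h \<cdot>\<^bsub>C\<^esub> e (Suc i))) \<and>
        (\<forall>Y y. y \<Colon>\<^bsub>C\<^esub> Y \<leadsto> E (Suc i) \<longrightarrow> e (Suc i) \<cdot>\<^bsub>C\<^esub> y = Zero C Y (E (Suc (Suc i))) \<longrightarrow>
           (\<exists>z. z \<Colon>\<^bsub>C\<^esub> Y \<leadsto> E i \<and> y = e i \<cdot>\<^bsub>C\<^esub> z)))"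

lemma exact_helix_opp:
  assumes "exact_helix C l E e"
  shows "exact_helix (opp C) l (\<lambda>i. E (Suc l - i)) (\<lambda>i. e (l - i))"
proof -
  have "e (l - i) \<Colon>\<^bsub>C\<^esub> E (l - i) \<leadsto> E (Suc l - i)" if "i \<le> l" for i
    using assms that unfolding exact_helix_def by (simp add: Suc_diff_le)
  moreover have "l - i = Suc (l - Suc i)" "Suc l - i = Suc (Suc (l - Suc i))" "l - Suc i < l" if "i < l" for i
    using that by auto
  ultimately show ?thesis using assms unfolding exact_helix_def by auto
qed

lemma is_biproduct_opp [simp]:
  "is_biproduct (opp C) A B X \<iota> \<kappa> \<pi> \<rho> \<longleftrightarrow> is_biproduct C A B X \<pi> \<rho> \<iota> \<kappa>"
  by (auto simp: is_biproduct_def)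

lemma is_zero_opp [simp]: "is_zero (opp C) Z \<longleftrightarrow> is_zero C Z"
  by (auto simp: is_zero_def)

definition orthogonal :: "('o, 'm) preadd \<Rightarrow> 'o set \<Rightarrow> 'o set \<Rightarrow> bool" where
  "orthogonal C G S \<longleftrightarrow> (\<forall>Q\<in>G. \<forall>Y\<in>S. \<forall>g. g \<Colon>\<^bsub>C\<^esub> Q \<leadsto> Y \<longrightarrow> g = Zero C Q Y)"

text \<open>What a helix through \<open>u\<close> has to satisfy for the truncation argument. The same notion in the opposite
  category, with \<open>G\<close> replaced by the objects of negative levels, serves for \<open>d\<close>-kernels.\<close>

definition cokernel_helix ::
  "('o, 'm) preadd \<Rightarrow> 'o set \<Rightarrow> 'o set \<Rightarrow> nat \<Rightarrow> 'o \<Rightarrow> 'o \<Rightarrow> 'm \<Rightarrow> (nat \<Rightarrow> 'o) \<Rightarrow> (nat \<Rightarrow> 'm) \<Rightarrow> bool" where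
  "cokernel_helix C S G d A B u E e \<longleftrightarrow> exact_helix C (d + 2) E e \<and> E 0 = A \<and> E 1 = B \<and> e 0 = u \<and>
     E (d + 2) \<in> G \<and>
     (\<forall>i\<le>d + 1. 2 \<le> i \<longrightarrow> (\<exists>A'\<in>S. \<exists>B'\<in>G. \<exists>\<iota> \<kappa> \<pi> \<rho>. is_biproduct C A' B' (E i) \<iota> \<kappa> \<pi> \<rho>)) \<and>
     (is_mono (full_subcategory C S) A B u \<longrightarrow>
       (\<forall>Q\<in>G. \<forall>y. y \<Colon>\<^bsub>C\<^esub> Q \<leadsto> E (d + 2) \<longrightarrow> e (d + 2) \<cdot>\<^bsub>C\<^esub> y = Zero C Q (E (d + 3)) \<longrightarrow> y = Zero C Q (E (d + 2))))"

lemma (in preadditive_category) biproduct_with_zero: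
  assumes "is_zero C Z" "X \<in> Ob C"
  shows "is_biproduct C X Z X (Idm C X) (Zero C Z X) (Idm C X) (Zero C X Z)"
proof -
  have Z: "Z \<in> Ob C" and id0: "Idm C Z = Zero C Z Z"
    using assms Id_in_Hom[of Z] by (auto simp: is_zero_def)
  have z: "Zero C Z X \<Colon> Z \<leadsto> X" "Zero C X Z \<Colon> X \<leadsto> Z" using Z assms by auto
  show ?thesis
    using assms Z z id0 id_arr[OF assms(2)] id_comp[of "Idm C X"] add_zero[of "Idm C X" X X]
      zero_comp[OF z(1)] zero_comp[OF z(2)] id_comp[OF z(1)] comp_id[OF z(2)]
    by (auto simp: is_biproduct_def arr_def)
qed

text \<open>The first two objects lie in \<open>S\<close> and are split trivially, which makes \<open>u\<close> itself the first morphism of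
  the truncated sequence.\<close>

lemma (in preadditive_category) cokernel_of_helix:
  assumes S: "S \<subseteq> Ob C" and orth: "orthogonal C G S"
    and Z: "is_zero C Z" "Z \<in> G" and AB: "A \<in> S" "B \<in> S" and h: "cokernel_helix C S G d A B u E e"
  obtains X f where "coker_seq (full_subcategory C S) d X f" "X 0 = A" "X 1 = B" "f 0 = u"
    "is_mono (full_subcategory C S) A B u \<Longrightarrow> ker_exact (full_subcategory C S) d X f"
proof -
  have ex: "exact_helix C (d + 2) E e" and E: "E 0 = A" "E 1 = B" "e 0 = u" "E (d + 2) \<in> G"
    using h by (auto simp: cokernel_helix_def)
  have e: "e i \<Colon> E i \<leadsto> E (Suc i)" if "i \<le> d + 2" for i
    using ex that by (simp add: exact_helix_def)
  have ee: "e (Suc i) \<cdot> e i = Zero C (E i) (E (Suc (Suc i)))"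
    and cok: "\<And>g Y. g \<Colon> E (Suc i) \<leadsto> Y \<Longrightarrow> g \<cdot> e i = Zero C (E i) Y \<Longrightarrow>
        \<exists>h. h \<Colon> E (Suc (Suc i)) \<leadsto> Y \<and> g = h \<cdot> e (Suc i)"
    and ker: "\<And>y Y. y \<Colon> Y \<leadsto> E (Suc i) \<Longrightarrow> e (Suc i) \<cdot> y = Zero C Y (E (Suc (Suc i))) \<Longrightarrow>
        \<exists>z. z \<Colon> Y \<leadsto> E i \<and> y = e i \<cdot> z" if "i \<le> d + 1" for i
    using ex that unfolding exact_helix_def by simp_all
  define P where "P = (\<lambda>i (A', B', \<iota>, \<pi>, \<kappa>, \<rho>). A' \<in> S \<and> B' \<in> G \<and> is_biproduct C A' B' (E i) \<iota> \<kappa> \<pi> \<rho> \<and>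
      (i \<le> 1 \<longrightarrow> A' = E i \<and> \<iota> = Idm C (E i) \<and> \<pi> = Idm C (E i)))"
  have "\<exists>q. P i q" if i: "i \<le> d + 1" for i
  proof (cases "i \<le> 1")
    case True
    then have "E i \<in> S" using E AB by (cases i) auto
    then show ?thesis using biproduct_with_zero[OF Z(1), of "E i"] Z(2) S
      by (intro exI[of _ "(E i, Z, Idm C (E i), Idm C (E i), Zero C Z (E i), Zero C (E i) Z)"])
        (auto simp: P_def)
  next
    case False
    then have "2 \<le> i" by simp
    then obtain A' B' \<iota> \<pi> \<kappa> \<rho> where "A' \<in> S" "B' \<in> G" "is_biproduct C A' B' (E i) \<iota> \<kappa> \<pi> \<rho>"
      using h i unfolding cokernel_helix_def by blast
    then show ?thesis using False by (intro exI[of _ "(A', B', \<iota>, \<pi>, \<kappa>, \<rho>)"]) (simp add: P_def)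
  qed
  then have "\<forall>i. \<exists>q. i \<le> d + 1 \<longrightarrow> P i q" by blast
  from choice[OF this] obtain q where q: "\<And>i. i \<le> d + 1 \<Longrightarrow> P i (q i)" by blast
  define A' B' \<iota> \<pi> \<kappa> \<rho> where "A' = (\<lambda>i. fst (q i))" and "B' = (\<lambda>i. fst (snd (q i)))"
    and "\<iota> = (\<lambda>i. fst (snd (snd (q i))))" and "\<pi> = (\<lambda>i. fst (snd (snd (snd (q i)))))"
    and "\<kappa> = (\<lambda>i. fst (snd (snd (snd (snd (q i))))))" and "\<rho> = (\<lambda>i. snd (snd (snd (snd (snd (q i))))))"
  have sp: "A' i \<in> S" "B' i \<in> G" "is_biproduct C (A' i) (B' i) (E i) (\<iota> i) (\<kappa> i) (\<pi> i) (\<rho> i)"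
      "i \<le> 1 \<Longrightarrow> A' i = E i \<and> \<iota> i = Idm C (E i) \<and> \<pi> i = Idm C (E i)" if "i \<le> d + 1" for i
    using q[OF that] by (simp_all add: P_def A'_def B'_def \<iota>_def \<pi>_def \<kappa>_def \<rho>_def case_prod_beta)
  interpret split_sequence C S G d E e A' B' \<iota> \<pi> \<kappa> \<rho>
  proof unfold_locales
    show "S \<subseteq> Ob C" by (fact S)
    show "g = Zero C Q Y" if "Q \<in> G" "Y \<in> S" "g \<Colon> Q \<leadsto> Y" for Q Y g using orth that unfolding orthogonal_def by blast
    show "e i \<Colon> E i \<leadsto> E (Suc i)" if "i \<le> d + 2" for i using that by (rule e)
    show "e (Suc i) \<cdot> e i = Zero C (E i) (E (Suc (Suc i)))" if "i \<le> d + 1" for i using that by (rule ee)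
    show "\<exists>h. h \<Colon> E (Suc (Suc i)) \<leadsto> Y \<and> g = h \<cdot> e (Suc i)"
      if "i \<le> d" "g \<Colon> E (Suc i) \<leadsto> Y" "g \<cdot> e i = Zero C (E i) Y" for i g Y
      using cok[OF _ that(2,3)] that(1) by simp
    show "E (Suc (Suc d)) \<in> G" using E(4) by simp
  qed (rule sp; assumption)+
  have "trunc_mor 0 = u"
    unfolding trunc_mor_def using sp(4)[of 0] sp(4)[of 1] E e[of 0] by (auto simp: comp_id id_comp)
  moreover have "ker_exact (full_subcategory C S) d A' trunc_mor" if m: "is_mono (full_subcategory C S) A B u"
  proof (rule ker_exact_trunc)
    show "y = Zero C Q (E (d + 2))" if "Q \<in> G" "y \<Colon> Q \<leadsto> E (d + 2)" "e (d + 2) \<cdot> y = Zero C Q (E (d + 3))" for Q y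
      using h m that unfolding cokernel_helix_def by blast
  qed (rule ker; simp)
  ultimately show ?thesis
    using that[OF coker_seq_trunc] sp(4)[of 0] sp(4)[of 1] E by simp
qed

lemma coker_seq_cong:
  assumes "\<And>i. i \<le> Suc d \<Longrightarrow> X i = X' i" "\<And>i. i \<le> d \<Longrightarrow> f i = f' i"
  shows "coker_seq C d X f \<longleftrightarrow> coker_seq C d X' f'"
  unfolding coker_seq_def using assms by (simp add: Suc_leI less_imp_le)

lemma opp_opp [simp]: "opp (opp C) = C"
  by (simp add: opp_def)

lemma (in preadditive_category) d_exact_opp:
  assumes "d_exact (opp C) d (\<lambda>i. X (d + 1 - i)) (\<lambda>i. f (d - i))"
  shows "d_exact C d X f"
proof -
  have "coker_seq C d (\<lambda>i. X (d + 1 - (d + 1 - i))) (\<lambda>i. f (d - (d - i)))"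
    using assms d_kernel_opp[of "opp C"] d_cokernel_iff by (simp add: d_exact_def)
  moreover have "coker_seq C d (\<lambda>i. X (d + 1 - (d + 1 - i))) (\<lambda>i. f (d - (d - i))) \<longleftrightarrow> coker_seq C d X f"
    by (rule coker_seq_cong) auto
  ultimately have "coker_seq C d X f" by simp
  then show ?thesis using assms d_kernel_opp d_cokernel_iff by (auto simp: d_exact_def)
qed

lemma (in preadditive_category) cokernels_from_helices:
  assumes S: "S \<subseteq> Ob C" and orth: "orthogonal C G S"
    and Z: "is_zero C Z" "Z \<in> G"
    and h: "\<forall>A\<in>S. \<forall>B\<in>S. \<forall>u\<in>Hom C A B. \<exists>E e. cokernel_helix C S G d A B u E e"
  shows "\<lbrakk>A \<in> S; B \<in> S; u \<in> Hom C A B\<rbrakk> \<Longrightarrow>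
      \<exists>X f. d_cokernel (full_subcategory C S) d X f \<and> X 0 = A \<and> X 1 = B \<and> f 0 = u"
    and "\<lbrakk>d_cokernel (full_subcategory C S) d X f; is_mono (full_subcategory C S) (X 0) (X 1) (f 0)\<rbrakk>
      \<Longrightarrow> d_exact (full_subcategory C S) d X f"
proof -
  interpret S: preadditive_category "full_subcategory C S" using preadditive_full_subcategory[OF S] .
  show "\<exists>X f. d_cokernel (full_subcategory C S) d X f \<and> X 0 = A \<and> X 1 = B \<and> f 0 = u"
    if u: "A \<in> S" "B \<in> S" "u \<in> Hom C A B"
  proof -
    obtain E e where "cokernel_helix C S G d A B u E e" using h u by blast
    from cokernel_of_helix[OF S orth Z u(1,2) this] obtain X f
      where X: "coker_seq (full_subcategory C S) d X f" "X 0 = A" "X 1 = B" "f 0 = u" .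
    show ?thesis using X by (intro exI[of _ X] exI[of _ f]) (simp add: S.d_cokernel_iff)
  qed
  show "d_exact (full_subcategory C S) d X f"
    if c: "d_cokernel (full_subcategory C S) d X f"
      and m: "is_mono (full_subcategory C S) (X 0) (X 1) (f 0)"
  proof -
    have c': "coker_seq (full_subcategory C S) d X f" using c S.d_cokernel_iff by simp
    have u: "X 0 \<in> S" "X 1 \<in> S" "f 0 \<in> Hom C (X 0) (X 1)"
      using S.coker_seqD(1)[OF c', of 0] by (auto simp: arr_def)
    obtain E e where E: "cokernel_helix C S G d (X 0) (X 1) (f 0) E e" using h u by blast
    obtain X' f' where x': "coker_seq (full_subcategory C S) d X' f'" "X' 0 = X 0" "X' 1 = X 1" "f' 0 = f 0"
      "ker_exact (full_subcategory C S) d X' f'"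
      using cokernel_of_helix[OF S orth Z u(1,2) E] m by blast
    show ?thesis
      unfolding d_exact_def
      using c S.d_kernelI[OF c' S.ker_exact_transfer[OF c' x'(1) x'(2-4)[symmetric] x'(5)] m] by blast
  qed
qed

text \<open>\<open>G\<close> has no morphisms to \<open>S\<close>, and \<open>S\<close> has none to \<open>L\<close>. The hypotheses are interchanged by passing to the opposite
  category, which exchanges the cokernel half and the kernel half of the definition of a \<open>d\<close>-abelian category.\<close>

lemma (in preadditive_category) d_abelian_from_helices:
  assumes S: "S \<subseteq> Ob C" and d: "d \<ge> 1"
    and add: "additive_category (full_subcategory C S)" and idem: "idempotent_complete (full_subcategory C S)"
    and Z: "is_zero C Z" "Z \<in> G" "Z \<in> L"
    and orth: "orthogonal C G S"
    and orth': "orthogonal C S L"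
    and h: "\<forall>A\<in>S. \<forall>B\<in>S. \<forall>u\<in>Hom C A B. \<exists>E e. cokernel_helix C S G d A B u E e"
    and h': "\<forall>A\<in>S. \<forall>B\<in>S. \<forall>u\<in>Hom C A B. \<exists>E e. cokernel_helix (opp C) S L d B A u E e"
  shows "d_abelian d (full_subcategory C S)"
proof -
  interpret O: preadditive_category "opp C" using preadditive_opp .
  interpret S: preadditive_category "full_subcategory C S" using preadditive_full_subcategory[OF S] .
  have orthO: "orthogonal (opp C) L S" using orth' by (auto simp: orthogonal_def)
  have hO: "\<forall>A\<in>S. \<forall>B\<in>S. \<forall>u\<in>Hom (opp C) A B. \<exists>E e. cokernel_helix (opp C) S L d A B u E e"
    using h' by simp
  have SO: "S \<subseteq> Ob (opp C)" and ZO: "is_zero (opp C) Z" using S Z by simp_all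
  note coker = cokernels_from_helices[OF S orth Z(1,2) h]
  note ker = O.cokernels_from_helices[OF SO orthO ZO Z(3) hO]
  show ?thesis
    unfolding d_abelian_def
  proof (intro conjI ballI allI impI)
    fix A B u assume "A \<in> Ob (full_subcategory C S)" "B \<in> Ob (full_subcategory C S)" "u \<in> Hom (full_subcategory C S) A B"
    then have u: "A \<in> S" "B \<in> S" "u \<in> Hom C A B" by auto
    show "\<exists>X f. d_cokernel (full_subcategory C S) d X f \<and> X 0 = A \<and> X 1 = B \<and> f 0 = u"
      using coker(1)[OF u] .
    obtain X f where "d_cokernel (full_subcategory (opp C) S) d X f" "X 0 = B" "X 1 = A" "f 0 = u"
      using ker(1)[of B A u] u by auto
    then have "coker_seq (opp (full_subcategory C S)) d X f"
      using preadditive_category.d_cokernel_iff[OF S.preadditive_opp] by (simp add: opp_full_subcategory)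
    moreover have "coker_seq (opp (full_subcategory C S)) d (\<lambda>i. X (d + 1 - (d + 1 - i))) (\<lambda>i. f (d - (d - i)))
        \<longleftrightarrow> coker_seq (opp (full_subcategory C S)) d X f"
      by (rule coker_seq_cong) auto
    ultimately have "d_kernel (full_subcategory C S) d (\<lambda>i. X (d + 1 - i)) (\<lambda>i. f (d - i))"
      using S.d_kernel_iff by simp
    then show "\<exists>X f. d_kernel (full_subcategory C S) d X f \<and> X d = A \<and> X (d + 1) = B \<and> f d = u"
      using \<open>X 0 = B\<close> \<open>X 1 = A\<close> \<open>f 0 = u\<close>
      by (intro exI[of _ "\<lambda>i. X (d + 1 - i)"] exI[of _ "\<lambda>i. f (d - i)"]) simp
  next
    fix X f assume "d_cokernel (full_subcategory C S) d X f \<and> is_mono (full_subcategory C S) (X 0) (X 1) (f 0)"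
    then show "d_exact (full_subcategory C S) d X f" using coker(2) by blast
  next
    fix X f assume a: "d_kernel (full_subcategory C S) d X f \<and> is_epi (full_subcategory C S) (X d) (X (d + 1)) (f d)"
    have "d_cokernel (full_subcategory (opp C) S) d (\<lambda>i. X (d + 1 - i)) (\<lambda>i. f (d - i))"
      using a d_kernel_opp[of "full_subcategory C S"] by (simp add: opp_full_subcategory)
    moreover have "is_mono (full_subcategory (opp C) S) (X (d + 1)) (X d) (f d)"
      using a is_mono_opp[of "full_subcategory C S"] by (simp add: opp_full_subcategory)
    ultimately have "d_exact (full_subcategory (opp C) S) d (\<lambda>i. X (d + 1 - i)) (\<lambda>i. f (d - i))"
      using ker(2) by simp
    then show "d_exact (full_subcategory C S) d X f"
      using S.d_exact_opp by (simp add: opp_full_subcategory)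
  qed (use d add idem in auto)
qed

section \<open>Angles and helices\<close>

context preadditive_category
begin

lemma neg_arr [intro]: "f \<Colon> X \<leadsto> Y \<Longrightarrow> neg C X Y f \<Colon> X \<leadsto> Y"
  and add_neg: "f \<Colon> X \<leadsto> Y \<Longrightarrow> Add C f (neg C X Y f) = Zero C X Y"
proof -
  assume f: "f \<Colon> X \<leadsto> Y"
  interpret G: comm_group "hom_group C X Y" using f by (auto simp: arr_def intro: hom_comm_group)
  have c: "f \<in> carrier (hom_group C X Y)" using f by (simp add: arr_def hom_group_def)
  show "neg C X Y f \<Colon> X \<leadsto> Y"
    using G.inv_closed[OF c] f unfolding neg_def by (simp add: arr_def hom_group_def)
  show "Add C f (neg C X Y f) = Zero C X Y"
    using G.r_inv[OF c] unfolding neg_def by (simp add: hom_group_def)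
qed

lemma neg_unique:
  assumes "f \<Colon> X \<leadsto> Y" "g \<Colon> X \<leadsto> Y" "Add C f g = Zero C X Y"
  shows "g = neg C X Y f"
  using add_left_cancel[OF assms(1,2) neg_arr[OF assms(1)]] add_neg[OF assms(1)] assms(3) by simp

lemma neg_neg: "f \<Colon> X \<leadsto> Y \<Longrightarrow> neg C X Y (neg C X Y f) = f"
  using neg_unique[OF neg_arr, of f X Y f] add_neg add_comm[OF neg_arr, of f X Y f] by simp

lemma neg_comp:
  assumes f: "f \<Colon> X \<leadsto> Y" and g: "g \<Colon> Y \<leadsto> Z"
  shows "neg C Y Z g \<cdot> f = neg C X Z (g \<cdot> f)"
proof (rule neg_unique)
  show "Add C (g \<cdot> f) (neg C Y Z g \<cdot> f) = Zero C X Z"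
    using add_comp[OF f g neg_arr[OF g]] add_neg[OF g] zero_comp[OF f] arr_obD(2)[OF g] by simp
qed (use f g in auto)

lemma comp_neg:
  assumes f: "f \<Colon> X \<leadsto> Y" and g: "g \<Colon> Y \<leadsto> Z"
  shows "g \<cdot> neg C X Y f = neg C X Z (g \<cdot> f)"
proof (rule neg_unique)
  show "Add C (g \<cdot> f) (g \<cdot> neg C X Y f) = Zero C X Z"
    using comp_add[OF f neg_arr[OF f] g] add_neg[OF f] comp_zero[OF g] arr_obD(1)[OF f] by simp
qed (use f g in auto)

end

context additive_automorphism
begin

lemma So_Ob: "X \<in> Ob C \<Longrightarrow> So X \<in> Ob C"
  using So_bij by (auto simp: bij_betw_def)

lemma So_inj: "X \<in> Ob C \<Longrightarrow> Y \<in> Ob C \<Longrightarrow> So X = So Y \<Longrightarrow> X = Y"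
  using So_bij by (auto simp: bij_betw_def inj_on_def)

lemma So_surj: "Y \<in> Ob C \<Longrightarrow> \<exists>X\<in>Ob C. Y = So X"
  using So_bij by (auto simp: bij_betw_def)

lemma Sm_arr: "f \<Colon> X \<leadsto> Y \<Longrightarrow> Sm f \<Colon> So X \<leadsto> So Y"
  using Sm_bij[of X Y] by (auto simp: arr_def So_Ob bij_betw_def)

lemma Sm_inj: "f \<Colon> X \<leadsto> Y \<Longrightarrow> g \<Colon> X \<leadsto> Y \<Longrightarrow> Sm f = Sm g \<Longrightarrow> f = g"
  using Sm_bij[of X Y] by (auto simp: arr_def bij_betw_def inj_on_def)

lemma Sm_surj: "X \<in> Ob C \<Longrightarrow> Y \<in> Ob C \<Longrightarrow> g \<Colon> So X \<leadsto> So Y \<Longrightarrow> \<exists>f. f \<Colon> X \<leadsto> Y \<and> g = Sm f"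
  using Sm_bij[of X Y] by (auto simp: arr_def bij_betw_def)

lemma Sm_comp: "f \<Colon> X \<leadsto> Y \<Longrightarrow> g \<Colon> Y \<leadsto> Z \<Longrightarrow> Sm (g \<cdot> f) = Sm g \<cdot> Sm f"
  by (auto simp: arr_def intro: Sm_Comp)

lemma Sm_zero:
  assumes "X \<in> Ob C" "Y \<in> Ob C"
  shows "Sm (Zero C X Y) = Zero C (So X) (So Y)"
proof -
  have z: "Zero C X Y \<Colon> X \<leadsto> Y" using assms by blast
  have "Add C (Sm (Zero C X Y)) (Sm (Zero C X Y)) = Add C (Sm (Zero C X Y)) (Zero C (So X) (So Y))"
    using Sm_Add[of X Y "Zero C X Y" "Zero C X Y"] z add_zero(1)[OF z] add_zero(1)[OF Sm_arr[OF z]] assms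
    by (auto simp: arr_def)
  then show ?thesis
    using add_left_cancel[OF Sm_arr[OF z] Sm_arr[OF z] zero_arr[OF So_Ob So_Ob]] assms by blast
qed

lemma So_is_zero:
  assumes "is_zero C Z"
  shows "is_zero C (So Z)"
proof -
  have Z: "Z \<in> Ob C" using assms by (simp add: is_zero_def)
  have "Hom C Y (So Z) = {Zero C Y (So Z)} \<and> Hom C (So Z) Y = {Zero C (So Z) Y}" if Y: "Y \<in> Ob C" for Y
  proof -
    obtain X where X: "X \<in> Ob C" "Y = So X" using So_surj[OF Y] by blast
    then have "Hom C X Z = {Zero C X Z}" "Hom C Z X = {Zero C Z X}" using assms by (auto simp: is_zero_def)
    then show ?thesis
      using Sm_bij[of X Z] Sm_bij[of Z X] Sm_zero[of X Z] Sm_zero[of Z X] X Z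
      by (auto simp: bij_betw_def)
  qed
  then show ?thesis using So_Ob[OF Z] by (auto simp: is_zero_def)
qed

end

lemma ext_less: "i < n + 2 \<Longrightarrow> ext n S x i = x i"
  by (simp add: ext_def)

context angulated_category
begin

text \<open>The sign \<open>(-1) ^ n\<close> of the rotation axiom is built in, so that a helix is continued by applying \<open>susp\<close>.\<close>

definition susp :: "'o \<Rightarrow> 'o \<Rightarrow> 'm \<Rightarrow> 'm" where
  "susp X Y f = (if even n then Sm f else neg C (So X) (So Y) (Sm f))"

lemma susp_arr: "f \<Colon> X \<leadsto> Y \<Longrightarrow> susp X Y f \<Colon> So X \<leadsto> So Y"
  unfolding susp_def using Sm_arr[of f X Y] neg_arr by auto

lemma susp_inj: "f \<Colon> X \<leadsto> Y \<Longrightarrow> g \<Colon> X \<leadsto> Y \<Longrightarrow> susp X Y f = susp X Y g \<Longrightarrow> f = g"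
  unfolding susp_def
  by (cases "even n") (simp_all add: Sm_inj, metis Sm_inj Sm_arr neg_neg)

lemma susp_surj:
  assumes "X \<in> Ob C" "Y \<in> Ob C" "g \<Colon> So X \<leadsto> So Y"
  shows "\<exists>f. f \<Colon> X \<leadsto> Y \<and> g = susp X Y f"
proof (cases "even n")
  case True
  then show ?thesis using Sm_surj[OF assms] by (auto simp: susp_def)
next
  case False
  obtain f where f: "f \<Colon> X \<leadsto> Y" "neg C (So X) (So Y) g = Sm f"
    using Sm_surj[OF assms(1,2) neg_arr[OF assms(3)]] by blast
  then have "g = susp X Y f" using False neg_neg[OF assms(3)] by (simp add: susp_def)
  then show ?thesis using f by blast
qed

lemma susp_comp_zero_iff:
  assumes "f \<Colon> X \<leadsto> Y" "g \<Colon> W \<leadsto> X"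
  shows "susp X Y f \<cdot> Sm g = Zero C (So W) (So Y) \<longleftrightarrow> f \<cdot> g = Zero C W Y"
proof -
  have fg: "f \<cdot> g \<Colon> W \<leadsto> Y" using assms by blast
  have z: "Zero C W Y \<Colon> W \<leadsto> Y" using fg arr_obD by blast
  have "susp X Y f \<cdot> Sm g = susp W Y (f \<cdot> g)"
    unfolding susp_def using Sm_comp[OF assms(2,1)] neg_comp[OF Sm_arr[OF assms(2)] Sm_arr[OF assms(1)]] by simp
  moreover have "susp W Y (Zero C W Y) = Zero C (So W) (So Y)"
    unfolding susp_def using Sm_zero[OF arr_obD[OF fg]]
      neg_unique[OF Sm_arr[OF z] Sm_arr[OF z]] add_zero(1)[OF Sm_arr[OF z]] by simp
  ultimately show ?thesis using susp_inj[OF fg z] by metis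
qed

lemma comp_susp_zero_iff:
  assumes "f \<Colon> X \<leadsto> Y" "g \<Colon> Y \<leadsto> W"
  shows "Sm g \<cdot> susp X Y f = Zero C (So X) (So W) \<longleftrightarrow> g \<cdot> f = Zero C X W"
proof -
  have fg: "g \<cdot> f \<Colon> X \<leadsto> W" using assms by blast
  have z: "Zero C X W \<Colon> X \<leadsto> W" using fg arr_obD by blast
  have "Sm g \<cdot> susp X Y f = susp X W (g \<cdot> f)"
    unfolding susp_def using Sm_comp[OF assms] comp_neg[OF Sm_arr[OF assms(1)] Sm_arr[OF assms(2)]] by simp
  moreover have "susp X W (Zero C X W) = Zero C (So X) (So W)"
    unfolding susp_def using Sm_zero[OF arr_obD[OF fg]]
      neg_unique[OF Sm_arr[OF z] Sm_arr[OF z]] add_zero(1)[OF Sm_arr[OF z]] by simp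
  ultimately show ?thesis using susp_inj[OF fg z] by metis
qed

lemma angle_arr:
  assumes "angle X f"
  shows "i < n + 1 \<Longrightarrow> f i \<Colon> X i \<leadsto> X (Suc i)" and "f (n + 1) \<Colon> X (n + 1) \<leadsto> So (X 0)"
proof -
  have s: "X i \<in> Ob C \<and> f i \<in> Hom C (X i) (ext n So X (i + 1))" if "i < n + 2" for i
    using angle_seq[OF assms] that by (simp add: is_seq_def)
  show "f i \<Colon> X i \<leadsto> X (Suc i)" if "i < n + 1"
    using s[of i] s[of "Suc i"] that by (simp add: arr_def ext_less)
  show "f (n + 1) \<Colon> X (n + 1) \<leadsto> So (X 0)"
    using s[of "n + 1"] s[of 0] by (simp add: arr_def ext_def So_Ob)
qed

lemma is_seqI:
  assumes "\<And>i. i < n + 1 \<Longrightarrow> f i \<Colon> X i \<leadsto> X (Suc i)" "f (n + 1) \<Colon> X (n + 1) \<leadsto> So (X 0)"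
  shows "is_seq C So n X f"
  unfolding is_seq_def
proof (intro allI impI)
  fix i assume "i < n + 2"
  then consider "i < n + 1" | "i = n + 1" by linarith
  then show "X i \<in> Ob C \<and> f i \<in> Hom C (X i) (ext n So X (i + 1))"
    by cases (use assms in \<open>auto simp: arr_def ext_def\<close>)
qed

text \<open>Closure under isomorphisms, applied to identities, because the values beyond \<open>n + 1\<close> are irrelevant.\<close>

lemma angle_cong:
  assumes a: "angle X f" and X: "\<And>i. i < n + 2 \<Longrightarrow> Y i = X i" and f: "\<And>i. i < n + 2 \<Longrightarrow> g i = f i"
  shows "angle Y g"
proof (rule F1_iso[OF a])
  note fa = angle_arr[OF a]
  have ob: "X i \<in> Ob C" if "i < n + 2" for i using angle_seq[OF a] that by (simp add: is_seq_def)
  show "is_seq C So n Y g" by (rule is_seqI) (use fa X f in auto)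
  show "seq_mor C Sm n X f Y g (\<lambda>i. Idm C (X i))"
    unfolding seq_mor_def
  proof (intro allI impI)
    fix i assume i: "i < n + 2"
    then consider "i < n + 1" | "i = n + 1" by linarith
    then show "Idm C (X i) \<in> Hom C (X i) (Y i) \<and> ext n Sm (\<lambda>i. Idm C (X i)) (i + 1) \<cdot> f i = g i \<cdot> Idm C (X i)"
    proof cases
      case 1
      then show ?thesis using X[OF i] f[OF i] ob[OF i] fa(1)[OF 1] by (simp add: ext_less Id_in_Hom comp_id id_comp)
    next
      case 2
      then show ?thesis using X[OF i] f[OF i] ob[OF i] ob[of 0] fa(2)
        by (simp add: ext_def Id_in_Hom comp_id id_comp Sm_Id)
    qed
  qed
  show "is_iso C (X i) (Y i) (Idm C (X i))" if "i < n + 2" for i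
    using X[OF that] ob[OF that] Id_in_Hom[OF ob[OF that]] id_comp[OF id_arr[OF ob[OF that]]]
    by (auto simp: is_iso_def)
qed

lemma F3_arr:
  assumes "angle X f" "angle Y g" "u \<Colon> X 0 \<leadsto> Y 0" "v \<Colon> X 1 \<leadsto> Y 1" "g 0 \<cdot> u = v \<cdot> f 0"
  obtains \<phi> where "\<phi> 0 = u" "\<phi> 1 = v" "\<And>i. i < n + 2 \<Longrightarrow> \<phi> i \<Colon> X i \<leadsto> Y i"
    "\<And>i. i < n + 1 \<Longrightarrow> \<phi> (Suc i) \<cdot> f i = g i \<cdot> \<phi> i"
    "Sm u \<cdot> f (n + 1) = g (n + 1) \<cdot> \<phi> (n + 1)"
proof -
  obtain \<phi> where \<phi>: "seq_mor C Sm n X f Y g \<phi>" "\<phi> 0 = u" "\<phi> 1 = v"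
    using F3[OF assms(1,2), of u v] assms(3-5) by (auto simp: arr_def)
  have q: "\<phi> i \<in> Hom C (X i) (Y i) \<and> ext n Sm \<phi> (i + 1) \<cdot> f i = g i \<cdot> \<phi> i" if "i < n + 2" for i
    using \<phi>(1) that by (simp add: seq_mor_def)
  show ?thesis
  proof (rule that[OF \<phi>(2,3)])
    show "\<phi> i \<Colon> X i \<leadsto> Y i" if "i < n + 2" for i
      using q[OF that] angle_seq[OF assms(1)] angle_seq[OF assms(2)] that by (auto simp: is_seq_def arr_def)
    show "\<phi> (Suc i) \<cdot> f i = g i \<cdot> \<phi> i" if "i < n + 1" for i
      using q[of i] that by (simp add: ext_less)
    show "Sm u \<cdot> f (n + 1) = g (n + 1) \<cdot> \<phi> (n + 1)"
      using q[of "n + 1"] \<phi>(2) by (simp add: ext_def)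
  qed
qed

lemma rot_angle:
  assumes "angle X f"
  shows "angle (rot_ob So n X) (rot_mor C So Sm n X f)"
  using F2[OF angle_seq[OF assms]] assms by blast

lemma rot_simps:
  "i < n + 1 \<Longrightarrow> rot_ob So n X i = X (Suc i)" "rot_ob So n X (n + 1) = So (X 0)"
  "i < n + 1 \<Longrightarrow> rot_mor C So Sm n X f i = f (Suc i)" "rot_mor C So Sm n X f (n + 1) = susp (X 0) (X 1) (f 0)"
  by (simp_all add: rot_ob_def rot_mor_def susp_def ext_def)

lemma trivial_angle:
  assumes Y: "Y \<in> Ob C" and n: "n \<ge> 1"
  obtains X f where "angle X f" "X 0 = Y" "X 1 = Y" "f 0 = Idm C Y"
    "\<And>i. 2 \<le> i \<Longrightarrow> i \<le> n + 1 \<Longrightarrow> is_zero C (X i)" "f 1 = Zero C Y (X 2)"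
proof -
  obtain Z where Z: "is_zero C Z" using zero_object by blast
  then have ZO: "Z \<in> Ob C" by (simp add: is_zero_def)
  define X where "X = (\<lambda>i::nat. if i \<le> 1 then Y else Z)"
  define f where "f = (\<lambda>i::nat. if i = 0 then Idm C Y else if i = n + 1 then Zero C Z (So Y) else Zero C (X i) (X (i + 1)))"
  have "is_seq C So n X f"
    by (rule is_seqI) (use n Y ZO So_Ob in \<open>auto simp: X_def f_def\<close>)
  then have "angle X f"
    by (rule F1_trivial[OF Y]) (auto simp: X_def f_def Z)
  then show ?thesis
    using that[of X f] Z n by (auto simp: X_def f_def numeral_2_eq_2)
qed

text \<open>Compare with the trivial angle on \<open>X 0\<close>: the identity and \<open>f 0\<close> extend to a morphism of angles, which factors
  \<open>f 1 \<cdot> f 0\<close> through a zero object.\<close>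

lemma angle_comp_zero:
  assumes a: "angle X f" and n: "n \<ge> 1"
  shows "f 1 \<cdot> f 0 = Zero C (X 0) (X 2)"
proof -
  have f: "f 0 \<Colon> X 0 \<leadsto> X 1" "f 1 \<Colon> X 1 \<leadsto> X 2"
    using angle_arr(1)[OF a, of 0] angle_arr(1)[OF a, of 1] n by (auto simp: numeral_2_eq_2)
  obtain Y g where g: "angle Y g" "Y 0 = X 0" "Y 1 = X 0" "g 0 = Idm C (X 0)" "g 1 = Zero C (X 0) (Y 2)"
    using trivial_angle[OF arr_obD(1)[OF f(1)] n] by metis
  have u: "Idm C (X 0) \<Colon> Y 0 \<leadsto> X 0" "f 0 \<Colon> Y 1 \<leadsto> X 1" using f(1) g arr_obD by auto
  obtain \<phi> where \<phi>: "\<phi> 1 = f 0" "\<And>i. i < n + 2 \<Longrightarrow> \<phi> i \<Colon> Y i \<leadsto> X i"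
    "\<And>i. i < n + 1 \<Longrightarrow> \<phi> (Suc i) \<cdot> g i = f i \<cdot> \<phi> i"
    using F3_arr[OF g(1) a u] g(4) by metis
  have "\<phi> 2 \<Colon> Y 2 \<leadsto> X 2" "\<phi> 2 \<cdot> g 1 = f 1 \<cdot> f 0" using \<phi>(2)[of 2] \<phi>(3)[of 1] \<phi>(1) n by (auto simp: numeral_2_eq_2)
  then show ?thesis using comp_zero[of "\<phi> 2" "Y 2" "X 2" "X 0"] g(5) arr_obD(1)[OF f(1)] by simp
qed

text \<open>If \<open>f 1 \<cdot> y = 0\<close>, then \<open>y\<close> starts a morphism from the rotated trivial angle \<open>Y \<rightarrow> 0 \<rightarrow> \<dots> \<rightarrow> \<Sigma> Y \<rightarrow> \<Sigma> Y\<close> to the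
  rotation of the given angle. Its last component is the suspension of the lift; both rotations carry the
  same sign.\<close>

lemma angle_weak_kernel:
  assumes a: "angle X f" and n: "n \<ge> 1" and y: "y \<Colon> Y \<leadsto> X 1" and z: "f 1 \<cdot> y = Zero C Y (X 2)"
  shows "\<exists>z. z \<Colon> Y \<leadsto> X 0 \<and> y = f 0 \<cdot> z"
proof -
  have f: "f 0 \<Colon> X 0 \<leadsto> X 1" "f 1 \<Colon> X 1 \<leadsto> X 2"
    using angle_arr(1)[OF a, of 0] angle_arr(1)[OF a, of 1] n by (auto simp: numeral_2_eq_2)
  have Y: "Y \<in> Ob C" using y arr_obD by blast
  obtain W g where g: "angle W g" "W 0 = Y" "W 1 = Y" "g 0 = Idm C Y"
    "\<And>i. 2 \<le> i \<Longrightarrow> i \<le> n + 1 \<Longrightarrow> is_zero C (W i)" "g 1 = Zero C Y (W 2)"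
    using trivial_angle[OF Y n] by metis
  have W2: "W 2 \<in> Ob C" using g(5)[of 2] n by (auto simp: is_zero_def)
  define R r where "R = rot_ob So n W" and "r = rot_mor C So Sm n W g"
  define V v where "V = rot_ob So n X" and "v = rot_mor C So Sm n X f"
  have ar: "angle R r" "angle V v" using rot_angle a g(1) unfolding R_def r_def V_def v_def by auto
  have R: "R 0 = Y" "R 1 = W 2" "r 0 = Zero C Y (W 2)" "R (n + 1) = So Y" "r (n + 1) = susp Y Y (Idm C Y)"
    and V: "V 0 = X 1" "V 1 = X 2" "v 0 = f 1" "V (n + 1) = So (X 0)" "v (n + 1) = susp (X 0) (X 1) (f 0)"
    using rot_simps(1)[of 0] rot_simps(1)[of 1] rot_simps(3)[of 0] rot_simps(2,4) n g
    unfolding R_def r_def V_def v_def by (auto simp: numeral_2_eq_2)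
  have "v 0 \<cdot> y = Zero C (W 2) (X 2) \<cdot> r 0"
    using z zero_comp[OF zero_arr[OF Y W2]] f(2) arr_obD R V by simp
  then obtain \<phi> where \<phi>: "\<phi> (n + 1) \<Colon> R (n + 1) \<leadsto> V (n + 1)" "Sm y \<cdot> r (n + 1) = v (n + 1) \<cdot> \<phi> (n + 1)"
    using F3_arr[OF ar, of y "Zero C (W 2) (X 2)"] y W2 f(2) arr_obD R V
    by (metis add_strict_left_mono less_numeral_extra(1) one_less_numeral_iff semiring_norm(76) zero_arr)
  then obtain t where t: "t \<Colon> Y \<leadsto> X 0" "\<phi> (n + 1) = Sm t"
    using Sm_surj[OF Y arr_obD(1)[OF f(1)]] R V by auto
  have i: "Idm C Y \<Colon> Y \<leadsto> Y" using Y by blast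
  have "susp Y (X 1) y = susp Y (X 1) (f 0 \<cdot> t)"
  proof (cases "even n")
    case True
    then show ?thesis using \<phi>(2) R V t Sm_comp[OF i y] comp_id[OF y] Sm_comp[OF t(1) f(1)] by (simp add: susp_def)
  next
    case False
    then have "Sm y \<cdot> neg C (So Y) (So Y) (Sm (Idm C Y)) = neg C (So (X 0)) (So (X 1)) (Sm (f 0)) \<cdot> Sm t"
      using \<phi>(2) R V t(2) by (simp add: susp_def)
    then show ?thesis
      using False comp_neg[OF Sm_arr[OF i] Sm_arr[OF y]] neg_comp[OF Sm_arr[OF t(1)] Sm_arr[OF f(1)]]
        Sm_comp[OF i y] comp_id[OF y] Sm_comp[OF t(1) f(1)] by (simp add: susp_def)
  qed
  then show ?thesis using susp_inj[OF y comp_arr[OF t(1) f(1)]] t(1) by blast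
qed

text \<open>If \<open>y \<cdot> f 0 = 0\<close>, then \<open>y\<close> extends to a morphism to the angle \<open>0 \<rightarrow> Y \<rightarrow> Y \<rightarrow> 0 \<rightarrow> \<dots>\<close>, the rotation of which is
  a trivial angle.\<close>

lemma angle_weak_cokernel:
  assumes a: "angle X f" and n: "n \<ge> 1" and y: "y \<Colon> X 1 \<leadsto> Y" and z: "y \<cdot> f 0 = Zero C (X 0) Y"
  shows "\<exists>z. z \<Colon> X 2 \<leadsto> Y \<and> y = z \<cdot> f 1"
proof -
  have f: "f 0 \<Colon> X 0 \<leadsto> X 1" "f 1 \<Colon> X 1 \<leadsto> X 2"
    using angle_arr(1)[OF a, of 0] angle_arr(1)[OF a, of 1] n by (auto simp: numeral_2_eq_2)
  have Y: "Y \<in> Ob C" using y arr_obD by blast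
  obtain Z where Z: "is_zero C Z" using zero_object by blast
  then have ZO: "Z \<in> Ob C" "So Z \<in> Ob C" by (auto simp: is_zero_def So_Ob)
  define V where "V = (\<lambda>i::nat. if i = 1 \<or> i = 2 then Y else Z)"
  define v where "v = (\<lambda>i::nat. if i = 1 then Idm C Y else if i = n + 1 then Zero C (V i) (So Z) else Zero C (V i) (V (i + 1)))"
  have V: "V i \<in> Ob C" for i using Y ZO by (auto simp: V_def)
  have s: "is_seq C So n V v"
    by (rule is_seqI) (use n V Y ZO in \<open>auto simp: v_def\<close>, auto simp: V_def)
  have "angle (rot_ob So n V) (rot_mor C So Sm n V v)"
  proof (rule F1_trivial[OF Y])
    have "susp (V 0) (V 1) (v 0) \<Colon> So (V 0) \<leadsto> So (V 1)"
      using susp_arr[of "v 0" "V 0" "V 1"] V zero_arr[OF V V, of 0 1] by (simp add: v_def)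
    then show "is_seq C So n (rot_ob So n V) (rot_mor C So Sm n V v)"
    proof (intro is_seqI)
      fix i assume i: "i < n + 1"
      show "rot_mor C So Sm n V v i \<Colon> rot_ob So n V i \<leadsto> rot_ob So n V (Suc i)"
      proof (cases "i = n")
        case True
        have "v (n + 1) \<Colon> V (n + 1) \<leadsto> So Z" using n V ZO by (auto simp: v_def)
        then show ?thesis using True rot_simps(2) i by (simp add: rot_simps(1,3)) (simp add: rot_ob_def ext_def V_def)
      next
        case False
        then have "v (Suc i) \<Colon> V (Suc i) \<leadsto> V (Suc (Suc i))"
          using V Y id_arr[OF Y] i by (auto simp: v_def) (auto simp: V_def)
        then show ?thesis using False i by (simp add: rot_simps)
      qed
    next
      show "rot_mor C So Sm n V v (n + 1) \<Colon> rot_ob So n V (n + 1) \<leadsto> So (rot_ob So n V 0)"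
        using \<open>susp (V 0) (V 1) (v 0) \<Colon> So (V 0) \<leadsto> So (V 1)\<close> rot_simps(2,4) rot_simps(1)[of 0] by simp
    qed
    show "is_zero C (rot_ob So n V i)" if "2 \<le> i" "i \<le> n + 1" for i
      using that Z So_is_zero[OF Z] by (auto simp: rot_ob_def ext_def V_def)
  qed (use n in \<open>auto simp: rot_ob_def rot_mor_def ext_def V_def v_def\<close>)
  then have av: "angle V v" using F2[OF s] by blast
  have eq: "v 0 \<cdot> Zero C (X 0) Z = y \<cdot> f 0"
    using z zero_comp[OF zero_arr[OF arr_obD(1)[OF f(1)] ZO(1)] Y] n by (simp add: v_def V_def)
  have u: "Zero C (X 0) Z \<Colon> X 0 \<leadsto> V 0" "y \<Colon> X 1 \<leadsto> V 1"
    using y f(1) ZO arr_obD by (auto simp: V_def)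
  obtain \<phi> where \<phi>: "\<phi> 1 = y" "\<And>i. i < n + 2 \<Longrightarrow> \<phi> i \<Colon> X i \<leadsto> V i"
    "\<And>i. i < n + 1 \<Longrightarrow> \<phi> (Suc i) \<cdot> f i = v i \<cdot> \<phi> i"
    using F3_arr[OF a av u eq] by metis
  have "\<phi> 2 \<Colon> X 2 \<leadsto> Y" using \<phi>(2)[of 2] n by (simp add: V_def)
  moreover have "\<phi> 2 \<cdot> f 1 = y"
    using \<phi>(3)[of 1] \<phi>(1) n id_comp[OF y] by (simp add: v_def numeral_2_eq_2)
  ultimately show ?thesis by blast
qed

text \<open>An angle with all its rotations to the right. The window at \<open>r\<close> is the \<open>r\<close>-th rotation.\<close>

definition helix :: "(nat \<Rightarrow> 'o) \<Rightarrow> (nat \<Rightarrow> 'm) \<Rightarrow> bool" where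
  "helix E e \<longleftrightarrow> (\<forall>r. angle (\<lambda>i. E (r + i)) (\<lambda>i. e (r + i))) \<and>
     (\<forall>r. E (r + (n + 2)) = So (E r) \<and> e (r + (n + 2)) = susp (E r) (E (Suc r)) (e r))"

lemma helix_arr: "helix E e \<Longrightarrow> e r \<Colon> E r \<leadsto> E (Suc r)"
  using angle_arr(1)[of "\<lambda>i. E (r + i)" "\<lambda>i. e (r + i)" 0] by (simp add: helix_def)

lemma exact_helix_of_helix:
  assumes h: "helix E e" and n: "n \<ge> 1"
  shows "exact_helix C l (\<lambda>i. E (r + i)) (\<lambda>i. e (r + i))"
proof -
  have a: "angle (\<lambda>j. E (r + i + j)) (\<lambda>j. e (r + i + j))" for i using h by (simp add: helix_def)
  show ?thesis unfolding exact_helix_def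
    using helix_arr[OF h] angle_comp_zero[OF a n] angle_weak_kernel[OF a n] angle_weak_cokernel[OF a n]
    by (simp add: numeral_2_eq_2)
qed

text \<open>The entries with indices \<open>k (n + 2) + j\<close>, \<open>j < n + 2\<close>, are \<open>k\<close>-fold suspensions of those with index \<open>j\<close>.\<close>

lemma helix_of_angle:
  assumes a: "angle X f"
  obtains E e where "helix E e" "\<And>i. i < n + 2 \<Longrightarrow> E i = X i" "\<And>i. i < n + 2 \<Longrightarrow> e i = f i"
proof -
  define E where "E = (\<lambda>r. (So ^^ (r div (n + 2))) (X (r mod (n + 2))))"
  define c where "c = (\<lambda>j. rec_nat (f j) (\<lambda>k. susp (E (k * (n + 2) + j)) (E (Suc (k * (n + 2) + j)))))"
  define e where "e = (\<lambda>r. c (r mod (n + 2)) (r div (n + 2)))"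
  have E: "E (r + (n + 2)) = So (E r)" for r
    unfolding E_def by (simp add: div_add_self2 del: add_2_eq_Suc')
  have dm: "r div (n + 2) * (n + 2) + r mod (n + 2) = r" for r by (rule div_mult_mod_eq)
  have e: "e (r + (n + 2)) = susp (E r) (E (Suc r)) (e r)" for r
  proof -
    have "e (r + (n + 2)) = c (r mod (n + 2)) (Suc (r div (n + 2)))"
      unfolding e_def by (simp add: div_add_self2 del: add_2_eq_Suc')
    also have "\<dots> = susp (E r) (E (Suc r)) (e r)"
      unfolding e_def c_def by (simp only: nat.rec(2) dm)
    finally show ?thesis .
  qed
  have E0: "E i = X i" and e0: "e i = f i" if "i < n + 2" for i
    using that by (simp_all add: E_def e_def c_def)
  have "angle (\<lambda>i. E (r + i)) (\<lambda>i. e (r + i))" for r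
  proof (induction r)
    case 0
    show ?case by (rule angle_cong[OF a]) (use E0 e0 in auto)
  next
    case (Suc r)
    show ?case
    proof (rule angle_cong[OF rot_angle[OF Suc]])
      fix i assume "i < n + 2"
      then consider "i < n + 1" | "i = n + 1" by linarith
      then show "E (Suc r + i) = rot_ob So n (\<lambda>i. E (r + i)) i"
        "e (Suc r + i) = rot_mor C So Sm n (\<lambda>i. E (r + i)) (\<lambda>i. e (r + i)) i"
        by (cases; use E[of r] e[of r] in \<open>simp add: rot_simps(1,3) rot_simps(2,4)[unfolded Suc_eq_plus1[symmetric]]\<close>)+
    qed
  qed
  then have "helix E e" using E e unfolding helix_def by blast
  then show ?thesis using that E0 e0 by blast
qed

text \<open>Suspension is bijective, so an angle can be rotated backwards as well.\<close>

lemma helix_extend_left: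
  assumes h: "helix E e"
  obtains E' e' where "helix E' e'" "\<And>r. E' (Suc r) = E r" "\<And>r. e' (Suc r) = e r"
proof -
  note e = helix_arr[OF h]
  have per: "E (r + (n + 2)) = So (E r)" "e (r + (n + 2)) = susp (E r) (E (Suc r)) (e r)" for r
    using h by (auto simp: helix_def)
  obtain A where A: "A \<in> Ob C" "E (n + 1) = So A" using So_surj[OF arr_obD(1)[OF e]] by blast
  have "e (n + 1) \<Colon> So A \<leadsto> So (E 0)" using e[of "n + 1"] per(1)[of 0] A by simp
  then obtain a where a: "a \<Colon> A \<leadsto> E 0" "e (n + 1) = susp A (E 0) a"
    using susp_surj[OF A(1) arr_obD(1)[OF e]] by blast
  define E' where "E' = case_nat A E"
  define e' where "e' = case_nat a e"
  have S: "E' (Suc r) = E r" "e' (Suc r) = e r" for r by (simp_all add: E'_def e'_def)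
  have p: "E' (r + (n + 2)) = So (E' r)" "e' (r + (n + 2)) = susp (E' r) (E' (Suc r)) (e' r)" for r
    using per[of "r - 1"] A a by (cases r; simp add: E'_def e'_def)+
  have arr': "e' r \<Colon> E' r \<leadsto> E' (Suc r)" for r using e a by (cases r) (auto simp: E'_def e'_def)
  have seq: "is_seq C So n E' e'"
    by (rule is_seqI) (use arr' p(1)[of 0] arr'[of "n + 1"] in auto)
  have "angle (\<lambda>i. E (0 + i)) (\<lambda>i. e (0 + i))" using h unfolding helix_def by blast
  then have "angle (rot_ob So n E') (rot_mor C So Sm n E' e')"
  proof (rule angle_cong)
    fix i assume "i < n + 2"
    then consider "i < n + 1" | "i = n + 1" by linarith
    then show "rot_ob So n E' i = E (0 + i)" "rot_mor C So Sm n E' e' i = e (0 + i)"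
      by (cases; use p[of 0] S in \<open>simp add: rot_simps(1,3) rot_simps(2,4)[unfolded Suc_eq_plus1[symmetric]]\<close>)+
  qed
  then have "angle E' e'" using F2[OF seq] by blast
  then have "angle (\<lambda>i. E' (r + i)) (\<lambda>i. e' (r + i))" for r
    using h by (cases r) (auto simp: S helix_def)
  then have "helix E' e'" using p unfolding helix_def by blast
  then show ?thesis using that S by blast
qed

lemma helix_shift_left:
  assumes "helix E e"
  obtains E' e' where "helix E' e'" "\<And>r. E' (k + r) = E r" "\<And>r. e' (k + r) = e r"
proof -
  have "\<exists>E' e'. helix E' e' \<and> (\<forall>r. E' (k + r) = E r \<and> e' (k + r) = e r)"
  proof (induction k)
    case 0
    then show ?case using assms by auto
  next
    case (Suc k)
    then obtain E' e' where "helix E' e'" "\<forall>r. E' (k + r) = E r \<and> e' (k + r) = e r" by blast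
    then show ?case using helix_extend_left[of E' e'] by (metis add_Suc)
  qed
  then show ?thesis using that by blast
qed

end

section \<open>Splitting idempotents\<close>

definition splits_idem :: "('o, 'm) preadd \<Rightarrow> 'o \<Rightarrow> 'm \<Rightarrow> 'o \<Rightarrow> 'm \<Rightarrow> 'm \<Rightarrow> bool" where
  "splits_idem C X e Y r s \<longleftrightarrow>
     r \<Colon>\<^bsub>C\<^esub> X \<leadsto> Y \<and> s \<Colon>\<^bsub>C\<^esub> Y \<leadsto> X \<and> s \<cdot>\<^bsub>C\<^esub> r = e \<and> r \<cdot>\<^bsub>C\<^esub> s = Idm C Y"

definition idems_split :: "('o, 'm) preadd \<Rightarrow> 'o \<Rightarrow> bool" where
  "idems_split C X \<longleftrightarrow> (\<forall>e. e \<Colon>\<^bsub>C\<^esub> X \<leadsto> X \<longrightarrow> e \<cdot>\<^bsub>C\<^esub> e = e \<longrightarrow> (\<exists>Y r s. splits_idem C X e Y r s))"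

context preadditive_category
begin

lemma biproductD:
  assumes "is_biproduct C A B Z i1 i2 p1 p2"
  shows "i1 \<Colon> A \<leadsto> Z" "i2 \<Colon> B \<leadsto> Z" "p1 \<Colon> Z \<leadsto> A" "p2 \<Colon> Z \<leadsto> B"
    "p1 \<cdot> i1 = Idm C A" "p2 \<cdot> i2 = Idm C B" "p1 \<cdot> i2 = Zero C B A" "p2 \<cdot> i1 = Zero C A B"
    "Add C (i1 \<cdot> p1) (i2 \<cdot> p2) = Idm C Z"
  using assms by (auto simp: is_biproduct_def arr_def)

text \<open>Indeed \<open>r \<cdot> s' = r \<cdot> f \<cdot> g \<cdot> s'\<close>.\<close>

lemma split_comp_zero:
  assumes f: "splits_idem C X f A r s" and g: "splits_idem C X g B r' s'" and z: "f \<cdot> g = Zero C X X"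
  shows "r \<cdot> s' = Zero C B A"
proof -
  have a: "r \<Colon> X \<leadsto> A" "s \<Colon> A \<leadsto> X" "s \<cdot> r = f" "r \<cdot> s = Idm C A"
    "r' \<Colon> X \<leadsto> B" "s' \<Colon> B \<leadsto> X" "s' \<cdot> r' = g" "r' \<cdot> s' = Idm C B"
    using f g by (auto simp: splits_idem_def)
  have rf: "r \<cdot> f = r" using assoc[OF a(1,2,1)] a(3,4) id_comp[OF a(1)] by simp
  have gs: "g \<cdot> s' = s'" using assoc[OF a(6,5,6)] a(7,8) comp_id[OF a(6)] by simp
  have fX: "f \<Colon> X \<leadsto> X" and gX: "g \<Colon> X \<leadsto> X" using a by blast+
  have "r \<cdot> s' = (r \<cdot> f) \<cdot> (g \<cdot> s')" using rf gs by simp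
  also have "\<dots> = r \<cdot> ((f \<cdot> g) \<cdot> s')"
    using assoc[OF comp_arr[OF a(6) gX] fX a(1)] assoc[OF a(6) gX fX] by simp
  also have "\<dots> = Zero C B A"
    using z zero_comp[OF a(6)] comp_zero[OF a(1)] arr_obD a(1,6) by simp
  finally show ?thesis .
qed

end

context additive_category
begin

text \<open>The sum of two orthogonal split idempotents splits off the direct sum of their images.\<close>

lemma splits_idem_add:
  assumes f: "splits_idem C X f A r s" and g: "splits_idem C X g B r' s'"
    and fg: "f \<cdot> g = Zero C X X" and gf: "g \<cdot> f = Zero C X X"
  shows "\<exists>Y r s. splits_idem C X (Add C f g) Y r s"
proof -
  have a: "r \<Colon> X \<leadsto> A" "s \<Colon> A \<leadsto> X" "s \<cdot> r = f" "r \<cdot> s = Idm C A"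
    "r' \<Colon> X \<leadsto> B" "s' \<Colon> B \<leadsto> X" "s' \<cdot> r' = g" "r' \<cdot> s' = Idm C B"
    using f g by (auto simp: splits_idem_def)
  note rs' = split_comp_zero[OF f g fg] and r's = split_comp_zero[OF g f gf]
  obtain Z i1 i2 p1 p2 where Z: "is_biproduct C A B Z i1 i2 p1 p2"
    using biproducts[of A B] arr_obD a by blast
  note b = biproductD[OF Z]
  have ob: "X \<in> Ob C" "A \<in> Ob C" "B \<in> Ob C" "Z \<in> Ob C" using a b arr_obD by blast+
  let ?R = "Add C (i1 \<cdot> r) (i2 \<cdot> r')" and ?S = "Add C (s \<cdot> p1) (s' \<cdot> p2)"
  have t: "i1 \<cdot> r \<Colon> X \<leadsto> Z" "i2 \<cdot> r' \<Colon> X \<leadsto> Z" "s \<cdot> p1 \<Colon> Z \<leadsto> X" "s' \<cdot> p2 \<Colon> Z \<leadsto> X"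
    using a b by blast+
  have R: "?R \<Colon> X \<leadsto> Z" and S: "?S \<Colon> Z \<leadsto> X" using t by blast+
  have p1R: "p1 \<cdot> ?R = r"
    using comp_add[OF t(1,2) b(3)] assoc[OF a(1) b(1,3)] assoc[OF a(5) b(2,3)] b(5,7)
      id_comp[OF a(1)] zero_comp[OF a(5) ob(2)] add_zero(1)[OF a(1)] by simp
  have p2R: "p2 \<cdot> ?R = r'"
    using comp_add[OF t(1,2) b(4)] assoc[OF a(1) b(1,4)] assoc[OF a(5) b(2,4)] b(6,8)
      id_comp[OF a(5)] zero_comp[OF a(1) ob(3)] add_zero(2)[OF a(5)] by simp
  have "?S \<cdot> ?R = Add C f g"
    using add_comp[OF R t(3,4)] assoc[OF R b(3) a(2)] assoc[OF R b(4) a(6)] p1R p2R a by simp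
  moreover have "r \<cdot> ?S = p1"
    using comp_add[OF t(3,4) a(1)] assoc[OF b(3) a(2,1)] assoc[OF b(4) a(6,1)] a(4) rs'
      id_comp[OF b(3)] zero_comp[OF b(4) ob(2)] add_zero(1)[OF b(3)] by simp
  moreover have "r' \<cdot> ?S = p2"
    using comp_add[OF t(3,4) a(5)] assoc[OF b(3) a(2,5)] assoc[OF b(4) a(6,5)] a(8) r's
      id_comp[OF b(4)] zero_comp[OF b(3) ob(3)] add_zero(2)[OF b(4)] by simp
  then have "?R \<cdot> ?S = Idm C Z"
    using add_comp[OF S t(1,2)] assoc[OF S a(1) b(1)] assoc[OF S a(5) b(2)] b(9) \<open>r \<cdot> ?S = p1\<close> by simp
  ultimately show ?thesis using R S unfolding splits_idem_def by blast
qed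

text \<open>An idempotent \<open>e\<close> is a lower triangular matrix with idempotent diagonal entries \<open>\<alpha>\<close> and \<open>\<beta>\<close>. It is the sum of
  \<open>f = e i1 p1 e\<close> and \<open>g = e i2 p2 e\<close>, which are orthogonal and split through the images of \<open>\<alpha>\<close> and \<open>\<beta>\<close>.\<close>

lemma idems_split_triangular:
  assumes X: "is_biproduct C A B X i1 i2 p1 p2" and BA: "\<And>g. g \<Colon> B \<leadsto> A \<Longrightarrow> g = Zero C B A"
    and A: "idems_split C A" and B: "idems_split C B"
  shows "idems_split C X"
  unfolding idems_split_def
proof (intro allI impI)
  fix e assume e: "e \<Colon> X \<leadsto> X" and ee: "e \<cdot> e = e"
  note b = biproductD[OF X]
  have ob: "X \<in> Ob C" "A \<in> Ob C" "B \<in> Ob C" using b arr_obD by blast+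
  define \<alpha> \<beta> where "\<alpha> = p1 \<cdot> (e \<cdot> i1)" and "\<beta> = p2 \<cdot> (e \<cdot> i2)"
  have ei: "e \<cdot> i1 \<Colon> A \<leadsto> X" "e \<cdot> i2 \<Colon> B \<leadsto> X" and pe: "p1 \<cdot> e \<Colon> X \<leadsto> A" "p2 \<cdot> e \<Colon> X \<leadsto> B"
    and ip: "i1 \<cdot> p1 \<Colon> X \<leadsto> X" "i2 \<cdot> p2 \<Colon> X \<leadsto> X" using e b by blast+
  have ab: "\<alpha> \<Colon> A \<leadsto> A" "\<beta> \<Colon> B \<leadsto> B" unfolding \<alpha>_def \<beta>_def using ei b by blast+
  have z: "p1 \<cdot> (e \<cdot> i2) = Zero C B A" using BA ei b by blast
  have ip1: "Add C (i1 \<cdot> (p1 \<cdot> y)) (i2 \<cdot> (p2 \<cdot> y)) = y" if y: "y \<Colon> W \<leadsto> X" for y W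
    using add_comp[OF y ip] b(9) id_comp[OF y] assoc[OF y b(3,1)] assoc[OF y b(4,2)] by simp
  have ip2: "Add C ((y \<cdot> i1) \<cdot> p1) ((y \<cdot> i2) \<cdot> p2) = y" if y: "y \<Colon> X \<leadsto> W" for y W
    using comp_add[OF ip y] b(9) comp_id[OF y] assoc[OF b(3,1) y] assoc[OF b(4,2) y] by simp
  \<comment> \<open>Since \<open>e\<close> is lower triangular, its diagonal entries are compatible with \<open>p1\<close> and \<open>i2\<close>.\<close>
  have \<alpha>p: "\<alpha> \<cdot> p1 = p1 \<cdot> e"
    using ip2[OF pe(1)] assoc[OF b(1) e b(3)] assoc[OF b(2) e b(3)] z zero_comp[OF b(4) ob(2)]
      add_zero(1)[OF comp_arr[OF b(3) ab(1)]] by (simp add: \<alpha>_def)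
  have i\<beta>: "i2 \<cdot> \<beta> = e \<cdot> i2"
    using ip1[OF ei(2)] z comp_zero[OF b(1) ob(3)] add_zero(2)[OF comp_arr[OF ab(2) b(2)]] by (simp add: \<beta>_def)
  have "\<alpha> \<cdot> \<alpha> = (\<alpha> \<cdot> p1) \<cdot> (e \<cdot> i1)" using assoc[OF ei(1) b(3) ab(1)] by (simp add: \<alpha>_def)
  also have "\<dots> = p1 \<cdot> ((e \<cdot> e) \<cdot> i1)"
    using \<alpha>p assoc[OF ei(1) e b(3)] assoc[OF b(1) e e] by simp
  finally have \<alpha>\<alpha>: "\<alpha> \<cdot> \<alpha> = \<alpha>" using ee by (simp add: \<alpha>_def)
  have "\<beta> \<cdot> \<beta> = (p2 \<cdot> e) \<cdot> (i2 \<cdot> \<beta>)" using assoc[OF ab(2) b(2) pe(2)] assoc[OF b(2) e b(4)] by (simp add: \<beta>_def)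
  also have "\<dots> = p2 \<cdot> ((e \<cdot> e) \<cdot> i2)"
    using i\<beta> assoc[OF ei(2) e b(4)] assoc[OF b(2) e e] by simp
  finally have \<beta>\<beta>: "\<beta> \<cdot> \<beta> = \<beta>" using ee by (simp add: \<beta>_def)
  obtain A' r s where a: "r \<Colon> A \<leadsto> A'" "s \<Colon> A' \<leadsto> A" "s \<cdot> r = \<alpha>" "r \<cdot> s = Idm C A'"
    using A ab(1) \<alpha>\<alpha> unfolding idems_split_def splits_idem_def by blast
  obtain B' r' s' where b': "r' \<Colon> B \<leadsto> B'" "s' \<Colon> B' \<leadsto> B" "s' \<cdot> r' = \<beta>" "r' \<cdot> s' = Idm C B'"
    using B ab(2) \<beta>\<beta> unfolding idems_split_def splits_idem_def by blast
  define f g where "f = (e \<cdot> i1) \<cdot> (p1 \<cdot> e)" and "g = (e \<cdot> i2) \<cdot> (p2 \<cdot> e)"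
  have fg: "f \<Colon> X \<leadsto> X" "g \<Colon> X \<leadsto> X" unfolding f_def g_def using ei pe by blast+
  have "Add C f g = e \<cdot> Add C (i1 \<cdot> (p1 \<cdot> e)) (i2 \<cdot> (p2 \<cdot> e))"
    unfolding f_def g_def using comp_add[OF comp_arr[OF pe(1) b(1)] comp_arr[OF pe(2) b(2)] e]
      assoc[OF pe(1) b(1) e] assoc[OF pe(2) b(2) e] by simp
  then have sum: "Add C f g = e" using ip1[OF e] ee by simp
  have rs\<alpha>: "r \<cdot> (\<alpha> \<cdot> s) = Idm C A'"
    using assoc[OF a(2,1,2)] a(3,4) comp_id[OF a(2)] by simp
  have rs\<beta>: "r' \<cdot> (\<beta> \<cdot> s') = Idm C B'"
    using assoc[OF b'(2,1,2)] b'(3,4) comp_id[OF b'(2)] by simp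
  have f: "splits_idem C X f A' (r \<cdot> (p1 \<cdot> e)) ((e \<cdot> i1) \<cdot> s)"
    unfolding splits_idem_def
  proof (intro conjI)
    have "((e \<cdot> i1) \<cdot> s) \<cdot> (r \<cdot> (p1 \<cdot> e)) = (e \<cdot> i1) \<cdot> (\<alpha> \<cdot> (p1 \<cdot> e))"
      using assoc[OF comp_arr[OF pe(1) a(1)] a(2) ei(1)] assoc[OF pe(1) a(1,2)] a(3) by simp
    also have "\<dots> = (e \<cdot> i1) \<cdot> (p1 \<cdot> (e \<cdot> e))"
      using assoc[OF e b(3) ab(1)] \<alpha>p assoc[OF e e b(3)] by simp
    finally show "((e \<cdot> i1) \<cdot> s) \<cdot> (r \<cdot> (p1 \<cdot> e)) = f" using ee by (simp add: f_def)
    have "(p1 \<cdot> e) \<cdot> ((e \<cdot> i1) \<cdot> s) = (p1 \<cdot> ((e \<cdot> e) \<cdot> i1)) \<cdot> s"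
      using assoc[OF a(2) ei(1) pe(1)] assoc[OF ei(1) e b(3)] assoc[OF b(1) e e] by simp
    then show "(r \<cdot> (p1 \<cdot> e)) \<cdot> ((e \<cdot> i1) \<cdot> s) = Idm C A'"
      using assoc[OF comp_arr[OF a(2) ei(1)] pe(1) a(1)] ee rs\<alpha> by (simp add: \<alpha>_def)
  qed (use a ei pe in blast)+
  have g: "splits_idem C X g B' (r' \<cdot> (p2 \<cdot> e)) (i2 \<cdot> s')"
    unfolding splits_idem_def
  proof (intro conjI)
    have "(i2 \<cdot> s') \<cdot> (r' \<cdot> (p2 \<cdot> e)) = (i2 \<cdot> \<beta>) \<cdot> (p2 \<cdot> e)"
      using assoc[OF comp_arr[OF pe(2) b'(1)] b'(2) b(2)] assoc[OF pe(2) b'(1,2)] b'(3)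
        assoc[OF pe(2) ab(2) b(2)] by simp
    then show "(i2 \<cdot> s') \<cdot> (r' \<cdot> (p2 \<cdot> e)) = g" using i\<beta> by (simp add: g_def)
    have "(p2 \<cdot> e) \<cdot> (i2 \<cdot> s') = \<beta> \<cdot> s'"
      using assoc[OF b'(2) b(2) pe(2)] assoc[OF b(2) e b(4)] by (simp add: \<beta>_def)
    then show "(r' \<cdot> (p2 \<cdot> e)) \<cdot> (i2 \<cdot> s') = Idm C B'"
      using assoc[OF comp_arr[OF b'(2) b(2)] pe(2) b'(1)] rs\<beta> by simp
  qed (use b' b pe in blast)+
  have "(p1 \<cdot> e) \<cdot> (e \<cdot> i2) = Zero C B A"
    using assoc[OF ei(2) e b(3)] assoc[OF b(2) e e] ee z by simp
  then have "(p1 \<cdot> e) \<cdot> g = Zero C X A"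
    unfolding g_def using assoc[OF pe(2) ei(2) pe(1)] zero_comp[OF pe(2) ob(2)] by simp
  then have fg0: "f \<cdot> g = Zero C X X"
    using assoc[OF fg(2) pe(1) ei(1)] comp_zero[OF ei(1) ob(1)] unfolding f_def by simp
  have "f \<cdot> e = f"
    unfolding f_def using assoc[OF e pe(1) ei(1)] assoc[OF e e b(3)] ee by simp
  then have ff: "f \<cdot> f = f"
    using sum comp_add[OF fg fg(1)] fg0 add_zero(1)[OF comp_arr[OF fg(1,1)]] by simp
  have "e \<cdot> f = f"
    unfolding f_def using assoc[OF pe(1) ei(1) e] assoc[OF b(1) e e] ee by simp
  then have "Add C f (g \<cdot> f) = Add C f (Zero C X X)"
    using sum add_comp[OF fg(1) fg] ff add_zero(1)[OF fg(1)] by simp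
  then have gf0: "g \<cdot> f = Zero C X X"
    using add_left_cancel[OF fg(1) comp_arr[OF fg(1,2)]] ob by blast
  show "\<exists>Y r s. splits_idem C X e Y r s" using splits_idem_add[OF f g fg0 gf0] sum by simp
qed

end

section \<open>Sums of morphisms\<close>

context preadditive_category
begin

lemma finprod_arr:
  assumes "X \<in> Ob C" "Y \<in> Ob C" "\<And>k. k \<in> I \<Longrightarrow> f k \<Colon> X \<leadsto> Y"
  shows "finprod (hom_group C X Y) f I \<Colon> X \<leadsto> Y"
proof -
  interpret G: comm_group "hom_group C X Y" using assms by (auto intro: hom_comm_group)
  have "finprod (hom_group C X Y) f I \<in> carrier (hom_group C X Y)"
    by (rule G.finprod_closed) (use assms in \<open>auto simp: arr_def hom_group_def\<close>)
  then show ?thesis using assms by (simp add: arr_def hom_group_def)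
qed

lemma finprod_insert_arr:
  assumes "finite I" "k \<notin> I" "\<And>l. l \<in> insert k I \<Longrightarrow> f l \<Colon> X \<leadsto> Y"
  shows "finprod (hom_group C X Y) f (insert k I) = Add C (f k) (finprod (hom_group C X Y) f I)"
proof -
  have ob: "X \<in> Ob C" "Y \<in> Ob C" using assms(3)[of k] arr_obD by auto
  interpret G: comm_group "hom_group C X Y" using ob by (auto intro: hom_comm_group)
  show ?thesis using G.finprod_insert[of I k f] assms by (auto simp: arr_def hom_group_def Pi_iff)
qed

lemma finprod_empty_arr:
  assumes "X \<in> Ob C" "Y \<in> Ob C"
  shows "finprod (hom_group C X Y) f {} = Zero C X Y"
proof -
  interpret G: comm_group "hom_group C X Y" using assms by (auto intro: hom_comm_group)
  show ?thesis using G.finprod_empty[of f] by (simp add: hom_group_def)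
qed

lemma finprod_comp:
  assumes "finite I" "\<And>k. k \<in> I \<Longrightarrow> f k \<Colon> Y \<leadsto> Z" "g \<Colon> X \<leadsto> Y" "Z \<in> Ob C"
  shows "finprod (hom_group C Y Z) f I \<cdot> g = finprod (hom_group C X Z) (\<lambda>k. f k \<cdot> g) I"
  using assms(1,2)
proof (induction I rule: finite_induct)
  case empty
  then show ?case using zero_comp[OF assms(3,4)] arr_obD[OF assms(3)] assms(4) by (simp add: finprod_empty_arr)
next
  case (insert k I)
  have Y: "Y \<in> Ob C" using assms(3) arr_obD by blast
  have "finprod (hom_group C Y Z) f (insert k I) \<cdot> g = Add C (f k \<cdot> g) (finprod (hom_group C Y Z) f I \<cdot> g)"
    using finprod_insert_arr[of I k f Y Z] insert
      add_comp[OF assms(3) _ finprod_arr[OF Y assms(4), of I f], of "f k"] by simp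
  also have "\<dots> = finprod (hom_group C X Z) (\<lambda>k. f k \<cdot> g) (insert k I)"
    using insert finprod_insert_arr[of I k "\<lambda>k. f k \<cdot> g" X Z] comp_arr[OF assms(3)] by simp
  finally show ?case .
qed

lemma finprod_zero:
  assumes "X \<in> Ob C" "Y \<in> Ob C" "\<And>k. k \<in> I \<Longrightarrow> f k = Zero C X Y"
  shows "finprod (hom_group C X Y) f I = Zero C X Y"
proof -
  interpret G: comm_group "hom_group C X Y" using assms by (auto intro: hom_comm_group)
  show ?thesis using G.finprod_one_eqI[of I f] assms by (simp add: hom_group_def)
qed

lemma direct_sumD:
  assumes "is_direct_sum C I X Z j p"
  shows "finite I" "Z \<in> Ob C" "k \<in> I \<Longrightarrow> X k \<in> Ob C" "k \<in> I \<Longrightarrow> j k \<Colon> X k \<leadsto> Z" "k \<in> I \<Longrightarrow> p k \<Colon> Z \<leadsto> X k"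
    "k \<in> I \<Longrightarrow> l \<in> I \<Longrightarrow> p k \<cdot> j l = (if k = l then Idm C (X k) else Zero C (X l) (X k))"
    "finprod (hom_group C Z Z) (\<lambda>k. j k \<cdot> p k) I = Idm C Z"
    "k \<in> I \<Longrightarrow> j k \<cdot> p k \<Colon> Z \<leadsto> Z"
  using assms comp_arr unfolding is_direct_sum_def arr_def by (blast | simp)+

text \<open>Each term of the partial sum factors through one of the projections \<open>p k\<close>.\<close>

lemma partial_sum_comp_zero:
  assumes ds: "is_direct_sum C I X Z j p" and J: "J \<subseteq> I" and g: "g \<Colon> W \<leadsto> Z"
    and z: "\<And>k. k \<in> J \<Longrightarrow> p k \<cdot> g = Zero C W (X k)"
  shows "finprod (hom_group C Z Z) (\<lambda>k. j k \<cdot> p k) J \<cdot> g = Zero C W Z"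
proof -
  note d = direct_sumD[OF ds]
  have fin: "finite J" using d(1) J finite_subset by blast
  have W: "W \<in> Ob C" using g arr_obD by blast
  have "(j k \<cdot> p k) \<cdot> g = Zero C W Z" if "k \<in> J" for k
    using assoc[OF g d(5,4)] z[OF that] comp_zero[OF d(4) W] that J by auto
  then show ?thesis
    using finprod_comp[OF fin _ g d(2), of "\<lambda>k. j k \<cdot> p k"] d(8) J
      finprod_zero[OF W d(2), of J "\<lambda>k. (j k \<cdot> p k) \<cdot> g"] by auto
qed

lemma direct_sum_opp: "is_direct_sum C I X Z j p \<Longrightarrow> is_direct_sum (opp C) I X Z p j"
  unfolding is_direct_sum_def by auto

lemma comp_partial_sum_zero:
  assumes ds: "is_direct_sum C I X Z j p" and J: "J \<subseteq> I" and g: "g \<Colon> Z \<leadsto> W"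
    and z: "\<And>k. k \<in> J \<Longrightarrow> g \<cdot> j k = Zero C (X k) W"
  shows "g \<cdot> finprod (hom_group C Z Z) (\<lambda>k. j k \<cdot> p k) J = Zero C Z W"
  using preadditive_category.partial_sum_comp_zero[OF preadditive_opp direct_sum_opp[OF ds] J, of g W] g z
  by simp

end

text \<open>A subfamily of a direct sum decomposition has a direct sum of its own, the image of the corresponding idempotent.\<close>

lemma (in additive_category) partial_sum_splits:
  assumes ds: "is_direct_sum C I X Z j p" and J: "J \<subseteq> I"
  shows "\<exists>A r s. splits_idem C Z (finprod (hom_group C Z Z) (\<lambda>k. j k \<cdot> p k) J) A r s"
proof -
  note d = direct_sumD[OF ds]
  have "finite J" using d(1) J finite_subset by blast
  then show ?thesis using J
  proof (induction J rule: finite_induct)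
    case empty
    obtain A where A: "is_zero C A" using zero_object by blast
    then have AO: "A \<in> Ob C" and i: "Idm C A = Zero C A A" using Id_in_Hom[of A] by (auto simp: is_zero_def)
    have z: "Zero C Z A \<Colon> Z \<leadsto> A" "Zero C A Z \<Colon> A \<leadsto> Z" using AO d(2) by auto
    have "splits_idem C Z (Zero C Z Z) A (Zero C Z A) (Zero C A Z)"
      using z zero_comp[OF z(1) d(2)] zero_comp[OF z(2) AO] i by (simp add: splits_idem_def)
    then show ?case unfolding finprod_empty_arr[OF d(2,2)] by blast
  next
    case (insert k J)
    let ?f = "finprod (hom_group C Z Z) (\<lambda>k. j k \<cdot> p k) J"
    obtain A r s where A: "splits_idem C Z ?f A r s" using insert by blast
    have k: "splits_idem C Z (j k \<cdot> p k) (X k) (p k) (j k)"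
      using d(4-6) insert.prems by (simp add: splits_idem_def)
    have f: "?f \<Colon> Z \<leadsto> Z" by (rule finprod_arr[OF d(2,2)]) (use d(8) insert.prems in auto)
    have pj: "p l \<cdot> j k = Zero C (X k) (X l)" "p k \<cdot> j l = Zero C (X l) (X k)" if "l \<in> J" for l
      using d(6)[of l k] d(6)[of k l] that insert.prems insert.hyps by auto
    have "?f \<cdot> j k = Zero C (X k) Z"
      using partial_sum_comp_zero[OF ds _ d(4) pj(1)] insert.prems by blast
    then have "?f \<cdot> (j k \<cdot> p k) = Zero C Z Z"
      using assoc[OF d(5)[of k] d(4)[of k] f] zero_comp[OF d(5)[of k] d(2)] insert.prems by simp
    moreover have "p k \<cdot> ?f = Zero C Z (X k)"
      using comp_partial_sum_zero[OF ds _ d(5) pj(2)] insert.prems by blast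
    then have "(j k \<cdot> p k) \<cdot> ?f = Zero C Z Z"
      using assoc[OF f d(5)[of k] d(4)[of k]] comp_zero[OF d(4)[of k] d(2)] insert.prems by simp
    ultimately have "\<exists>Y r s. splits_idem C Z (Add C (j k \<cdot> p k) ?f) Y r s"
      using splits_idem_add[OF k A] by blast
    moreover have "finprod (hom_group C Z Z) (\<lambda>k. j k \<cdot> p k) (insert k J) = Add C (j k \<cdot> p k) ?f"
      by (rule finprod_insert_arr[OF insert.hyps]) (use d(8) insert.prems in auto)
    ultimately show ?case by simp
  qed
qed

section \<open>Levels\<close>

locale leveled_category = additive_category C
  for C :: "('o, 'm) preadd" (structure) +
  fixes \<aa> :: "int \<Rightarrow> 'o set"
  assumes level_Ob: "\<aa> p \<subseteq> Ob C"
    and level_hom: "\<lbrakk>q < p; X \<in> \<aa> p; Y \<in> \<aa> q; f \<Colon> X \<leadsto> Y\<rbrakk> \<Longrightarrow> f = Zero C X Y"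
    and level_decomposition: "t \<in> Ob C \<Longrightarrow>
       \<exists>s i a j p. (\<forall>k\<in>{i..s}. a k \<in> \<aa> k) \<and> is_direct_sum C {i..s} a t j p"
begin

text \<open>Bounds on levels are expressed by vanishing of morphisms. This does not refer to a decomposition, so it is
  visibly invariant under retracts, direct sums and suspensions.\<close>

definition ge :: "int \<Rightarrow> 'o set" where
  "ge p = {X \<in> Ob C. \<forall>q<p. \<forall>Q\<in>\<aa> q. \<forall>f. f \<Colon> X \<leadsto> Q \<longrightarrow> f = Zero C X Q}"

definition le :: "int \<Rightarrow> 'o set" where
  "le p = {X \<in> Ob C. \<forall>q>p. \<forall>Q\<in>\<aa> q. \<forall>f. f \<Colon> Q \<leadsto> X \<longrightarrow> f = Zero C Q X}"

lemma ge_Ob: "ge p \<subseteq> Ob C" and le_Ob: "le p \<subseteq> Ob C"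
  by (auto simp: ge_def le_def)

lemma geD: "\<lbrakk>X \<in> ge p; q < p; Q \<in> \<aa> q; f \<Colon> X \<leadsto> Q\<rbrakk> \<Longrightarrow> f = Zero C X Q"
  and leD: "\<lbrakk>X \<in> le p; p < q; Q \<in> \<aa> q; f \<Colon> Q \<leadsto> X\<rbrakk> \<Longrightarrow> f = Zero C Q X"
  by (auto simp: ge_def le_def)

lemma ge_mono: "p \<le> q \<Longrightarrow> ge q \<subseteq> ge p" and le_mono: "p \<le> q \<Longrightarrow> le p \<subseteq> le q"
  by (simp_all add: ge_def le_def subset_iff) (meson less_le_trans le_less_trans)+

lemma level_sum_le:
  assumes ds: "is_direct_sum C I a t j p" and a: "\<And>k. k \<in> I \<Longrightarrow> a k \<in> \<aa> k"
    and J: "J \<subseteq> {k \<in> I. k \<le> l}" and A: "splits_idem C t (finprod (hom_group C t t) (\<lambda>k. j k \<cdot> p k) J) A r s"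
  shows "A \<in> le l"
proof -
  note d = direct_sumD[OF ds]
  have A': "r \<Colon> t \<leadsto> A" "s \<Colon> A \<leadsto> t" "s \<cdot> r = finprod (hom_group C t t) (\<lambda>k. j k \<cdot> p k) J" "r \<cdot> s = Idm C A"
    using A by (auto simp: splits_idem_def)
  have "f = Zero C Q A" if "l < q" "Q \<in> \<aa> q" and f: "f \<Colon> Q \<leadsto> A" for q Q f
  proof -
    have sf: "s \<cdot> f \<Colon> Q \<leadsto> t" using f A' by blast
    have "p k \<cdot> (s \<cdot> f) = Zero C Q (a k)" if "k \<in> J" for k
    proof (rule level_hom)
      show "k < q" "a k \<in> \<aa> k" using J that a \<open>l < q\<close> by auto
      show "p k \<cdot> (s \<cdot> f) \<Colon> Q \<leadsto> a k" using comp_arr[OF sf d(5)] J that by auto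
    qed (fact \<open>Q \<in> \<aa> q\<close>)
    then have "(s \<cdot> r) \<cdot> (s \<cdot> f) = Zero C Q t"
      using partial_sum_comp_zero[OF ds _ sf, of J] J A'(3) by auto
    moreover have "r \<cdot> ((s \<cdot> r) \<cdot> (s \<cdot> f)) = f"
      using assoc[OF sf A'(1,2)] assoc[OF f A'(2,1)] A'(4) id_comp[OF f] by simp
    ultimately show ?thesis using comp_zero[OF A'(1)] arr_obD(1)[OF f] by simp
  qed
  then show ?thesis using arr_obD(2)[OF A'(1)] by (auto simp: le_def)
qed

lemma level_sum_ge:
  assumes ds: "is_direct_sum C I a t j p" and a: "\<And>k. k \<in> I \<Longrightarrow> a k \<in> \<aa> k"
    and J: "J \<subseteq> {k \<in> I. l \<le> k}" and A: "splits_idem C t (finprod (hom_group C t t) (\<lambda>k. j k \<cdot> p k) J) A r s"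
  shows "A \<in> ge l"
proof -
  note d = direct_sumD[OF ds]
  have A': "r \<Colon> t \<leadsto> A" "s \<Colon> A \<leadsto> t" "s \<cdot> r = finprod (hom_group C t t) (\<lambda>k. j k \<cdot> p k) J" "r \<cdot> s = Idm C A"
    using A by (auto simp: splits_idem_def)
  have "f = Zero C A Q" if "q < l" "Q \<in> \<aa> q" and f: "f \<Colon> A \<leadsto> Q" for q Q f
  proof -
    have fr: "f \<cdot> r \<Colon> t \<leadsto> Q" using f A' by blast
    have "(f \<cdot> r) \<cdot> j k = Zero C (a k) Q" if "k \<in> J" for k
    proof (rule level_hom)
      show "q < k" "a k \<in> \<aa> k" using J that a \<open>q < l\<close> by auto
      show "(f \<cdot> r) \<cdot> j k \<Colon> a k \<leadsto> Q" using comp_arr[OF d(4) fr] J that by auto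
    qed (fact \<open>Q \<in> \<aa> q\<close>)
    then have "(f \<cdot> r) \<cdot> (s \<cdot> r) = Zero C t Q"
      using comp_partial_sum_zero[OF ds _ fr, of J] J A'(3) by auto
    moreover have "((f \<cdot> r) \<cdot> (s \<cdot> r)) \<cdot> s = f"
      using assoc[OF A'(2) comp_arr[OF A'(1,2)] fr] assoc[OF A'(2,1,2)] assoc[OF A'(2,1) f] A'(4)
        comp_id[OF A'(2)] comp_id[OF f] by simp
    ultimately show ?thesis using zero_comp[OF A'(2)] arr_obD(2)[OF f] by simp
  qed
  then show ?thesis using arr_obD(2)[OF A'(1)] by (auto simp: ge_def)
qed

text \<open>Decompose \<open>Y\<close>: the components of \<open>f\<close> of levels at most \<open>l\<close> vanish because of \<open>X\<close>, and the summands of higher levels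
  map trivially to \<open>Y\<close>.\<close>

lemma hom_ge_le:
  assumes X: "X \<in> ge (l + 1)" and Y: "Y \<in> le l" and f: "f \<Colon> X \<leadsto> Y"
  shows "f = Zero C X Y"
proof -
  obtain I a j p where a: "\<And>k. k \<in> I \<Longrightarrow> a k \<in> \<aa> k" and ds: "is_direct_sum C (I :: int set) a Y j p"
    using level_decomposition[OF arr_obD(2)[OF f]] by blast
  note d = direct_sumD[OF ds]
  have ob: "X \<in> Ob C" "Y \<in> Ob C" using f arr_obD by auto
  have "(j k \<cdot> p k) \<cdot> f = Zero C X Y" if k: "k \<in> I" for k
  proof (cases "k \<le> l")
    case True
    have "p k \<cdot> f \<Colon> X \<leadsto> a k" using comp_arr[OF f d(5)[OF k]] .
    then have "p k \<cdot> f = Zero C X (a k)" using X True a[OF k] by (auto simp: ge_def)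
    then show ?thesis using assoc[OF f d(5,4)[OF k]] comp_zero[OF d(4)[OF k] ob(1)] by simp
  next
    case False
    then have "l < k" by simp
    then have "j k = Zero C (a k) Y" using Y d(4)[OF k] a[OF k] by (auto simp: le_def)
    then show ?thesis
      using zero_comp[OF d(5)[OF k] ob(2)] zero_comp[OF f ob(2)] by simp
  qed
  then have "finprod (hom_group C Y Y) (\<lambda>k. j k \<cdot> p k) I \<cdot> f = Zero C X Y"
    using finprod_comp[OF d(1) d(8) f ob(2)] finprod_zero[OF ob, of I "\<lambda>k. (j k \<cdot> p k) \<cdot> f"] by simp
  then show ?thesis using d(7) id_comp[OF f] by simp
qed

text \<open>Group the summands of a decomposition into levels at most \<open>l\<close> and above \<open>l\<close>.\<close>

lemma level_splitting:
  assumes "t \<in> Ob C"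
  obtains A B i1 i2 p1 p2 where "A \<in> le l" "B \<in> ge (l + 1)" "is_biproduct C A B t i1 i2 p1 p2"
proof -
  obtain I a j p where a: "\<And>k. k \<in> I \<Longrightarrow> a k \<in> \<aa> k" and ds: "is_direct_sum C (I :: int set) a t j p"
    using level_decomposition[OF assms] by blast
  note d = direct_sumD[OF ds]
  let ?J = "{k \<in> I. k \<le> l}" and ?J' = "{k \<in> I. l + 1 \<le> k}"
  let ?s = "\<lambda>J. finprod (hom_group C t t) (\<lambda>k. j k \<cdot> p k) J"
  obtain A r s where A: "splits_idem C t (?s ?J) A r s" using partial_sum_splits[OF ds, of ?J] by auto
  obtain B r' s' where B: "splits_idem C t (?s ?J') B r' s'" using partial_sum_splits[OF ds, of ?J'] by auto
  have le: "A \<in> le l" using level_sum_le[OF ds a _ A] by blast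
  have ge: "B \<in> ge (l + 1)" using level_sum_ge[OF ds a _ B] by blast
  have A': "r \<Colon> t \<leadsto> A" "s \<Colon> A \<leadsto> t" "s \<cdot> r = ?s ?J" "r \<cdot> s = Idm C A"
    and B': "r' \<Colon> t \<leadsto> B" "s' \<Colon> B \<leadsto> t" "s' \<cdot> r' = ?s ?J'" "r' \<cdot> s' = Idm C B"
    using A B by (auto simp: splits_idem_def)
  have ob: "A \<in> Ob C" "B \<in> Ob C" using A' B' arr_obD by auto
  interpret G: comm_group "hom_group C t t" using assms by (auto intro: hom_comm_group)
  have "?s (?J \<union> ?J') = ?s ?J \<otimes>\<^bsub>hom_group C t t\<^esub> ?s ?J'"
    by (rule G.finprod_Un_disjoint) (use d(1,8) in \<open>auto simp: hom_group_def arr_def\<close>)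
  moreover have "?J \<union> ?J' = I" by auto
  ultimately have sum: "Add C (s \<cdot> r) (s' \<cdot> r') = Idm C t"
    using d(7) A'(3) B'(3) by (simp add: hom_group_def)
  have rs': "r \<cdot> s' = Zero C B A" using hom_ge_le[OF ge le] comp_arr[OF B'(2) A'(1)] by blast
  have sr: "s \<cdot> r \<Colon> t \<leadsto> t" "s' \<cdot> r' \<Colon> t \<leadsto> t" using A' B' by blast+
  have "Add C s (s' \<cdot> (r' \<cdot> s)) = Add C s (Zero C A t)"
    using add_comp[OF A'(2) sr] sum assoc[OF A'(2,1,2)] A'(4) comp_id[OF A'(2)] id_comp[OF A'(2)]
      assoc[OF A'(2) B'(1,2)] add_zero(1)[OF A'(2)] by simp
  moreover have r's: "r' \<cdot> s \<Colon> A \<leadsto> B" using A' B' by blast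
  ultimately have "s' \<cdot> (r' \<cdot> s) = Zero C A t"
    using add_left_cancel[OF A'(2) comp_arr[OF r's B'(2)]] ob(1) assms by blast
  then have "(r' \<cdot> s') \<cdot> (r' \<cdot> s) = Zero C A B"
    using assoc[OF r's B'(2,1)] comp_zero[OF B'(1) ob(1)] by simp
  then have "r' \<cdot> s = Zero C A B" using B'(4) id_comp[OF r's] by simp
  then have "is_biproduct C A B t s s' r r'"
    using A' B' rs' sum by (simp add: is_biproduct_def arr_def)
  then show ?thesis using that le ge by blast
qed

lemma retract_le:
  assumes "X \<in> le l" "r \<Colon> X \<leadsto> A" "s \<Colon> A \<leadsto> X" "r \<cdot> s = Idm C A"
  shows "A \<in> le l"
proof -
  have "f = Zero C Q A" if "l < q" "Q \<in> \<aa> q" "f \<Colon> Q \<leadsto> A" for q Q f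
  proof -
    have "s \<cdot> f = Zero C Q X" using assms(1) that comp_arr[OF that(3) assms(3)] by (auto simp: le_def)
    then show ?thesis
      using assoc[OF that(3) assms(3,2)] assms(4) id_comp[OF that(3)] comp_zero[OF assms(2)] arr_obD(1)[OF that(3)]
      by simp
  qed
  then show ?thesis using arr_obD(2)[OF assms(2)] by (auto simp: le_def)
qed

lemma retract_ge:
  assumes "X \<in> ge l" "r \<Colon> X \<leadsto> A" "s \<Colon> A \<leadsto> X" "r \<cdot> s = Idm C A"
  shows "A \<in> ge l"
proof -
  have "f = Zero C A Q" if "q < l" "Q \<in> \<aa> q" "f \<Colon> A \<leadsto> Q" for q Q f
  proof -
    have "f \<cdot> r = Zero C X Q" using assms(1) that comp_arr[OF assms(2) that(3)] by (auto simp: ge_def)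
    then show ?thesis
      using assoc[OF assms(3,2) that(3)] assms(4) comp_id[OF that(3)] zero_comp[OF assms(3)] arr_obD(2)[OF that(3)]
      by simp
  qed
  then show ?thesis using arr_obD(2)[OF assms(2)] by (auto simp: ge_def)
qed

lemma biproduct_le:
  assumes Z: "is_biproduct C A B Z i1 i2 p1 p2" and AB: "A \<in> le l" "B \<in> le l"
  shows "Z \<in> le l"
proof -
  note b = biproductD[OF Z]
  have "f = Zero C Q Z" if "l < q" "Q \<in> \<aa> q" and f: "f \<Colon> Q \<leadsto> Z" for q Q f
  proof -
    have "p1 \<cdot> f = Zero C Q A" "p2 \<cdot> f = Zero C Q B"
      using AB that comp_arr[OF f b(3)] comp_arr[OF f b(4)] by (auto simp: le_def)
    then have "Add C (i1 \<cdot> (p1 \<cdot> f)) (i2 \<cdot> (p2 \<cdot> f)) = Zero C Q Z"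
      using comp_zero[OF b(1)] comp_zero[OF b(2)] arr_obD[OF f] add_zero(1)[of "Zero C Q Z" Q Z] by auto
    then show ?thesis
      using add_comp[OF f comp_arr[OF b(3,1)] comp_arr[OF b(4,2)]] b(9) id_comp[OF f]
        assoc[OF f b(3,1)] assoc[OF f b(4,2)] by simp
  qed
  then show ?thesis using arr_obD(2)[OF b(1)] by (auto simp: le_def)
qed

lemma biproduct_ge:
  assumes Z: "is_biproduct C A B Z i1 i2 p1 p2" and AB: "A \<in> ge l" "B \<in> ge l"
  shows "Z \<in> ge l"
proof -
  note b = biproductD[OF Z]
  have "f = Zero C Z Q" if "q < l" "Q \<in> \<aa> q" and f: "f \<Colon> Z \<leadsto> Q" for q Q f
  proof -
    have "f \<cdot> i1 = Zero C A Q" "f \<cdot> i2 = Zero C B Q"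
      using AB that comp_arr[OF b(1) f] comp_arr[OF b(2) f] by (auto simp: ge_def)
    then have "Add C ((f \<cdot> i1) \<cdot> p1) ((f \<cdot> i2) \<cdot> p2) = Zero C Z Q"
      using zero_comp[OF b(3)] zero_comp[OF b(4)] arr_obD[OF f] add_zero(1)[of "Zero C Z Q" Z Q] by auto
    then show ?thesis
      using comp_add[OF comp_arr[OF b(3,1)] comp_arr[OF b(4,2)] f] b(9) comp_id[OF f]
        assoc[OF b(3,1) f] assoc[OF b(4,2) f] by simp
  qed
  then show ?thesis using arr_obD(2)[OF b(1)] by (auto simp: ge_def)
qed

lemma zero_in_levels:
  assumes "is_zero C Z"
  shows "Z \<in> ge l" "Z \<in> le l"
  using assms level_Ob by (fastforce simp: is_zero_def ge_def le_def arr_def)+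

text \<open>A decomposition of an object that satisfies both bounds has zero summands outside the levels \<open>i, \<dots>, j\<close>; dropping
  them leaves a direct sum of objects of the allowed levels.\<close>

lemma trunc_eq: "trunc C \<aa> i j = ge i \<inter> le j"
proof (intro equalityI subsetI)
  fix A assume "A \<in> trunc C \<aa> i j"
  then obtain r :: nat and X W h p B i1 i2 p1 p2
    where X: "\<forall>k<r. X k \<in> (\<Union>p\<in>{i..j}. \<aa> p)" and W: "is_direct_sum C {..<r} X W h p"
      and A: "is_biproduct C A B W i1 i2 p1 p2"
    unfolding trunc_def add_closure_def by blast
  note d = direct_sumD[OF W]
  have "f = Zero C Q W" if q: "j < q" "Q \<in> \<aa> q" and f: "f \<Colon> Q \<leadsto> W" for q Q f
  proof -
    have "p k \<cdot> f = Zero C Q (X k)" if kr: "k \<in> {..<r}" for k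
    proof -
      obtain l where "l \<in> {i..j}" "X k \<in> \<aa> l" using X kr by blast
      then show ?thesis using level_hom[of l q Q "X k" "p k \<cdot> f"] q comp_arr[OF f d(5)[OF kr]] by auto
    qed
    then show ?thesis using partial_sum_comp_zero[OF W order_refl f] d(7) id_comp[OF f] by simp
  qed
  then have "W \<in> le j" using d(2) by (auto simp: le_def)
  moreover have "f = Zero C W Q" if q: "q < i" "Q \<in> \<aa> q" and f: "f \<Colon> W \<leadsto> Q" for q Q f
  proof -
    have "f \<cdot> h k = Zero C (X k) Q" if kr: "k \<in> {..<r}" for k
    proof -
      obtain l where "l \<in> {i..j}" "X k \<in> \<aa> l" using X kr by blast
      then show ?thesis using level_hom[of q l "X k" Q "f \<cdot> h k"] q comp_arr[OF d(4)[OF kr] f] by auto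
    qed
    then show ?thesis using comp_partial_sum_zero[OF W order_refl f] d(7) comp_id[OF f] by simp
  qed
  then have "W \<in> ge i" using d(2) by (auto simp: ge_def)
  ultimately show "A \<in> ge i \<inter> le j"
    using retract_le[of W j p1 A i1] retract_ge[of W i p1 A i1] biproductD[OF A] by blast
next
  fix A assume A: "A \<in> ge i \<inter> le j"
  then have AO: "A \<in> Ob C" using ge_Ob by blast
  obtain I a h p where a: "\<And>k. k \<in> I \<Longrightarrow> a k \<in> \<aa> k" and ds: "is_direct_sum C (I :: int set) a A h p"
    using level_decomposition[OF AO] by blast
  note d = direct_sumD[OF ds]
  interpret G: comm_group "hom_group C A A" using AO by (auto intro: hom_comm_group)
  let ?K = "I \<inter> {i..j}"
  have z: "h k \<cdot> p k = Zero C A A" if k: "k \<in> I" "k \<notin> {i..j}" for k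
  proof (cases "k < i")
    case True
    then have "p k = Zero C A (a k)" using A d(5)[OF k(1)] a[OF k(1)] by (auto simp: ge_def)
    then show ?thesis using comp_zero[OF d(4)[OF k(1)] AO] by simp
  next
    case False
    then have "j < k" using k by auto
    then have "h k = Zero C (a k) A" using A d(4)[OF k(1)] a[OF k(1)] by (auto simp: le_def)
    then show ?thesis using zero_comp[OF d(5)[OF k(1)] AO] by simp
  qed
  have cl: "h k \<cdot> p k \<in> carrier (hom_group C A A)" if "k \<in> I" for k
    using d(8)[OF that] by (simp add: hom_group_def arr_def)
  have "finprod (hom_group C A A) (\<lambda>k. h k \<cdot> p k) ?K = finprod (hom_group C A A) (\<lambda>k. h k \<cdot> p k) I"
    by (rule G.finprod_mono_neutral_cong_left) (use d(1) z cl in \<open>auto simp: hom_group_def\<close>)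
  then have K: "finprod (hom_group C A A) (\<lambda>k. h k \<cdot> p k) ?K = Idm C A" using d(7) by simp
  have "finite ?K" using d(1) by blast
  then obtain b where b: "bij_betw b {..<card ?K} ?K"
    using ex_bij_betw_nat_finite[of ?K] by (auto simp: atLeast0LessThan)
  then have bi: "inj_on b {..<card ?K}" and bim: "b ` {..<card ?K} = ?K" by (auto simp: bij_betw_def)
  then have bK: "b k \<in> ?K" if "k < card ?K" for k using that by blast
  have "finprod (hom_group C A A) (\<lambda>k. h k \<cdot> p k) (b ` {..<card ?K}) =
      finprod (hom_group C A A) (\<lambda>k. h (b k) \<cdot> p (b k)) {..<card ?K}"
    by (rule G.finprod_reindex) (use bi bK cl in auto)
  then have "finprod (hom_group C A A) (\<lambda>k. h (b k) \<cdot> p (b k)) {..<card ?K} = Idm C A"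
    using K bim by simp
  moreover have "b k = b l \<longleftrightarrow> k = l" if "k < card ?K" "l < card ?K" for k l
    using bi that by (auto simp: inj_on_def)
  ultimately have "is_direct_sum C {..<card ?K} (\<lambda>k. a (b k)) A (\<lambda>k. h (b k)) (\<lambda>k. p (b k))"
    using bK d(3-6) AO by (auto simp: is_direct_sum_def arr_def)
  moreover have "a (b k) \<in> (\<Union>p\<in>{i..j}. \<aa> p)" if "k < card ?K" for k
    using bK[OF that] a by blast
  moreover obtain Z where Z: "is_zero C Z" using zero_object by blast
  note biproduct_with_zero[OF Z AO]
  ultimately have "\<exists>(r::nat) X W j' p B i1 i2 p1 p2. (\<forall>k<r. X k \<in> (\<Union>p\<in>{i..j}. \<aa> p)) \<and>
      is_direct_sum C {..<r} X W j' p \<and> is_biproduct C A B W i1 i2 p1 p2"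
    by metis
  then show "A \<in> trunc C \<aa> i j" unfolding trunc_def add_closure_def by simp
qed

text \<open>Such an object is zero or isomorphic to its summand of level \<open>l\<close>, since all other summands vanish.\<close>

lemma idems_split_one_level:
  assumes ic: "idempotent_complete (full_subcategory C (\<aa> l))" and X: "X \<in> ge l \<inter> le l"
  shows "idems_split C X"
  unfolding idems_split_def
proof (intro allI impI)
  fix e assume e: "e \<Colon> X \<leadsto> X" and ee: "e \<cdot> e = e"
  have XO: "X \<in> Ob C" using X ge_Ob by blast
  obtain I a h p where a: "\<And>k. k \<in> I \<Longrightarrow> a k \<in> \<aa> k" and ds: "is_direct_sum C (I :: int set) a X h p"
    using level_decomposition[OF XO] by blast
  note d = direct_sumD[OF ds]
  have z: "(h k \<cdot> p k) = Zero C X X" if k: "k \<in> I" "k \<noteq> l" for k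
  proof (cases "k < l")
    case True
    then have "p k = Zero C X (a k)" using X d(5)[OF k(1)] a[OF k(1)] by (auto simp: ge_def)
    then show ?thesis using comp_zero[OF d(4)[OF k(1)] XO] by simp
  next
    case False
    then have "l < k" using k(2) by simp
    then have "h k = Zero C (a k) X" using X d(4)[OF k(1)] a[OF k(1)] by (auto simp: le_def)
    then show ?thesis using zero_comp[OF d(5)[OF k(1)] XO] by simp
  qed
  show "\<exists>Y r s. splits_idem C X e Y r s"
  proof (cases "l \<in> I")
    case False
    then have "Idm C X = Zero C X X" using finprod_zero[OF XO XO, of I "\<lambda>k. h k \<cdot> p k"] z d(7) by metis
    then have "Idm C X = e" using comp_id[OF e] comp_zero[OF e XO] by simp
    then show ?thesis using e ee by (intro exI[of _ X] exI[of _ e]) (simp add: splits_idem_def)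
  next
    case True
    have I: "I = insert l (I - {l})" using True by blast
    have zz: "finprod (hom_group C X X) (\<lambda>k. h k \<cdot> p k) (I - {l}) = Zero C X X"
      by (rule finprod_zero[OF XO XO]) (use z in auto)
    have "finprod (hom_group C X X) (\<lambda>k. h k \<cdot> p k) (insert l (I - {l})) =
      Add C (h l \<cdot> p l) (finprod (hom_group C X X) (\<lambda>k. h k \<cdot> p k) (I - {l}))"
      by (rule finprod_insert_arr) (use d(1,8) True in auto)
    then have hp: "h l \<cdot> p l = Idm C X"
      using zz d(7) I add_zero(1)[OF d(8)[OF True]] by simp
    note h = d(4)[OF True] and p = d(5)[OF True]
    have pe: "p l \<cdot> e \<Colon> X \<leadsto> a l" and eh: "e \<cdot> h l \<Colon> a l \<leadsto> X" using e h p by blast+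
    define e' where "e' = p l \<cdot> (e \<cdot> h l)"
    have e': "e' \<Colon> a l \<leadsto> a l" unfolding e'_def using e h p by blast
    have he': "h l \<cdot> e' = e \<cdot> h l"
      unfolding e'_def using assoc[OF eh p h] hp id_comp[OF eh] by simp
    have "e' \<cdot> e' = p l \<cdot> (e \<cdot> (h l \<cdot> e'))"
      using assoc[OF e' eh p] assoc[OF e' h e] unfolding e'_def by simp
    then have "e' \<cdot> e' = e'" using he' assoc[OF h e e] ee unfolding e'_def by simp
    then obtain Y r s where Y: "Y \<in> \<aa> l" "r \<in> Hom C (a l) Y" "s \<in> Hom C Y (a l)" "s \<cdot> r = e'" "r \<cdot> s = Idm C Y"
      using ic a[OF True] e' unfolding idempotent_complete_def arr_def full_subcategory_simps by blast
    then have r: "r \<Colon> a l \<leadsto> Y" and s: "s \<Colon> Y \<leadsto> a l" using level_Ob d(3)[OF True] by (auto simp: arr_def)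
    have "(h l \<cdot> s) \<cdot> (r \<cdot> p l) = (h l \<cdot> e') \<cdot> p l"
      using assoc[OF comp_arr[OF p r] s h] assoc[OF p r s] assoc[OF p e' h] Y(4) by simp
    also have "\<dots> = e" using he' assoc[OF p h e] hp comp_id[OF e] by simp
    finally have 1: "(h l \<cdot> s) \<cdot> (r \<cdot> p l) = e" .
    have "(r \<cdot> p l) \<cdot> (h l \<cdot> s) = Idm C Y"
      using assoc[OF comp_arr[OF s h] p r] assoc[OF s h p] d(6)[OF True True] id_comp[OF s] Y(5) by simp
    then have "splits_idem C X e Y (r \<cdot> p l) (h l \<cdot> s)"
      using 1 r s h p by (auto simp: splits_idem_def)
    then show ?thesis by blast
  qed
qed

text \<open>Induction on the number of levels: split off the highest level, on which the triangular form applies.\<close>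

lemma idems_split_trunc:
  assumes ic: "\<And>l. idempotent_complete (full_subcategory C (\<aa> l))"
  shows "X \<in> ge 0 \<inter> le (int k - 1) \<Longrightarrow> idems_split C X"
proof (induction k arbitrary: X)
  case 0
  have X: "X \<in> Ob C" using 0 ge_Ob by blast
  have z: "f = Zero C X X" if "f \<Colon> X \<leadsto> X" for f using hom_ge_le[of X "-1" X f] 0 that by simp
  have i: "Idm C X \<Colon> X \<leadsto> X" using X by blast
  have "splits_idem C X e X e e" if "e \<Colon> X \<leadsto> X" for e
    using that z[OF that] z[OF i] z[OF comp_arr[OF that that]] by (simp add: splits_idem_def)
  then show ?case unfolding idems_split_def by blast
next
  case (Suc k)
  have X: "X \<in> Ob C" using Suc.prems ge_Ob by blast
  obtain A B i1 i2 p1 p2 where A: "A \<in> le (int k - 1)" and B: "B \<in> ge (int k - 1 + 1)"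
    and b: "is_biproduct C A B X i1 i2 p1 p2" using level_splitting[OF X] by blast
  note bb = biproductD[OF b]
  have "A \<in> ge 0" using retract_ge[OF _ bb(3,1,5)] Suc.prems by blast
  moreover have "B \<in> le (int k)" using retract_le[OF _ bb(4,2,6)] Suc.prems by simp
  moreover have "\<And>g. g \<Colon> B \<leadsto> A \<Longrightarrow> g = Zero C B A" using hom_ge_le[OF B A] .
  ultimately show ?case
    using idems_split_triangular[OF b _ Suc.IH idems_split_one_level[OF ic[of "int k"]]] A B by simp
qed

lemma additive_trunc: "additive_category (full_subcategory C (trunc C \<aa> i j))"
proof -
  have S: "trunc C \<aa> i j \<subseteq> Ob C" unfolding trunc_eq using ge_Ob by blast
  interpret S: preadditive_category "full_subcategory C (trunc C \<aa> i j)" by (rule preadditive_full_subcategory[OF S])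
  show ?thesis
  proof unfold_locales
    obtain Z where Z: "is_zero C Z" using zero_object by blast
    then have "is_zero (full_subcategory C (trunc C \<aa> i j)) Z"
      using zero_in_levels[OF Z] S by (auto simp: is_zero_def trunc_eq)
    then show "\<exists>Z. is_zero (full_subcategory C (trunc C \<aa> i j)) Z" ..
    show "\<exists>Z i1 i2 p1 p2. is_biproduct (full_subcategory C (trunc C \<aa> i j)) A B Z i1 i2 p1 p2"
      if AB: "A \<in> Ob (full_subcategory C (trunc C \<aa> i j))" "B \<in> Ob (full_subcategory C (trunc C \<aa> i j))" for A B
    proof -
      obtain Z i1 i2 p1 p2 where Z: "is_biproduct C A B Z i1 i2 p1 p2" using biproducts[of A B] AB S by (metis full_subcategory_simps(1) subset_iff)
      then have "Z \<in> trunc C \<aa> i j" using biproduct_le[OF Z] biproduct_ge[OF Z] AB by (simp add: trunc_eq)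
      then have "is_biproduct (full_subcategory C (trunc C \<aa> i j)) A B Z i1 i2 p1 p2"
        using Z AB by (simp add: is_biproduct_def)
      then show ?thesis by blast
    qed
  qed
qed

lemma idempotent_complete_trunc:
  assumes ic: "\<And>l. idempotent_complete (full_subcategory C (\<aa> l))"
  shows "idempotent_complete (full_subcategory C (trunc C \<aa> 0 (int m)))"
  unfolding idempotent_complete_def
proof (intro ballI impI)
  fix X e assume "X \<in> Ob (full_subcategory C (trunc C \<aa> 0 (int m)))"
    "e \<in> Hom (full_subcategory C (trunc C \<aa> 0 (int m))) X X"
    "e \<cdot>\<^bsub>full_subcategory C (trunc C \<aa> 0 (int m))\<^esub> e = e"
  then have X: "X \<in> ge 0 \<inter> le (int m)" and e: "e \<Colon> X \<leadsto> X" "e \<cdot> e = e"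
    using ge_Ob by (auto simp: trunc_eq arr_def)
  then obtain Y r s where Y: "r \<Colon> X \<leadsto> Y" "s \<Colon> Y \<leadsto> X" "s \<cdot> r = e" "r \<cdot> s = Idm C Y"
    using idems_split_trunc[OF ic, of X "Suc m"] by (auto simp: idems_split_def splits_idem_def)
  have "Y \<in> trunc C \<aa> 0 (int m)"
    using retract_le[OF _ Y(1,2,4)] retract_ge[OF _ Y(1,2,4)] X by (simp add: trunc_eq)
  then show "\<exists>Y\<in>Ob (full_subcategory C (trunc C \<aa> 0 (int m))).
      \<exists>r\<in>Hom (full_subcategory C (trunc C \<aa> 0 (int m))) X Y.
      \<exists>s\<in>Hom (full_subcategory C (trunc C \<aa> 0 (int m))) Y X.
        s \<cdot>\<^bsub>full_subcategory C (trunc C \<aa> 0 (int m))\<^esub> r = e \<and>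
        r \<cdot>\<^bsub>full_subcategory C (trunc C \<aa> 0 (int m))\<^esub> s = Idm (full_subcategory C (trunc C \<aa> 0 (int m))) Y"
    using Y by (auto simp: arr_def)
qed

end

section \<open>Levels in an angulated category\<close>

text \<open>For negative \<open>j\<close> the power is an iterated inverse, which one application of the suspension shortens by one.\<close>

lemma image_ob_power:
  assumes bij: "bij_betw So (Ob C) (Ob C)" and a0: "\<aa> 0 \<subseteq> Ob C"
    and a: "\<And>j. \<aa> j = ob_power C So j ` \<aa> 0"
  shows "\<aa> (j + 1) = So ` \<aa> j"
proof (cases "j \<ge> 0")
  case True
  then have "ob_power C So (j + 1) X = So (ob_power C So j X)" for X
    by (simp add: ob_power_def nat_add_distrib)
  then show ?thesis using a[of j] a[of "j + 1"] by (auto simp: image_iff)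
next
  case False
  let ?i = "inv_into (Ob C) So"
  have iO: "(?i ^^ k) X \<in> Ob C" if "X \<in> Ob C" for k X
    using that bij by (induction k) (auto simp: bij_betw_def intro: inv_into_into)
  have "So (?i X) = X" if "X \<in> Ob C" for X using that bij by (auto simp: bij_betw_def f_inv_into_f)
  moreover have "nat (- j) = Suc (nat (- (j + 1)))" using False by simp
  moreover have "ob_power C So (j + 1) X = (?i ^^ nat (- (j + 1))) X" for X
    using False by (auto simp: ob_power_def)
  ultimately have "So (ob_power C So j X) = ob_power C So (j + 1) X" if "X \<in> Ob C" for X
    using False iO[OF that] by (simp add: ob_power_def)
  then show ?thesis using a[of j] a[of "j + 1"] a0 by (auto simp: image_iff) (metis subsetD)+
qed

locale leveled_angulated_category = angulated_category C So Sm n angle + leveled_category C \<aa>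
  for C :: "('o, 'm) preadd" (structure) and So Sm n angle \<aa> +
  assumes n: "n \<ge> 1" and level_shift: "\<aa> (p + 1) = So ` \<aa> p"
begin

lemma So_ge_iff:
  assumes X: "X \<in> Ob C"
  shows "So X \<in> ge (p + 1) \<longleftrightarrow> X \<in> ge p"
proof
  assume S: "So X \<in> ge (p + 1)"
  have "f = Zero C X Q" if q: "q < p" "Q \<in> \<aa> q" and f: "f \<Colon> X \<leadsto> Q" for q Q f
  proof -
    have "So Q \<in> \<aa> (q + 1)" using q level_shift by simp
    then have "Sm f = Zero C (So X) (So Q)" using geD[OF S _ _ Sm_arr[OF f], of "q + 1"] q(1) by simp
    then show ?thesis
      using Sm_zero[OF arr_obD[OF f]] Sm_inj[OF f zero_arr[OF arr_obD[OF f]]] by simp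
  qed
  then show "X \<in> ge p" using X by (auto simp: ge_def)
next
  assume P: "X \<in> ge p"
  have "f = Zero C (So X) Q" if q: "q < p + 1" "Q \<in> \<aa> q" and f: "f \<Colon> So X \<leadsto> Q" for q Q f
  proof -
    obtain Q' where Q': "Q' \<in> \<aa> (q - 1)" "Q = So Q'" using q level_shift[of "q - 1"] by auto
    have Q'O: "Q' \<in> Ob C" using Q' level_Ob by blast
    obtain g where g: "g \<Colon> X \<leadsto> Q'" "f = Sm g" using Sm_surj[OF X Q'O] f Q'(2) by blast
    have "g = Zero C X Q'" using geD[OF P _ Q'(1) g(1)] q(1) by simp
    then show ?thesis using g(2) Q'(2) Sm_zero[OF X Q'O] by simp
  qed
  then show "So X \<in> ge (p + 1)" using So_Ob[OF X] by (auto simp: ge_def)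
qed

lemma So_le_iff:
  assumes X: "X \<in> Ob C"
  shows "So X \<in> le (p + 1) \<longleftrightarrow> X \<in> le p"
proof
  assume S: "So X \<in> le (p + 1)"
  have "f = Zero C Q X" if q: "p < q" "Q \<in> \<aa> q" and f: "f \<Colon> Q \<leadsto> X" for q Q f
  proof -
    have "So Q \<in> \<aa> (q + 1)" using q level_shift by simp
    then have "Sm f = Zero C (So Q) (So X)" using leD[OF S _ _ Sm_arr[OF f], of "q + 1"] q(1) by simp
    then show ?thesis
      using Sm_zero[OF arr_obD[OF f]] Sm_inj[OF f zero_arr[OF arr_obD[OF f]]] by simp
  qed
  then show "X \<in> le p" using X by (auto simp: le_def)
next
  assume P: "X \<in> le p"
  have "f = Zero C Q (So X)" if q: "p + 1 < q" "Q \<in> \<aa> q" and f: "f \<Colon> Q \<leadsto> So X" for q Q f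
  proof -
    obtain Q' where Q': "Q' \<in> \<aa> (q - 1)" "Q = So Q'" using q level_shift[of "q - 1"] by auto
    have Q'O: "Q' \<in> Ob C" using Q' level_Ob by blast
    obtain g where g: "g \<Colon> Q' \<leadsto> X" "f = Sm g" using Sm_surj[OF Q'O X] f Q'(2) by blast
    have "g = Zero C Q' X" using leD[OF P _ Q'(1) g(1)] q(1) by simp
    then show ?thesis using g(2) Q'(2) Sm_zero[OF Q'O X] by simp
  qed
  then show "So X \<in> le (p + 1)" using So_Ob[OF X] by (auto simp: le_def)
qed

lemma idempotent_complete_shift:
  "idempotent_complete (full_subcategory C (\<aa> p)) \<longleftrightarrow> idempotent_complete (full_subcategory C (\<aa> (p + 1)))"
proof
  assume ic: "idempotent_complete (full_subcategory C (\<aa> p))"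
  show "idempotent_complete (full_subcategory C (\<aa> (p + 1)))"
    unfolding idempotent_complete_def full_subcategory_simps
  proof (intro ballI impI)
    fix X e assume X: "X \<in> \<aa> (p + 1)" and e: "e \<in> Hom C X X" "e \<cdot> e = e"
    obtain X' where X': "X' \<in> \<aa> p" "X = So X'" using X level_shift by auto
    have XO: "X' \<in> Ob C" using X' level_Ob by blast
    obtain e' where e': "e' \<Colon> X' \<leadsto> X'" "e = Sm e'"
      using Sm_surj[OF XO XO, of e] e X' So_Ob[OF XO] by (auto simp: arr_def)
    have "e' \<cdot> e' = e'"
      using Sm_inj[OF comp_arr[OF e'(1,1)] e'(1)] Sm_comp[OF e'(1,1)] e(2) e'(2) by simp
    then obtain Y r s where Y: "Y \<in> \<aa> p" "r \<in> Hom C X' Y" "s \<in> Hom C Y X'" "s \<cdot> r = e'" "r \<cdot> s = Idm C Y"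
      using ic X'(1) e'(1) unfolding idempotent_complete_def full_subcategory_simps arr_def by blast
    have YO: "Y \<in> Ob C" using Y level_Ob by blast
    have r: "r \<Colon> X' \<leadsto> Y" and s: "s \<Colon> Y \<leadsto> X'" using Y XO YO by (auto simp: arr_def)
    have "So Y \<in> \<aa> (p + 1)" using Y level_shift by simp
    moreover have "Sm r \<in> Hom C X (So Y)" "Sm s \<in> Hom C (So Y) X"
      using Sm_arr[OF r] Sm_arr[OF s] X' by (auto simp: arr_def)
    moreover have "Sm s \<cdot> Sm r = e" "Sm r \<cdot> Sm s = Idm C (So Y)"
      using Sm_comp[OF r s] Sm_comp[OF s r] Y(4,5) e'(2) Sm_Id[OF YO] by simp_all
    ultimately show "\<exists>Y\<in>\<aa> (p + 1). \<exists>r\<in>Hom C X Y. \<exists>s\<in>Hom C Y X. s \<cdot> r = e \<and> r \<cdot> s = Idm C Y" by blast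
  qed
next
  assume ic: "idempotent_complete (full_subcategory C (\<aa> (p + 1)))"
  show "idempotent_complete (full_subcategory C (\<aa> p))"
    unfolding idempotent_complete_def full_subcategory_simps
  proof (intro ballI impI)
    fix X e assume X: "X \<in> \<aa> p" and e: "e \<in> Hom C X X" "e \<cdot> e = e"
    have XO: "X \<in> Ob C" and SX: "So X \<in> \<aa> (p + 1)" using X level_Ob level_shift by auto
    have e': "e \<Colon> X \<leadsto> X" using e XO by (simp add: arr_def)
    have "Sm e \<cdot> Sm e = Sm e" using Sm_comp[OF e' e'] e(2) by simp
    then obtain Y' r' s' where Y': "Y' \<in> \<aa> (p + 1)" "r' \<in> Hom C (So X) Y'" "s' \<in> Hom C Y' (So X)"
      "s' \<cdot> r' = Sm e" "r' \<cdot> s' = Idm C Y'"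
      using ic SX Sm_arr[OF e'] unfolding idempotent_complete_def full_subcategory_simps arr_def by blast
    obtain Y where Y: "Y \<in> \<aa> p" "Y' = So Y" using Y' level_shift by auto
    have YO: "Y \<in> Ob C" using Y level_Ob by blast
    obtain r s where r: "r \<Colon> X \<leadsto> Y" "r' = Sm r" and s: "s \<Colon> Y \<leadsto> X" "s' = Sm s"
      using Sm_surj[OF XO YO, of r'] Sm_surj[OF YO XO, of s'] Y' Y(2) So_Ob XO YO by (auto simp: arr_def)
    have "s \<cdot> r = e"
      using Sm_inj[OF comp_arr[OF r(1) s(1)] e'] Sm_comp[OF r(1) s(1)] Y'(4) r(2) s(2) by simp
    moreover have "r \<cdot> s = Idm C Y"
      using Sm_inj[OF comp_arr[OF s(1) r(1)] id_arr[OF YO]] Sm_comp[OF s(1) r(1)] Y'(5) Y(2) r(2) s(2) Sm_Id[OF YO]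
      by simp
    ultimately show "\<exists>Y\<in>\<aa> p. \<exists>r\<in>Hom C X Y. \<exists>s\<in>Hom C Y X. s \<cdot> r = e \<and> r \<cdot> s = Idm C Y"
      using r(1) s(1) Y(1) by (auto simp: arr_def)
  qed
qed

lemma idempotent_complete_levels:
  assumes "idempotent_complete (full_subcategory C (\<aa> 0))"
  shows "idempotent_complete (full_subcategory C (\<aa> p))"
proof (induction p rule: int_induct[where k = 0])
  case base
  show ?case by (fact assms)
next
  case (step1 i)
  then show ?case using idempotent_complete_shift by simp
next
  case (step2 i)
  then show ?case using idempotent_complete_shift[of "i - 1"] by simp
qed

subsection \<open>Helices through morphisms of the truncated subcategory\<close>

lemma helix_period:
  assumes "helix E e"
  shows "E (r + (n + 2)) = So (E r)" "e (r + (n + 2)) = susp (E r) (E (Suc r)) (e r)"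
  using assms by (auto simp: helix_def)

text \<open>Test objects and helix can be desuspended simultaneously: injectivity of a helix morphism moves along the period,
  and the levels of the test objects move with it.\<close>

lemma helix_mono_shift:
  assumes h: "helix E e"
    and i: "\<And>Q y. \<lbrakk>Q \<in> ge p; y \<Colon> Q \<leadsto> E r; e r \<cdot> y = Zero C Q (E (Suc r))\<rbrakk> \<Longrightarrow> y = Zero C Q (E r)"
  shows "\<lbrakk>Q \<in> ge (p + int k); y \<Colon> Q \<leadsto> E (r + k * (n + 2));
      e (r + k * (n + 2)) \<cdot> y = Zero C Q (E (Suc (r + k * (n + 2))))\<rbrakk> \<Longrightarrow> y = Zero C Q (E (r + k * (n + 2)))"
proof (induction k arbitrary: Q y)
  case 0
  then show ?case using i by simp
next
  case (Suc k)
  let ?r = "r + k * (n + 2)"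
  have r: "r + Suc k * (n + 2) = ?r + (n + 2)" "Suc (r + Suc k * (n + 2)) = Suc ?r + (n + 2)" by simp_all
  note E = helix_period[OF h, of ?r] and E' = helix_period(1)[OF h, of "Suc ?r"]
  note a = helix_arr[OF h, of ?r]
  have QO: "Q \<in> Ob C" using Suc.prems(1) ge_Ob by blast
  then obtain Q' where Q': "Q' \<in> Ob C" "Q = So Q'" using So_surj by blast
  have "Q' \<in> ge (p + int k)" using So_ge_iff[OF Q'(1), of "p + int k"] Suc.prems(1) Q'(2) by (simp add: algebra_simps)
  moreover obtain y' where y': "y' \<Colon> Q' \<leadsto> E ?r" "y = Sm y'"
    using Sm_surj[OF Q'(1) arr_obD(1)[OF a], of y] Suc.prems(2) E(1) Q'(2) unfolding r by auto
  moreover have "e ?r \<cdot> y' = Zero C Q' (E (Suc ?r))"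
    using susp_comp_zero_iff[OF a y'(1)] Suc.prems(3) y'(2) E E' Q'(2) unfolding r by simp
  ultimately have "y' = Zero C Q' (E ?r)" using Suc.IH by blast
  then show ?case using y'(2) Sm_zero[OF Q'(1) arr_obD(1)[OF a]] E(1) Q'(2) unfolding r by simp
qed

lemma helix_epi_shift:
  assumes h: "helix E e"
  shows "\<lbrakk>\<And>Q y. \<lbrakk>Q \<in> le (p + int k); y \<Colon> E (Suc (r + k * (n + 2))) \<leadsto> Q;
      y \<cdot> e (r + k * (n + 2)) = Zero C (E (r + k * (n + 2))) Q\<rbrakk> \<Longrightarrow> y = Zero C (E (Suc (r + k * (n + 2)))) Q;
    Q \<in> le p; y \<Colon> E (Suc r) \<leadsto> Q; y \<cdot> e r = Zero C (E r) Q\<rbrakk> \<Longrightarrow> y = Zero C (E (Suc r)) Q"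
proof (induction k arbitrary: Q y)
  case 0
  then show ?case by simp
next
  case (Suc k)
  let ?r = "r + k * (n + 2)"
  have r: "r + Suc k * (n + 2) = ?r + (n + 2)" "Suc (r + Suc k * (n + 2)) = Suc ?r + (n + 2)" by simp_all
  note E = helix_period[OF h, of ?r] and E' = helix_period(1)[OF h, of "Suc ?r"]
  note a = helix_arr[OF h, of ?r]
  show ?case
  proof (rule Suc.IH[OF _ Suc.prems(2-4)])
    fix Q y assume Q: "Q \<in> le (p + int k)" and y: "y \<Colon> E (Suc ?r) \<leadsto> Q" and z: "y \<cdot> e ?r = Zero C (E ?r) Q"
    have QO: "Q \<in> Ob C" using Q le_Ob by blast
    have "So Q \<in> le (p + int (Suc k))" using So_le_iff[OF QO, of "p + int k"] Q by (simp add: algebra_simps)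
    moreover have "Sm y \<Colon> E (Suc ?r + (n + 2)) \<leadsto> So Q" using Sm_arr[OF y] E' by simp
    moreover have "Sm y \<cdot> e (?r + (n + 2)) = Zero C (E (?r + (n + 2))) (So Q)"
      using comp_susp_zero_iff[OF a y] z E by simp
    ultimately have "Sm y = Zero C (So (E (Suc ?r))) (So Q)"
      using Suc.prems(1)[of "So Q" "Sm y"] E' unfolding r by simp
    then show "y = Zero C (E (Suc ?r)) Q"
      using Sm_inj[OF y zero_arr[OF arr_obD[OF y]]] Sm_zero[OF arr_obD[OF y]] by simp
  qed
qed

text \<open>The angle that starts with \<open>B\<close> and ends with \<open>susp u : \<Sigma> A \<rightarrow> \<Sigma> B\<close> has all its objects in \<open>\<T>[0, m + 1]\<close> by
  closure under extensions. It is the rotation of an angle that starts with \<open>u\<close>. The helix is continued to the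
  left for \<open>K = d + 2\<close> more steps, to give room to the kernel side; thus \<open>u\<close> sits in position \<open>K\<close>.\<close>

lemma helix_through:
  assumes ext: "closed_under_n_extensions C So n angle (trunc C \<aa> 0 (int m + 1))"
    and A: "A \<in> trunc C \<aa> 0 (int m)" and B: "B \<in> trunc C \<aa> 0 (int m)" and u: "u \<Colon> A \<leadsto> B"
    and K: "K = (m + 1) * (n + 2)"
  obtains E e where "helix E e" "E K = A" "E (Suc K) = B" "e K = u"
    "\<And>i. E (K + i) \<in> ge 0" "\<And>i. i \<le> Suc K \<Longrightarrow> E i \<in> le (int m)"
    "E (K + K) \<in> ge (int m + 1)" "E 1 \<in> le (- 1)"
proof -
  have AO: "A \<in> Ob C" and BO: "B \<in> Ob C" using u arr_obD by auto
  have A': "A \<in> ge 0" "A \<in> le (int m)" and B': "B \<in> ge 0" "B \<in> le (int m)" using A B by (auto simp: trunc_eq)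
  have "So A \<in> ge (0 + 1)" "So A \<in> le (int m + 1)" using So_ge_iff[OF AO] So_le_iff[OF AO] A' by blast+
  then have SA: "So A \<in> trunc C \<aa> 0 (int m + 1)" using ge_mono[of 0 1] by (auto simp: trunc_eq)
  have B1: "B \<in> trunc C \<aa> 0 (int m + 1)" using B' le_mono[of "int m" "int m + 1"] by (auto simp: trunc_eq)
  obtain X f where X: "angle X f" "X 0 = B" "X (n + 1) = So A" "f (n + 1) = susp A B u"
    "\<forall>i\<in>{1..n}. X i \<in> trunc C \<aa> 0 (int m + 1)"
    using ext B1 SA susp_arr[OF u] unfolding closed_under_n_extensions_def arr_def by blast
  obtain E0 e0 where E0: "helix E0 e0" "\<And>i. i < n + 2 \<Longrightarrow> E0 i = X i" "\<And>i. i < n + 2 \<Longrightarrow> e0 i = f i"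
    using helix_of_angle[OF X(1)] by blast
  obtain E e where h: "helix E e" and E: "\<And>r. E (Suc K + r) = E0 r" "\<And>r. e (Suc K + r) = e0 r"
    using helix_shift_left[OF E0(1)] by blast
  note per = helix_period[OF h] and a = helix_arr[OF h]
  have EO: "E i \<in> Ob C" for i using a arr_obD by blast
  have EB: "E (Suc K) = B" using E(1)[of 0] E0(2)[of 0] X(2) by simp
  have "So (E K) = So A" using per(1)[of K] E(1)[of "n + 1"] E0(2)[of "n + 1"] X(3) by simp
  then have EA: "E K = A" using So_inj[OF EO AO] by blast
  have "susp A B (e K) = susp A B u"
    using per(2)[of K] E(2)[of "n + 1"] E0(3)[of "n + 1"] X(4) EA EB by simp
  then have eu: "e K = u" using susp_inj[OF _ u, of "e K"] a[of K] EA EB by simp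
  have mid: "E (K + i) \<in> ge 0 \<inter> le (int m + 1)" if "2 \<le> i" "i \<le> n + 1" for i
  proof -
    have "E (K + i) = X (i - 1)" "i - 1 \<in> {1..n}"
      using that E(1)[of "i - 1"] E0(2)[of "i - 1"] by auto
    then show ?thesis using X(5) by (simp add: trunc_eq)
  qed
  have ge0: "E (K + i) \<in> ge 0" for i
  proof (induction i rule: less_induct)
    case (less i)
    consider "i = 0" | "i = 1" | "2 \<le> i" "i \<le> n + 1" | "n + 2 \<le> i" by linarith
    then show ?case
    proof cases
      case 4
      then have "K + (i - (n + 2)) + (n + 2) = K + i" by simp
      then have "E (K + i) = So (E (K + (i - (n + 2))))" using per(1) by metis
      moreover have "i - (n + 2) < i" using 4 by simp
      then have "E (K + (i - (n + 2))) \<in> ge 0" by (rule less)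
      ultimately have "E (K + i) \<in> ge (0 + 1)" using So_ge_iff[OF EO] by metis
      then show ?thesis using ge_mono[of 0 1] by auto
    qed (use EA EB A' B' mid in auto)
  qed
  have lem: "E (Suc K - i) \<in> le (int m)" if "i \<le> Suc K" for i
    using that
  proof (induction i rule: less_induct)
    case (less i)
    consider "i = 0" | "i = 1" | "2 \<le> i" by linarith
    then show ?case
    proof cases
      case 3
      let ?j = "Suc K - i"
      have S: "E (?j + (n + 2)) = So (E ?j)" using per(1) .
      have "E (?j + (n + 2)) \<in> le (int m + 1)"
      proof (cases "i \<le> n + 1")
        case True
        have eq: "?j + (n + 2) = K + (n + 3 - i)" using True less.prems by simp
        have "2 \<le> n + 3 - i" "n + 3 - i \<le> n + 1" using True 3 by simp_all
        then show ?thesis unfolding eq using mid by blast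
      next
        case False
        have eq: "?j + (n + 2) = Suc K - (i - (n + 2))" using False less.prems by simp
        have "i - (n + 2) < i" "i - (n + 2) \<le> Suc K" using False less.prems by simp_all
        then have "E (Suc K - (i - (n + 2))) \<in> le (int m)" by (rule less.IH)
        then show ?thesis unfolding eq using le_mono[of "int m" "int m + 1"] by auto
      qed
      then show ?thesis using S So_le_iff[OF EO] by metis
    qed (use EA EB A' B' in auto)
  qed
  have up: "E (r + k * (n + 2)) \<in> ge (p + int k) \<longleftrightarrow> E r \<in> ge p"
    "E (r + k * (n + 2)) \<in> le (p + int k) \<longleftrightarrow> E r \<in> le p" for r k p
  proof (induction k)
    case (Suc k)
    have "E (r + Suc k * (n + 2)) = So (E (r + k * (n + 2)))"
      using per(1)[of "r + k * (n + 2)"] by (simp add: algebra_simps)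
    moreover have "p + int (Suc k) = p + int k + 1" by simp
    ultimately show "E (r + Suc k * (n + 2)) \<in> ge (p + int (Suc k)) \<longleftrightarrow> E r \<in> ge p"
      "E (r + Suc k * (n + 2)) \<in> le (p + int (Suc k)) \<longleftrightarrow> E r \<in> le p"
      using Suc So_ge_iff[OF EO] So_le_iff[OF EO] by metis+
  qed simp_all
  have "E (K + K) \<in> ge (int m + 1)" using up(1)[of K "m + 1" 0] EA A' K by (simp add: add.commute)
  moreover have "E 1 \<in> le (- 1)" using up(2)[of 1 "m + 1" "- 1"] EB B' K by (simp add: add.commute)
  moreover have "E i \<in> le (int m)" if "i \<le> Suc K" for i using lem[of "Suc K - i"] that by simp
  ultimately show ?thesis using that[OF h EA EB eu ge0] by blast
qed

text \<open>The half of the helix to the right of position \<open>K\<close>, and the reversed half to the left of \<open>K + 1\<close>, satisfy the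
  conditions of the truncation argument. In both cases a monomorphism or epimorphism of the truncated subcategory is
  first seen to be injective against all objects of levels at least \<open>0\<close>, respectively at most \<open>m\<close>, by splitting off the
  part that has no morphisms to \<open>A\<close>, respectively from \<open>B\<close>.\<close>

lemma trunc_d_abelian:
  assumes ext: "closed_under_n_extensions C So n angle (trunc C \<aa> 0 (int m + 1))"
    and ic: "idempotent_complete (full_subcategory C (\<aa> 0))"
  shows "d_abelian ((n + 2) * (m + 1) - 2) (full_subcategory C (trunc C \<aa> 0 (int m)))"
proof -
  define d where "d = (n + 2) * (m + 1) - 2"
  let ?S = "trunc C \<aa> 0 (int m)" and ?K = "(m + 1) * (n + 2)"
  have d: "d \<ge> 1" "?K = d + 2" using n by (auto simp: d_def)
  have S_Ob: "?S \<subseteq> Ob C" unfolding trunc_eq using ge_Ob by blast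
  obtain Z where Z: "is_zero C Z" using zero_object by blast
  have orth: "orthogonal C (ge (int m + 1)) ?S"
    unfolding orthogonal_def trunc_eq using hom_ge_le by blast
  have orth': "orthogonal C ?S (le (- 1))"
    unfolding orthogonal_def trunc_eq using hom_ge_le[of _ "- 1"] by auto
  have split_ge: "\<exists>A\<in>?S. \<exists>B\<in>ge (int m + 1). \<exists>\<iota> \<kappa> \<pi> \<rho>. is_biproduct C A B X \<iota> \<kappa> \<pi> \<rho>" if X: "X \<in> ge 0" for X
  proof -
    obtain A B i1 i2 p1 p2 where AB: "A \<in> le (int m)" "B \<in> ge (int m + 1)" "is_biproduct C A B X i1 i2 p1 p2"
      using level_splitting[of X "int m"] X ge_Ob by blast
    have "A \<in> ge 0" using retract_ge[OF X] biproductD[OF AB(3)] by blast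
    then show ?thesis using AB unfolding trunc_eq by blast
  qed
  have split_le: "\<exists>A\<in>?S. \<exists>B\<in>le (- 1). \<exists>\<iota> \<kappa> \<pi> \<rho>. is_biproduct C A B X \<iota> \<kappa> \<pi> \<rho>" if X: "X \<in> le (int m)" for X
  proof -
    obtain B A i1 i2 p1 p2 where AB: "B \<in> le (- 1)" "A \<in> ge (- 1 + 1)" "is_biproduct C B A X i1 i2 p1 p2"
      using level_splitting[of X "- 1"] X le_Ob by blast
    have "A \<in> le (int m)" using retract_le[OF X] biproductD[OF AB(3)] by blast
    moreover have "is_biproduct C A B X i2 i1 p2 p1"
      using AB(3) add_comm[OF comp_arr comp_arr] biproductD[OF AB(3)] unfolding is_biproduct_def by metis
    moreover have "A \<in> ge 0" using AB(2) by simp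
    ultimately show ?thesis using AB(1) unfolding trunc_eq by blast
  qed
  have right: "\<forall>A\<in>?S. \<forall>B\<in>?S. \<forall>u\<in>Hom C A B. \<exists>E e. cokernel_helix C ?S (ge (int m + 1)) d A B u E e"
    and left: "\<forall>A\<in>?S. \<forall>B\<in>?S. \<forall>u\<in>Hom C A B. \<exists>E e. cokernel_helix (opp C) ?S (le (- 1)) d B A u E e"
  proof -
    have "(\<exists>E e. cokernel_helix C ?S (ge (int m + 1)) d A B u E e) \<and>
        (\<exists>E e. cokernel_helix (opp C) ?S (le (- 1)) d B A u E e)"
      if AB: "A \<in> ?S" "B \<in> ?S" "u \<in> Hom C A B" for A B u
    proof
      have u: "u \<Colon> A \<leadsto> B" using AB S_Ob by (auto simp: arr_def)
      obtain E e where h: "helix E e" and E: "E ?K = A" "E (Suc ?K) = B" "e ?K = u"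
        and lev: "\<And>i. E (?K + i) \<in> ge 0" "\<And>i. i \<le> Suc ?K \<Longrightarrow> E i \<in> le (int m)"
          "E (?K + ?K) \<in> ge (int m + 1)" "E 1 \<in> le (- 1)"
        using helix_through[OF ext AB(1,2) u refl] by blast
      have A: "A \<in> le (int m)" and B: "B \<in> ge 0" using AB by (auto simp: trunc_eq)
      have "cokernel_helix C ?S (ge (int m + 1)) d A B u (\<lambda>i. E (?K + i)) (\<lambda>i. e (?K + i))"
        unfolding cokernel_helix_def
      proof (intro conjI allI impI ballI)
        show "exact_helix C (d + 2) (\<lambda>i. E (?K + i)) (\<lambda>i. e (?K + i))"
          using exact_helix_of_helix[OF h n] .
        show "E (?K + 0) = A" "E (?K + 1) = B" "e (?K + 0) = u" using E by simp_all
        show "E (?K + (d + 2)) \<in> ge (int m + 1)" using lev(3) d(2) by simp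
        show "\<exists>A'\<in>?S. \<exists>B'\<in>ge (int m + 1). \<exists>\<iota> \<kappa> \<pi> \<rho>. is_biproduct C A' B' (E (?K + i)) \<iota> \<kappa> \<pi> \<rho>" for i
          using split_ge lev(1) by blast
      next
        assume mono: "is_mono (full_subcategory C ?S) A B u"
        interpret S: preadditive_category "full_subcategory C ?S" using preadditive_full_subcategory[OF S_Ob] .
        have uS: "u \<Colon>\<^bsub>full_subcategory C ?S\<^esub> A \<leadsto> B" using AB by (simp add: arr_def)
        have inj: "y = Zero C Q (E ?K)"
          if Q: "Q \<in> ge 0" and y: "y \<Colon> Q \<leadsto> E ?K" and z: "e ?K \<cdot> y = Zero C Q (E (Suc ?K))" for Q y
        proof -
          obtain Q1 Q2 i1 i2 p1 p2 where q: "Q1 \<in> ?S" "Q2 \<in> ge (int m + 1)" "is_biproduct C Q1 Q2 Q i1 i2 p1 p2"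
            using split_ge[OF Q] by blast
          note b = biproductD[OF q(3)]
          have y': "y \<Colon> Q \<leadsto> A" using y E by simp
          have y1: "y \<cdot> i1 \<Colon> Q1 \<leadsto> A" and y2: "y \<cdot> i2 \<Colon> Q2 \<leadsto> A" using y' b by blast+
          have "u \<cdot> (y \<cdot> i1) = Zero C Q1 B"
            using assoc[OF b(1) y' u] z E zero_comp[OF b(1) arr_obD(2)[OF u]] by simp
          then have "y \<cdot> i1 = Zero C Q1 A"
            using mono S.is_mono_iff[OF uS] y1 q(1) AB(1) by (auto simp: arr_def)
          moreover have "y \<cdot> i2 = Zero C Q2 A" using hom_ge_le[OF q(2) A y2] .
          ultimately have "Add C ((y \<cdot> i1) \<cdot> p1) ((y \<cdot> i2) \<cdot> p2) = Zero C Q A"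
            using zero_comp[OF b(3)] zero_comp[OF b(4)] arr_obD[OF y'] add_zero(1)[of "Zero C Q A" Q A] by auto
          then show ?thesis
            using comp_add[OF comp_arr[OF b(3,1)] comp_arr[OF b(4,2)] y'] b(9) comp_id[OF y']
              assoc[OF b(3,1) y'] assoc[OF b(4,2) y'] E by simp
        qed
        fix Q y assume "Q \<in> ge (int m + 1)" "y \<Colon> Q \<leadsto> E (?K + (d + 2))"
          "e (?K + (d + 2)) \<cdot> y = Zero C Q (E (?K + (d + 3)))"
        then show "y = Zero C Q (E (?K + (d + 2)))"
          using helix_mono_shift[OF h inj, where k = "m + 1" and Q = Q and y = y] d(2)
          by (simp add: numeral_3_eq_3 numeral_2_eq_2 add.commute)
      qed
      then show "\<exists>E e. cokernel_helix C ?S (ge (int m + 1)) d A B u E e" by blast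
      have "cokernel_helix (opp C) ?S (le (- 1)) d B A u (\<lambda>i. E (Suc ?K - i)) (\<lambda>i. e (?K - i))"
        unfolding cokernel_helix_def
      proof (intro conjI allI impI ballI)
        show "exact_helix (opp C) (d + 2) (\<lambda>i. E (Suc ?K - i)) (\<lambda>i. e (?K - i))"
          using exact_helix_opp[OF exact_helix_of_helix[OF h n, of "d + 2" 0]] d(2) by simp
        show "E (Suc ?K - 0) = B" "E (Suc ?K - 1) = A" "e (?K - 0) = u" using E by simp_all
        show "E (Suc ?K - (d + 2)) \<in> le (- 1)" using lev(4) d(2) by simp
        show "\<exists>A'\<in>?S. \<exists>B'\<in>le (- 1). \<exists>\<iota> \<kappa> \<pi> \<rho>. is_biproduct (opp C) A' B' (E (Suc ?K - i)) \<iota> \<kappa> \<pi> \<rho>" for i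
        proof -
          have "E (Suc ?K - i) \<in> le (int m)" by (rule lev(2)) simp
          from split_le[OF this] show ?thesis unfolding is_biproduct_opp by blast
        qed
      next
        assume "is_mono (full_subcategory (opp C) ?S) B A u"
        then have mono: "is_mono (opp (full_subcategory C ?S)) B A u" by (simp add: opp_full_subcategory)
        interpret S: preadditive_category "full_subcategory C ?S" using preadditive_full_subcategory[OF S_Ob] .
        interpret SO: preadditive_category "opp (full_subcategory C ?S)" by (rule S.preadditive_opp)
        have uS: "u \<Colon>\<^bsub>opp (full_subcategory C ?S)\<^esub> B \<leadsto> A" using AB by (simp add: arr_def)
        have inj: "y = Zero C (E (Suc ?K)) Q"
          if Q: "Q \<in> le (int m)" and y: "y \<Colon> E (Suc ?K) \<leadsto> Q" and z: "y \<cdot> e ?K = Zero C (E ?K) Q" for Q y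
        proof -
          obtain Q1 Q2 i1 i2 p1 p2 where q: "Q1 \<in> ?S" "Q2 \<in> le (- 1)" "is_biproduct C Q1 Q2 Q i1 i2 p1 p2"
            using split_le[OF Q] by blast
          note b = biproductD[OF q(3)]
          have y': "y \<Colon> B \<leadsto> Q" using y E by simp
          have y1: "p1 \<cdot> y \<Colon> B \<leadsto> Q1" and y2: "p2 \<cdot> y \<Colon> B \<leadsto> Q2" using y' b by blast+
          have "(p1 \<cdot> y) \<cdot> u = Zero C A Q1"
            using assoc[OF u y' b(3)] z E comp_zero[OF b(3) arr_obD(1)[OF u]] by simp
          then have "p1 \<cdot> y = Zero C B Q1"
            using mono SO.is_mono_iff[OF uS] y1 q(1) AB(2) by (auto simp: arr_def)
          moreover have "p2 \<cdot> y = Zero C B Q2" using hom_ge_le[of B "- 1" Q2] B q(2) y2 by simp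
          ultimately have "Add C (i1 \<cdot> (p1 \<cdot> y)) (i2 \<cdot> (p2 \<cdot> y)) = Zero C B Q"
            using comp_zero[OF b(1)] comp_zero[OF b(2)] arr_obD[OF y'] add_zero(1)[of "Zero C B Q" B Q] by auto
          then show ?thesis
            using add_comp[OF y' comp_arr[OF b(3,1)] comp_arr[OF b(4,2)]] b(9) id_comp[OF y']
              assoc[OF y' b(3,1)] assoc[OF y' b(4,2)] E by simp
        qed
        fix Q y assume Q: "Q \<in> le (- 1)" "y \<Colon>\<^bsub>opp C\<^esub> Q \<leadsto> E (Suc ?K - (d + 2))"
          "e (?K - (d + 2)) \<cdot>\<^bsub>opp C\<^esub> y = Zero (opp C) Q (E (Suc ?K - (d + 3)))"
        have i: "Suc ?K - (d + 2) = Suc 0" "?K - (d + 2) = 0" "Suc ?K - (d + 3) = 0" using d(2) by simp_all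
        show "y = Zero (opp C) Q (E (Suc ?K - (d + 2)))"
          using helix_epi_shift[OF h, of "- 1" "m + 1" 0 Q y] inj Q unfolding i by simp
      qed
      then show "\<exists>E e. cokernel_helix (opp C) ?S (le (- 1)) d B A u E e" by blast
    qed
    then show "\<forall>A\<in>?S. \<forall>B\<in>?S. \<forall>u\<in>Hom C A B. \<exists>E e. cokernel_helix C ?S (ge (int m + 1)) d A B u E e"
      "\<forall>A\<in>?S. \<forall>B\<in>?S. \<forall>u\<in>Hom C A B. \<exists>E e. cokernel_helix (opp C) ?S (le (- 1)) d B A u E e" by blast+
  qed
  show ?thesis
    unfolding d_def[symmetric]
    using d_abelian_from_helices[OF S_Ob d(1) additive_trunc idempotent_complete_trunc Z zero_in_levels(1)[OF Z]
        zero_in_levels(2)[OF Z] orth orth' right left] idempotent_complete_levels[OF ic] by blast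
qed

end

theorem theoremD:
  fixes T :: "('o, 'm) preadd"
    and So :: "'o \<Rightarrow> 'o" and Sm :: "'m \<Rightarrow> 'm"
    and n m :: nat
    and angle :: "(nat \<Rightarrow> 'o) \<Rightarrow> (nat \<Rightarrow> 'm) \<Rightarrow> bool"
    and \<aa> :: "int \<Rightarrow> 'o set"
  assumes "n \<ge> 1"
    and "angulated_category T So Sm n angle"
    and "\<And>p. additive_subcategory T (\<aa> p)"
    and "\<And>p q X Y. \<lbrakk>q \<notin> {p, p + 1}; X \<in> \<aa> p; Y \<in> \<aa> q\<rbrakk> \<Longrightarrow> Hom T X Y = {Zero T X Y}"
    and "\<And>t. t \<in> Ob T \<Longrightarrow>
           \<exists>s i a j p. i \<le> s \<and> (\<forall>k\<in>{i..s}. a k \<in> \<aa> k) \<and> is_direct_sum T {i..s} a t j p"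
    and "\<And>j. \<aa> j = ob_power T So j ` \<aa> 0"
    and "idempotent_complete (full_subcategory T (\<aa> 0))"
    and "closed_under_n_extensions T So n angle (trunc T \<aa> 0 (int m + 1))"
  shows "d_abelian ((n + 2) * (m + 1) - 2) (full_subcategory T (trunc T \<aa> 0 (int m)))"
proof -
  interpret angulated_category T So Sm n angle by (fact assms(2))
  have ob: "\<aa> p \<subseteq> Ob T" for p using assms(3) by (simp add: additive_subcategory_def)
  interpret leveled_angulated_category T So Sm n angle \<aa>
  proof unfold_locales
    show "f = Zero T X Y" if "q < p" "X \<in> \<aa> p" "Y \<in> \<aa> q" "f \<Colon>\<^bsub>T\<^esub> X \<leadsto> Y" for p q X Y f
      using assms(4)[of q p X Y] that by (simp add: arr_def)
    show "\<exists>s i a j p. (\<forall>k\<in>{i..s}. a k \<in> \<aa> k) \<and> is_direct_sum T {i..s} a t j p" if "t \<in> Ob T" for t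
      using assms(5)[OF that] by blast
    show "\<aa> (p + 1) = So ` \<aa> p" for p
      by (rule image_ob_power[OF So_bij ob assms(6)])
  qed (use ob assms(1) in auto)
  show ?thesis by (rule trunc_d_abelian[OF assms(8,7)])
qed

end
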